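(* For the random geometric graph $G_n$ (with any $r=r(n)>0$, $r(n)\to0$), $\chi(G_n)/\chi_f(G_n)\to1$ almost surely.
   Context: Setup: $d\ge1$, a norm $\|\cdot\|$ on $\mathbb R^d$; $\nu$ a probability distribution on $\mathbb R^d$ with bounded density; $X_1,X_2,\dots$ i.i.d. $\sim\nu$; $G_n$ has vertices $1,\dots,n$, distinct $i,j$ adjacent iff $\|X_i-X_j\|\le r(n)$. $\chi_f(G)$ is the fractional chromatic number: the optimal value of $\min 1^Tx$ subject to $Ax\ge 1$, $x\ge0$, where $A$ is the vertex–stable-set incidence matrix of $G$. *)

theory Defs
  imports "HOL-Probability.Probability"
begin

text \<open>Finite simple graphs given by a vertex set V and a symmetric adjacency predicate E.\<close>

definition proper_colouring :: "'v set \<Rightarrow> ('v \<Rightarrow> 'v \<Rightarrow> bool) \<Rightarrow> nat \<Rightarrow> ('v \<Rightarrow> nat) \<Rightarrow> bool" where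
  "proper_colouring V E k c \<longleftrightarrow>
     (\<forall>v\<in>V. c v < k) \<and> (\<forall>u\<in>V. \<forall>v\<in>V. u \<noteq> v \<and> E u v \<longrightarrow> c u \<noteq> c v)"

definition chromatic_number :: "'v set \<Rightarrow> ('v \<Rightarrow> 'v \<Rightarrow> bool) \<Rightarrow> nat" where
  "chromatic_number V E = (LEAST k. \<exists>c. proper_colouring V E k c)"

definition stable_sets :: "'v set \<Rightarrow> ('v \<Rightarrow> 'v \<Rightarrow> bool) \<Rightarrow> 'v set set" where
  "stable_sets V E = {S. S \<subseteq> V \<and> (\<forall>u\<in>S. \<forall>v\<in>S. u \<noteq> v \<longrightarrow> \<not> E u v)}"

definition fractional_chromatic_number :: "'v set \<Rightarrow> ('v \<Rightarrow> 'v \<Rightarrow> bool) \<Rightarrow> real" where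
  "fractional_chromatic_number V E =
     Inf {(\<Sum>S\<in>stable_sets V E. x S) | x.
            (\<forall>S\<in>stable_sets V E. x S \<ge> 0) \<and>
            (\<forall>v\<in>V. (\<Sum>S\<in>{S\<in>stable_sets V E. v \<in> S}. x S) \<ge> 1)}"

definition is_norm :: "(real^'d \<Rightarrow> real) \<Rightarrow> bool" where
  "is_norm N \<longleftrightarrow> (\<forall>x. N x = 0 \<longleftrightarrow> x = 0) \<and> (\<forall>x y. N (x + y) \<le> N x + N y)
      \<and> (\<forall>c x. N (c *\<^sub>R x) = \<bar>c\<bar> * N x)"

text \<open>Adjacency of the random geometric graph G_n (vertex set {1..n}).\<close>
definition rgg_adj :: "(real^'d \<Rightarrow> real) \<Rightarrow> (nat \<Rightarrow> real^'d) \<Rightarrow> real \<Rightarrow> nat \<Rightarrow> nat \<Rightarrow> bool" where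
  "rgg_adj N x r i j \<longleftrightarrow> i \<noteq> j \<and> N (x i - x j) \<le> r"

end

theory Submission
  imports Defs "HOL-Combinatorics.Multiset_Permutations" "HOL-Real_Asymp.Real_Asymp"
begin

text \<open>
  Cover space by a fine grid of cells and write w for the cell counts in a large box of cells.
  Shifting a partition into large boxes, splitting the points of each cell evenly among the shifts and
  rounding up a fractional cover of the weighted cell graph shows that the chromatic number is, up
  to a factor close to 1 and an additive constant, at most the maximal weighted fractional
  chromatic number of a box. Conversely each box of a slightly finer grid bounds the
  fractional chromatic number from below, because there the points of adjacent cells are
  adjacent in the graph. So it suffices that every count profile of a coarse box is, after scaling by
  some a' < 1, dominated by a profile of some fine box.

  Let \<mu> be the maximal expected count of a coarse cell. A profile w has probability about exp (- R w)
  with R the sum of the Poisson rates w ln (w/\<mu>) - w + \<mu>, so only profiles with R w at most about ln n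
  occur. Since the rate is homogeneous in (w, \<mu>), the profile a w in fine boxes of mean a \<mu> has
  probability at least n^(-a), up to lower order factors, while there are almost n places for it
  where the density is close to its supremum; the second moment method produces one. If \<mu> is a large
  multiple of ln n, all counts are concentrated. If \<mu> is at most n^(-\<alpha>), additive constants matter; then
  the clusters have bounded size and the chromatic number is the clique number. To obtain almost sure
  convergence for an arbitrary sequence r, the bounds are proved for all n and r in geometric
  blocks at once.
\<close>

section \<open>Colourings and fractional covers\<close>

text \<open>The exceptional probabilities obtained are only t^(-\<kappa>) with a small \<kappa>, so
  they cannot be summed over n, and r is known only through positivity and its limit. Monotonicity
  answers both: for t \<le> n \<le> \<rho> t and radii between r and \<rho> r, upper bounds are
  taken at the largest n and radius, lower bounds from the first t points and the smallest radius.
  With coarse side s = \<epsilon> \<rho> r and fine side \<tau> s, the one relation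
  \<open>cell_adj N \<epsilon>\<close> relates the coarse cells of adjacent points and makes points
  of related fine cells adjacent. Both bounds therefore concern the same cell graph, and only the
  mean count per cell drops, by the factor a = \<tau>^d / \<rho>. That a is strictly below 1
  separates the union bound for coarse boxes from the second moment for fine ones by a power of t,
  which swallows the polylogarithmic number of profiles. The two sides are only compared; the value
  of a box is never computed.\<close>

lemma chromatic_number_le:
  assumes "finite C" "c ` V \<subseteq> C"
    and "\<And>u v. u \<in> V \<Longrightarrow> v \<in> V \<Longrightarrow> u \<noteq> v \<Longrightarrow> E u v \<Longrightarrow> c u \<noteq> c v"
  shows "chromatic_number V E \<le> card C"
proof -
  obtain h where h: "bij_betw h C {0..<card C}"
    using ex_bij_betw_finite_nat[OF assms(1)] by blast
  have "proper_colouring V E (card C) (h \<circ> c)"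
    unfolding proper_colouring_def
  proof (intro conjI ballI impI)
    fix v assume "v \<in> V"
    then have "h (c v) \<in> {0..<card C}" using h assms(2) by (meson bij_betwE image_subset_iff)
    then show "(h \<circ> c) v < card C" by simp
  next
    fix u v assume *: "u \<in> V" "v \<in> V" "u \<noteq> v \<and> E u v"
    then have "c u \<noteq> c v" using assms(3) by auto
    moreover have "c u \<in> C" "c v \<in> C" using * assms(2) by auto
    ultimately show "(h \<circ> c) u \<noteq> (h \<circ> c) v"
      using h by (auto simp: bij_betw_def inj_on_def)
  qed
  then show ?thesis unfolding chromatic_number_def by (intro Least_le) blast
qed

lemma chromatic_number_colouring:
  assumes "finite V"
  obtains c where "proper_colouring V E (chromatic_number V E) c"
proof -
  obtain h where h: "bij_betw h V {0..<card V}"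
    using ex_bij_betw_finite_nat[OF assms] by blast
  have "proper_colouring V E (card V) h"
    unfolding proper_colouring_def using h by (auto simp: bij_betw_def inj_on_def) 
  then have "\<exists>k c. proper_colouring V E k c" by blast
  then have "\<exists>c. proper_colouring V E (chromatic_number V E) c"
    unfolding chromatic_number_def by (rule LeastI_ex)
  then show thesis using that by blast
qed

lemma not_colourable_below_chromatic_number:
  assumes "k < chromatic_number V E"
  shows "\<not> proper_colouring V E k c"
  using assms not_less_Least unfolding chromatic_number_def by blast

section \<open>Fractional covers of weighted graphs\<close>

lemma finite_stable_sets: "finite V \<Longrightarrow> finite (stable_sets V E)"
  by (rule finite_subset[of _ "Pow V"]) (auto simp: stable_sets_def)

text \<open>Feasibility of the covering program with vertex weights w and budget T. Arguing with
  every feasible T rather than with the optimal value keeps infima out of the proof until the end,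
  and one given solution can be projected, scaled and rounded.\<close>

definition fractional_cover ::
    "'v set \<Rightarrow> ('v \<Rightarrow> 'v \<Rightarrow> bool) \<Rightarrow> ('v \<Rightarrow> real) \<Rightarrow> real \<Rightarrow> bool" where
  "fractional_cover V E w T \<longleftrightarrow> (\<exists>x. (\<forall>S\<in>stable_sets V E. 0 \<le> x S) \<and>
     (\<forall>v\<in>V. w v \<le> (\<Sum>S\<in>{S\<in>stable_sets V E. v \<in> S}. x S)) \<and> (\<Sum>S\<in>stable_sets V E. x S) \<le> T)"

lemma fractional_cover_nonneg: "fractional_cover V E w T \<Longrightarrow> 0 \<le> T"
  unfolding fractional_cover_def by (meson order_trans sum_nonneg)

text \<open>Scale the given cover by a and put an extra b on every singleton, which is stable. The
  additive cost \<open>b * card V\<close> is harmless because V is going to be a box with a fixed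
  number of cells.\<close>

lemma fractional_cover_affine:
  assumes "finite V" "fractional_cover V E w T" "0 \<le> a" "0 \<le> b"
    and "\<And>v. v \<in> V \<Longrightarrow> w' v \<le> a * w v + b"
  shows "fractional_cover V E w' (a * T + b * card V)"
proof -
  obtain x where x: "\<And>S. S\<in>stable_sets V E \<Longrightarrow> 0 \<le> x S"
     "\<And>v. v\<in>V \<Longrightarrow> w v \<le> (\<Sum>S\<in>{S\<in>stable_sets V E. v \<in> S}. x S)"
     "(\<Sum>S\<in>stable_sets V E. x S) \<le> T"
    using assms(2) unfolding fractional_cover_def by blast
  define sg where "sg = (\<lambda>v. {v}) ` V"
  have fin: "finite (stable_sets V E)" by (rule finite_stable_sets) fact
  have sg: "sg \<subseteq> stable_sets V E" unfolding sg_def stable_sets_def by auto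
  have csg: "card sg = card V" unfolding sg_def by (rule card_image) (auto simp: inj_on_def)
  define y where "y S = a * x S + (if S \<in> sg then b else 0)" for S
  show ?thesis unfolding fractional_cover_def
  proof (intro exI[of _ y] conjI ballI)
    fix S assume "S \<in> stable_sets V E" then show "0 \<le> y S" using x assms unfolding y_def by auto
  next
    fix v assume v: "v \<in> V"
    let ?A = "{S \<in> stable_sets V E. v \<in> S}"
    have "{v} \<in> ?A \<inter> sg" using v sg unfolding sg_def by auto
    then have "b \<le> (\<Sum>S\<in>?A \<inter> sg. b)"
      using assms(4) sum_mono2[of "?A \<inter> sg" "{{v}}" "\<lambda>_. b"] fin by auto
    also have "\<dots> = (\<Sum>S\<in>?A. if S \<in> sg then b else 0)"
      using fin by (subst sum.inter_restrict) auto
    finally have 1: "b \<le> (\<Sum>S\<in>?A. if S \<in> sg then b else 0)" .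
    have "w' v \<le> a * w v + b" using assms v by auto
    also have "\<dots> \<le> a * (\<Sum>S\<in>?A. x S) + (\<Sum>S\<in>?A. if S \<in> sg then b else 0)"
      using 1 x(2)[OF v] assms(3) by (intro add_mono mult_left_mono) auto
    also have "\<dots> = (\<Sum>S\<in>?A. y S)" unfolding y_def by (simp add: sum.distrib sum_distrib_left)
    finally show "w' v \<le> (\<Sum>S\<in>?A. y S)" .
  next
    have "(\<Sum>S\<in>stable_sets V E. y S) = a * (\<Sum>S\<in>stable_sets V E. x S) 
       + (\<Sum>S\<in>stable_sets V E. if S \<in> sg then b else 0)"
      unfolding y_def by (simp add: sum.distrib sum_distrib_left)
    also have "(\<Sum>S\<in>stable_sets V E. if S \<in> sg then b else 0) = (\<Sum>S\<in>stable_sets V E \<inter> sg. b)"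
      using fin by (subst sum.inter_restrict) auto
    also have "\<dots> = b * card V" using sg csg by (simp add: Int_absorb1)
    finally show "(\<Sum>S\<in>stable_sets V E. y S) \<le> a * T + b * card V"
      using x(3) assms(3) by (simp add: mult_left_mono)
  qed
qed

lemma fractional_chromatic_number_ge:
  assumes "finite V" "\<And>T. fractional_cover V E (\<lambda>_. 1) T \<Longrightarrow> b \<le> T"
  shows "b \<le> fractional_chromatic_number V E"
  unfolding fractional_chromatic_number_def
proof (rule cInf_greatest)
  have fin: "finite (stable_sets V E)" by (rule finite_stable_sets) fact
  \<comment> \<open>Weight 1 on every stable set is feasible, so the set of values is nonempty; only
    then is \<open>Inf\<close> on the reals a greatest lower bound.\<close>
  have "(\<forall>S\<in>stable_sets V E. (1::real) \<ge> 0) \<and>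
            (\<forall>v\<in>V. (\<Sum>S\<in>{S\<in>stable_sets V E. v \<in> S}. (1::real)) \<ge> 1)"
  proof (intro conjI ballI)
    fix v assume "v \<in> V"
    then have "{v} \<in> {S\<in>stable_sets V E. v \<in> S}" by (auto simp: stable_sets_def)
    then have "card {S\<in>stable_sets V E. v \<in> S} > 0" using fin by (auto simp: card_gt_0_iff)
    then show "(\<Sum>S\<in>{S\<in>stable_sets V E. v \<in> S}. (1::real)) \<ge> 1" by simp
  qed simp
  then show "{(\<Sum>S\<in>stable_sets V E. x S) | x.
            (\<forall>S\<in>stable_sets V E. x S \<ge> (0::real)) \<and>
            (\<forall>v\<in>V. (\<Sum>S\<in>{S\<in>stable_sets V E. v \<in> S}. x S) \<ge> 1)} \<noteq> {}"
    unfolding ex_in_conv[symmetric] mem_Collect_eq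
    by (intro exI[of _ "\<Sum>S\<in>stable_sets V E. 1"] exI[of _ "\<lambda>_. 1"] conjI refl) auto
qed (use assms in \<open>auto simp: fractional_cover_def\<close>)

lemma fractional_chromatic_number_le:
  assumes "fractional_cover V E (\<lambda>_. 1) T"
  shows "fractional_chromatic_number V E \<le> T"
proof -
  obtain x where x: "\<forall>S\<in>stable_sets V E. 0 \<le> x S"
     "\<forall>v\<in>V. 1 \<le> (\<Sum>S\<in>{S\<in>stable_sets V E. v \<in> S}. x S)"
     "(\<Sum>S\<in>stable_sets V E. x S) \<le> T"
    using assms unfolding fractional_cover_def by blast
  have "fractional_chromatic_number V E \<le> (\<Sum>S\<in>stable_sets V E. x S)"
    unfolding fractional_chromatic_number_def
  proof (rule cInf_lower)
    show "bdd_below {(\<Sum>S\<in>stable_sets V E. x S) | x.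
            (\<forall>S\<in>stable_sets V E. x S \<ge> (0::real)) \<and>
            (\<forall>v\<in>V. (\<Sum>S\<in>{S\<in>stable_sets V E. v \<in> S}. x S) \<ge> 1)}"
      by (rule bdd_belowI[of _ 0]) (auto intro: sum_nonneg)
  qed (use x in auto)
  then show ?thesis using x by simp
qed

lemma fractional_chromatic_number_le_chromatic_number:
  assumes "finite V"
  shows "fractional_chromatic_number V E \<le> chromatic_number V E"
proof -
  obtain c where c: "proper_colouring V E (chromatic_number V E) c"
    using chromatic_number_colouring[OF assms] by blast
  let ?k = "chromatic_number V E"
  define cl where "cl j = {v \<in> V. c v = j}" for j
  define x where "x S = real (card {j\<in>{..<?k}. cl j = S})" for S
  have fin: "finite (stable_sets V E)" by (rule finite_stable_sets) fact
  have cl: "cl j \<in> stable_sets V E" for j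
    using c unfolding cl_def stable_sets_def proper_colouring_def by fastforce
  have "fractional_cover V E (\<lambda>_. 1) ?k"
    unfolding fractional_cover_def
  proof (intro exI[of _ x] conjI ballI)
    fix v assume v: "v \<in> V"
    let ?A = "{S \<in> stable_sets V E. v \<in> S}"
    have "cl (c v) \<in> ?A" using cl v by (auto simp: cl_def)
    moreover have "1 \<le> x (cl (c v))"
    proof -
      have "c v \<in> {j\<in>{..<?k}. cl j = cl (c v)}"
        using c v by (auto simp: proper_colouring_def)
      then have "card {j\<in>{..<?k}. cl j = cl (c v)} > 0" by (auto simp: card_gt_0_iff)
      then show ?thesis unfolding x_def by simp
    qed
    ultimately show "1 \<le> (\<Sum>S\<in>?A. x S)"
      using member_le_sum[of "cl (c v)" ?A x] fin by (simp add: x_def)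
  next
    have "(\<Sum>S\<in>stable_sets V E. x S) = (\<Sum>S\<in>stable_sets V E. \<Sum>j\<in>{j\<in>{..<?k}. cl j = S}. 1)"
      unfolding x_def by simp
    also have "\<dots> = (\<Sum>j<?k. 1)"
      by (rule sum.group) (use fin cl in auto)
    finally show "(\<Sum>S\<in>stable_sets V E. x S) \<le> real ?k" by simp
  qed (simp add: x_def)
  then show ?thesis by (rule fractional_chromatic_number_le)
qed

text \<open>A stable set meets each fibre of g in at most one vertex, so it projects to a
  stable set of the quotient graph.\<close>
lemma fractional_cover_quotient:
  assumes "finite V" "finite Q" "U \<subseteq> V" "fractional_cover V E (\<lambda>_. 1) T"
    and "\<And>u v. u \<in> U \<Longrightarrow> v \<in> U \<Longrightarrow> u \<noteq> v \<Longrightarrow> g u \<in> Q \<Longrightarrow> g v \<in> Q \<Longrightarrow> g u = g v \<or> H (g u) (g v) \<Longrightarrow> E u v"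
  shows "fractional_cover Q H (\<lambda>q. card {u\<in>U. g u = q}) T"
proof -
  obtain x where x: "\<And>S. S\<in>stable_sets V E \<Longrightarrow> 0 \<le> x S"
     "\<And>v. v\<in>V \<Longrightarrow> 1 \<le> (\<Sum>S\<in>{S\<in>stable_sets V E. v \<in> S}. x S)"
     "(\<Sum>S\<in>stable_sets V E. x S) \<le> T"
    using assms(4) unfolding fractional_cover_def by blast
  have fin: "finite (stable_sets V E)" "finite (stable_sets Q H)"
    using finite_stable_sets assms by auto
  define pr where "pr S = g ` (S \<inter> U) \<inter> Q" for S
  have pr: "pr S \<in> stable_sets Q H" if "S \<in> stable_sets V E" for S
  proof -
    have "\<not> H q q'" if q: "q \<in> pr S" "q' \<in> pr S" "q \<noteq> q'" for q q'
    proof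
      assume h: "H q q'"
      obtain u v where uv: "u \<in> S" "u \<in> U" "q = g u" "v \<in> S" "v \<in> U" "q' = g v" "q \<in> Q" "q' \<in> Q"
        using q unfolding pr_def by blast
      moreover have "u \<noteq> v" using uv q(3) by auto
      ultimately have "E u v" using assms(5)[of u v] h by auto
      moreover have "u \<noteq> v" using uv q(3) by auto
      ultimately show False using \<open>S \<in> stable_sets V E\<close> uv by (auto simp: stable_sets_def)
    qed
    then show ?thesis unfolding stable_sets_def by (auto simp: pr_def)
  qed
  \<comment> \<open>Push the weight forward along the projection of stable sets; the total is
    preserved.\<close>
  define y where "y A = (\<Sum>S\<in>{S\<in>stable_sets V E. pr S = A}. x S)" for A
  show ?thesis unfolding fractional_cover_def
  proof (intro exI[of _ y] conjI ballI)
    fix A show "0 \<le> y A" unfolding y_def by (rule sum_nonneg) (use x in auto)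
  next
    fix q assume q: "q \<in> Q"
    let ?U = "{u\<in>U. g u = q}"
    have finU: "finite ?U" using finite_subset[OF assms(3,1)] by simp
    have "real (card ?U) = (\<Sum>u\<in>?U. 1)" by simp
    also have "\<dots> \<le> (\<Sum>u\<in>?U. \<Sum>S\<in>{S\<in>stable_sets V E. u \<in> S}. x S)"
      by (rule sum_mono) (use x assms(3) in auto)
    also have "\<dots> = (\<Sum>u\<in>?U. \<Sum>S\<in>stable_sets V E. if u \<in> S then x S else 0)"
      by (rule sum.cong) (simp_all add: sum.inter_filter fin)
    also have "\<dots> = (\<Sum>S\<in>stable_sets V E. \<Sum>u\<in>?U. if u \<in> S then x S else 0)"
      by (rule sum.swap)
    also have "\<dots> \<le> (\<Sum>S\<in>stable_sets V E. if q \<in> pr S then x S else 0)"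
    proof (rule sum_mono)
      fix S assume S: "S \<in> stable_sets V E"
      have "(\<Sum>u\<in>?U. if u \<in> S then x S else 0) = card (?U \<inter> S) * x S"
        using finU by (simp add: sum.If_cases Int_def)
      also have "\<dots> \<le> (if q \<in> pr S then x S else 0)"
      proof (cases "q \<in> pr S")
        case True
        have "u = v" if uv: "u \<in> ?U \<inter> S" "v \<in> ?U \<inter> S" for u v
        proof (rule ccontr)
          assume "u \<noteq> v"
          moreover have "g u = g v" "g u \<in> Q" using uv q by auto
          ultimately have "E u v" using uv assms(5)[of u v] by auto
          then show False using S uv \<open>u \<noteq> v\<close> by (auto simp: stable_sets_def)
        qed
        then have "card (?U \<inter> S) \<le> 1" using finU card_le_Suc0_iff_eq[of "?U \<inter> S"] by auto
        then show ?thesis using True x(1)[OF S] mult_right_mono[of "real (card (?U \<inter> S))" 1 "x S"] by auto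
      next
        case False
        then have "?U \<inter> S = {}" unfolding pr_def using q by auto
        then show ?thesis using False by simp
      qed
      finally show "(\<Sum>u\<in>?U. if u \<in> S then x S else 0) \<le> (if q \<in> pr S then x S else 0)" .
    qed
    also have "\<dots> = (\<Sum>S\<in>{S\<in>stable_sets V E. q \<in> pr S}. x S)"
      using fin by (simp add: sum.inter_filter)
    also have "\<dots> = (\<Sum>A\<in>{A\<in>stable_sets Q H. q \<in> A}. \<Sum>S\<in>{S\<in>{S\<in>stable_sets V E. q \<in> pr S}. pr S = A}. x S)"
      by (rule sum.group[symmetric]) (use fin pr in auto)
    also have "\<dots> = (\<Sum>A\<in>{A\<in>stable_sets Q H. q \<in> A}. y A)"
      unfolding y_def by (intro sum.cong[OF refl] arg_cong[of _ _ "sum x"]) auto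
    finally show "real (card ?U) \<le> (\<Sum>A\<in>{A\<in>stable_sets Q H. q \<in> A}. y A)" .
  next
    have "(\<Sum>A\<in>stable_sets Q H. y A) = (\<Sum>S\<in>stable_sets V E. x S)"
      unfolding y_def by (rule sum.group) (use fin pr in auto)
    then show "(\<Sum>A\<in>stable_sets Q H. y A) \<le> T" using x by simp
  qed
qed

text \<open>Collapse U to a single vertex: a stable set meets a clique at most once, so the weight
  \<open>card U\<close> of that vertex has to be paid from the total budget.\<close>

lemma fractional_cover_clique:
  fixes T :: real
  assumes "finite V" "U \<subseteq> V" "fractional_cover V E (\<lambda>_. 1) T"
    and "\<And>u v. u \<in> U \<Longrightarrow> v \<in> U \<Longrightarrow> u \<noteq> v \<Longrightarrow> E u v"
  shows "card U \<le> T"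
proof -
  have "fractional_cover {()} (\<lambda>_ _. False) (\<lambda>q. card {u\<in>U. () = q}) T"
    by (rule fractional_cover_quotient[where V = V and E = E and U = U and g = "\<lambda>_. ()"]) (use assms in auto)
  then obtain x :: "unit set \<Rightarrow> real" where x: "\<And>S. S\<in>stable_sets {()} (\<lambda>_ _. False) \<Longrightarrow> 0 \<le> x S"
     "card U \<le> (\<Sum>S\<in>{S\<in>stable_sets {()} (\<lambda>_ _. False). () \<in> S}. x S)"
     "(\<Sum>S\<in>stable_sets {()} (\<lambda>_ _. False). x S) \<le> T"
    unfolding fractional_cover_def by auto
  have "(\<Sum>S\<in>{S\<in>stable_sets {()} (\<lambda>_ _. False). () \<in> S}. x S) \<le> (\<Sum>S\<in>stable_sets {()} (\<lambda>_ _. False). x S)"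
    by (rule sum_mono2) (use x finite_stable_sets[of "{()}"] in auto)
  then show ?thesis using x by simp
qed

section \<open>Colouring by shifted boxes\<close>

definition cube :: "nat \<Rightarrow> (int^'d) set" where
  "cube K = {z. \<forall>i. 0 \<le> z $ i \<and> z $ i < int K}"

lemma finite_cube: "finite (cube K :: (int^'d) set)"
  and card_cube: "card (cube K :: (int^'d) set) = K ^ CARD('d)"
proof -
  have b: "bij_betw vec_nth (cube K :: (int^'d) set) (PiE UNIV (\<lambda>_. {0..<int K}))"
    by (rule bij_betwI[where g = "\<lambda>f. \<chi> i. f i"]) (auto simp: cube_def PiE_def Pi_def)
  show "finite (cube K :: (int^'d) set)"
    using bij_betw_finite[OF b] by (simp add: finite_PiE)
  show "card (cube K :: (int^'d) set) = K ^ CARD('d)"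
    using bij_betw_same_card[OF b] by (simp add: card_PiE)
qed

text \<open>The K-boxes congruent to a fixed residue modulo K, each shrunk to side K - b,
  do not interact, so they can share colours. Every cell lies in shrunken boxes of (K - b)^d of the
  K^d residues, and its points are distributed evenly among these.\<close>
lemma chromatic_number_le_box_cover:
  fixes c :: "'v \<Rightarrow> int^'d" and R :: "int^'d \<Rightarrow> bool"
  assumes "finite V" "b < K"
    and R: "\<And>u v. u \<in> V \<Longrightarrow> v \<in> V \<Longrightarrow> u \<noteq> v \<Longrightarrow> E u v \<Longrightarrow> R (c u - c v)"
    and b: "\<And>e i. R e \<Longrightarrow> \<bar>e $ i\<bar> \<le> int b"
    and cov: "\<And>z. fractional_cover (cube K) (\<lambda>p q. R (p - q)) (\<lambda>p. card {u\<in>V. c u = z + p}) T"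
  shows "chromatic_number V E \<le>
    real K ^ CARD('d) * (T / real (K - b) ^ CARD('d) + 2 * 2 ^ (K ^ CARD('d)))"
proof -
  let ?H = "\<lambda>p q. R (p - q)"
  let ?S = "stable_sets (cube K) ?H"
  define D where "D = (K - b) ^ CARD('d)"
  have D0: "D > 0" using assms(2) by (simp add: D_def)
  have finS: "finite ?S" by (rule finite_stable_sets) (rule finite_cube)
  have cardS: "card ?S \<le> 2 ^ (K ^ CARD('d))"
  proof -
    have "card ?S \<le> card (Pow (cube K :: (int^'d) set))"
      by (rule card_mono) (auto simp: stable_sets_def finite_cube)
    then show ?thesis by (simp add: card_Pow finite_cube card_cube)
  qed
  have T0: "0 \<le> T" using cov fractional_cover_nonneg by blast
  have "\<exists>x. (\<forall>S\<in>?S. 0 \<le> x S) \<and>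
     (\<forall>p\<in>cube K. real (card {u\<in>V. c u = z + p}) \<le> (\<Sum>S\<in>{S\<in>?S. p \<in> S}. x S)) \<and> (\<Sum>S\<in>?S. x S) \<le> T" for z
    using cov[of z] unfolding fractional_cover_def .
  then have "\<exists>x. \<forall>z. (\<forall>S\<in>?S. 0 \<le> x z S) \<and>
     (\<forall>p\<in>cube K. real (card {u\<in>V. c u = z + p}) \<le> (\<Sum>S\<in>{S\<in>?S. p \<in> S}. x z S)) \<and> (\<Sum>S\<in>?S. x z S) \<le> T"
    by (intro choice allI)
  then obtain x where x: "\<forall>z. (\<forall>S\<in>?S. 0 \<le> x z S) \<and>
     (\<forall>p\<in>cube K. real (card {u\<in>V. c u = z + p}) \<le> (\<Sum>S\<in>{S\<in>?S. p \<in> S}. x z S)) \<and> (\<Sum>S\<in>?S. x z S) \<le> T" ..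
  have x0: "0 \<le> x z S" if "S \<in> ?S" for z S using x that by simp
  have x1: "real (card {u\<in>V. c u = z + p}) \<le> (\<Sum>S\<in>{S\<in>?S. p \<in> S}. x z S)" if "p \<in> cube K" for z p
    using x that by simp
  have x2: "(\<Sum>S\<in>?S. x z S) \<le> T" for z using x by simp
  \<comment> \<open>In the box with corner z, the stable set S is turned into \<open>y z S\<close>
    colours: its weight divided by D, rounded up, plus one. This exceeds the share by at most 2 per
    stable set, which is the additive term of the conclusion.\<close>
  define y where "y z S = nat \<lceil>x z S / D\<rceil> + 1" for z S
  define A where "A z = (SIGMA S:?S. {..<y z S})" for z
  define B where "B z p = (SIGMA S:{S\<in>?S. p \<in> S}. {..<y z S})" for z p
  define M where "M = nat \<lfloor>T / D + 2 * 2 ^ (K ^ CARD('d))\<rfloor>"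
  have finA: "finite (A z)" for z unfolding A_def using finS by auto
  have BA: "B z p \<subseteq> A z" for z p unfolding A_def B_def by auto
  have y_le: "real (y z S) \<le> x z S / D + 2" if "S \<in> ?S" for z S
    using x0[OF that, of z] unfolding y_def by (simp add: ceiling_correct of_nat_nat) linarith
  have cardA: "card (A z) \<le> M" for z
  proof -
    have "real (card (A z)) = (\<Sum>S\<in>?S. real (y z S))"
      unfolding A_def using finS by (simp add: card_SigmaI)
    also have "\<dots> \<le> (\<Sum>S\<in>?S. x z S / D + 2)" by (rule sum_mono) (rule y_le)
    also have "\<dots> = (\<Sum>S\<in>?S. x z S) / D + 2 * card ?S"
      by (simp add: sum.distrib sum_divide_distrib)
    also have "\<dots> \<le> T / D + 2 * 2 ^ (K ^ CARD('d))"
    proof -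
      have "real (card ?S) \<le> 2 ^ (K ^ CARD('d))" using cardS by (metis of_nat_le_iff of_nat_numeral of_nat_power)
      moreover have "(\<Sum>S\<in>?S. x z S) / D \<le> T / D" using x2 by (simp add: divide_right_mono)
      ultimately show ?thesis by linarith
    qed
    finally show ?thesis unfolding M_def by linarith
  qed
  have cardB: "real (card {u\<in>V. c u = z + p}) / D + 1 \<le> card (B z p)" if p: "p \<in> cube K" for z p
  proof -
    let ?Sp = "{S\<in>?S. p \<in> S}"
    have "{p} \<in> ?Sp" using p by (auto simp: stable_sets_def)
    then have "card ?Sp > 0" using finS by (auto simp: card_gt_0_iff)
    then have ne: "1 \<le> card ?Sp" by simp
    have "real (card {u\<in>V. c u = z + p}) / D + 1 \<le> (\<Sum>S\<in>?Sp. x z S) / D + card ?Sp"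
      using x1[OF p, of z] ne by (intro add_mono divide_right_mono) auto
    also have "\<dots> = (\<Sum>S\<in>?Sp. x z S / D + 1)" by (simp add: sum.distrib sum_divide_distrib)
    also have "\<dots> \<le> (\<Sum>S\<in>?Sp. real (y z S))"
      by (rule sum_mono) (simp add: y_def, linarith)
    also have "\<dots> = card (B z p)" unfolding B_def using finS by (simp add: card_SigmaI)
    finally show ?thesis .
  qed
  have "\<exists>h. inj_on h (A z) \<and> h ` A z \<subseteq> {..<M}" for z
    using card_le_inj[OF finA[of z], of "{..<M}"] cardA[of z] by auto
  \<comment> \<open>All boxes use the same M colour names: h embeds the colours of a box into them,
    and g below lists those colours of a box whose stable set contains the cell p.\<close>
  then obtain h where h: "\<And>z. inj_on (h z) (A z)" "\<And>z. h z ` A z \<subseteq> {..<M}" by metis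
  have "\<exists>g. bij_betw g {0..<card (B z p)} (B z p)" for z p
    using ex_bij_betw_nat_finite finite_subset[OF BA finA] by blast
  then obtain g where g: "\<And>z p. bij_betw (g z p) {0..<card (B z p)} (B z p)" by metis
  obtain e where e: "bij_betw e {0..<D} (cube (K - b) :: (int^'d) set)"
    using ex_bij_betw_nat_finite[OF finite_cube[where 'd='d]] unfolding D_def card_cube[where 'd='d,symmetric] by blast
  have "\<exists>rk. bij_betw rk {u\<in>V. c u = w} {0..<card {u\<in>V. c u = w}}" for w
    by (rule ex_bij_betw_finite_nat) (use assms(1) in auto)
  then obtain rk0 where rk0: "\<And>w. bij_betw (rk0 w) {u\<in>V. c u = w} {0..<card {u\<in>V. c u = w}}" by metis
  define rk where "rk u = rk0 (c u) u" for u
  \<comment> \<open>The rank of a point in its cell, modulo D, decides at which place of a shrunken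
    box the cell is put for this point, hence the shift. The rank divided by D numbers the points
    that share the place, and these get different colours.\<close>
  define off where "off u = e (rk u mod D)" for u
  define base where "base u = c u - off u" for u
  define res where "res u = (\<chi> i. base u $ i mod int K)" for u
  define col where "col u = (res u, h (base u) (g (base u) (off u) (rk u div D)))" for u
  have offin: "off u \<in> cube (K - b)" for u
    using bij_betwE[OF e] D0 unfolding off_def by auto
  have offK: "off u \<in> cube K" for u
  proof -
    have "cube (K - b) \<subseteq> (cube K :: (int^'d) set)"       unfolding cube_def by (auto intro: order_less_le_trans)
    then show ?thesis using offin by blast
  qed
  have gin: "g (base u) (off u) (rk u div D) \<in> B (base u) (off u)"
    and glt: "rk u div D < card (B (base u) (off u))" if u: "u \<in> V" for u
  proof -
    have cu: "base u + off u = c u" unfolding base_def by simp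
    have "rk u < card {v\<in>V. c v = c u}"
      using bij_betwE[OF rk0[of "c u"]] u unfolding rk_def by auto
    then have "real (rk u) < card {v\<in>V. c v = c u}" by simp
    then have "real (rk u) / D \<le> card {v\<in>V. c v = c u} / D" by (simp add: divide_right_mono)
    moreover have "real (rk u div D) \<le> real (rk u) / D"
      using of_nat_div_le_of_nat by blast
    moreover note cardB[OF offK[of u], of "base u"]
    ultimately have "real (rk u div D) < card (B (base u) (off u))" unfolding cu by linarith
    then show "rk u div D < card (B (base u) (off u))" by simp
    then show "g (base u) (off u) (rk u div D) \<in> B (base u) (off u)"
      using bij_betwE[OF g] by auto
  qed
  have proper: "col u \<noteq> col v" if uv: "u \<in> V" "v \<in> V" "u \<noteq> v" "E u v" for u v
  proof
    assume eq: "col u = col v"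
    have Ruv: "R (c u - c v)" using R uv by blast
    have "base u = base v"
    proof -
      have "base u $ i = base v $ i" for i
      proof -
        have "base u $ i mod int K = base v $ i mod int K"
          using eq unfolding col_def res_def by (metis Pair_inject vec_lambda_beta)
        then have dv: "int K dvd (base u $ i - base v $ i)" by (simp add: mod_eq_dvd_iff)
        have 1: "\<bar>c u $ i - c v $ i\<bar> \<le> int b" using b[OF Ruv, of i] by simp
        have 2: "0 \<le> off u $ i" "off u $ i < int (K - b)" "0 \<le> off v $ i" "off v $ i < int (K - b)"
          using offin[of u] offin[of v] unfolding cube_def by auto
        \<comment> \<open>Places differ by less than K - b and cells of adjacent points by at most
          b, so corners that are congruent modulo K are equal. The boxes were shrunk by b for
          this.\<close>
        have "base u $ i - base v $ i = (c u $ i - c v $ i) - (off u $ i - off v $ i)"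
          unfolding base_def by simp
        then have "\<bar>base u $ i - base v $ i\<bar> < int K" using 1 2 assms(2) by linarith
        then show ?thesis using dv dvd_imp_le_int[of "base u $ i - base v $ i" "int K"] by force
      qed
      then show ?thesis by (simp add: vec_eq_iff)
    qed
    note bs = this
    have "h (base u) (g (base u) (off u) (rk u div D)) = h (base u) (g (base v) (off v) (rk v div D))"
      using eq bs unfolding col_def by auto
    then have geq: "g (base u) (off u) (rk u div D) = g (base v) (off v) (rk v div D)"
      by (rule inj_onD[OF h(1)[of "base u"]])
        (use gin[OF uv(1)] gin[OF uv(2)] BA[of "base u" "off u"] BA[of "base u" "off v"] bs in auto)
    \<comment> \<open>Equal colours carry the same stable set of the box, and it contains the places
      of both cells. Hence the cells are equal, and the numbering by rank then separates the
      points.\<close>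
    then have "off u \<in> fst (g (base u) (off u) (rk u div D)) \<and> off v \<in> fst (g (base u) (off u) (rk u div D))
      \<and> fst (g (base u) (off u) (rk u div D)) \<in> ?S"
      using gin[OF uv(1)] gin[OF uv(2)] unfolding B_def by auto
    then have st: "off u \<noteq> off v \<longrightarrow> \<not> R (off u - off v)" unfolding stable_sets_def by auto
    have "c u - c v = off u - off v" using bs unfolding base_def by (simp add: algebra_simps)
    then have oeq: "off u = off v" using st Ruv by auto
    then have ceq: "c u = c v" using bs unfolding base_def by simp
    have "rk u div D = rk v div D"
      using geq bij_betw_imp_inj_on[OF g[of "base u" "off u"]] glt[OF uv(1)] glt[OF uv(2)] bs oeq
      by (auto dest!: inj_onD)
    moreover have "rk u mod D = rk v mod D"
      using oeq bij_betw_imp_inj_on[OF e] D0 unfolding off_def by (auto dest!: inj_onD)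
    ultimately have "rk u = rk v" by (metis div_mult_mod_eq)
    then have "u = v" using bij_betw_imp_inj_on[OF rk0[of "c u"]] uv ceq unfolding rk_def
      by (auto dest!: inj_onD)
    then show False using uv by simp
  qed
  have "col ` V \<subseteq> cube K \<times> {..<M}"
  proof
    fix k assume "k \<in> col ` V"
    then obtain u where u: "u \<in> V" "k = col u" by auto
    have "res u \<in> cube K" using assms(2) unfolding res_def cube_def by auto
    moreover have "h (base u) (g (base u) (off u) (rk u div D)) < M"
      using h(2) gin[OF u(1)] BA by blast
    ultimately show "k \<in> cube K \<times> {..<M}" using u unfolding col_def by auto
  qed
  then have "chromatic_number V E \<le> card ((cube K :: (int^'d) set) \<times> {..<M})"
    by (intro chromatic_number_le[where c = col] proper) (simp add: finite_cube)
  then have "real (chromatic_number V E) \<le> real K ^ CARD('d) * real M"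
    by (simp add: card_cartesian_product card_cube del: of_nat_mult flip: of_nat_power of_nat_mult)
  also have "\<dots> \<le> real K ^ CARD('d) * (T / D + 2 * 2 ^ (K ^ CARD('d)))"
  proof (rule mult_left_mono)
    have "0 \<le> T / D + 2 * 2 ^ (K ^ CARD('d))" using T0 by simp
    then show "real M \<le> T / D + 2 * 2 ^ (K ^ CARD('d))" unfolding M_def by linarith
  qed simp
  finally show ?thesis unfolding D_def by simp
qed

text \<open>A vertex-critical subgraph U of G has minimum degree at least its chromatic number minus
  one; unless a closed neighbourhood in U is a clique, some ball of radius two is too large.\<close>
lemma chromatic_number_le_cover_of_small_balls:
  fixes E :: "'v \<Rightarrow> 'v \<Rightarrow> bool" and T :: real
  assumes "finite V" and sym: "\<And>u v. E u v \<Longrightarrow> E v u" and irr: "\<And>u. \<not> E u u"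
    and ball: "\<And>u. u \<in> V \<Longrightarrow> card {v\<in>V. v = u \<or> E u v \<or> (\<exists>w\<in>V. E u w \<and> E w v)} \<le> j + 1"
    and cov: "fractional_cover V E (\<lambda>_. 1) T" and j: "real j \<le> T"
  shows "chromatic_number V E \<le> T"
proof (cases "chromatic_number V E \<le> j")
  case True
  then show ?thesis using j by linarith
next
  case False
  define m where "m = chromatic_number V E - 1"
  have m: "chromatic_number V E = m + 1" "j \<le> m" using False unfolding m_def by auto
  \<comment> \<open>Vertex sets on which one colour fewer than V needs does not suffice; a smallest
    one plays the role of the critical subgraph.\<close>
  define bad where "bad U \<longleftrightarrow> U \<subseteq> V \<and> (\<nexists>c. proper_colouring U E m c)" for U
  have "bad V" unfolding bad_def using not_colourable_below_chromatic_number[of m V E] m by auto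
  then obtain U where U: "bad U" and minU: "\<And>U'. bad U' \<Longrightarrow> card U \<le> card U'"
    using ex_has_least_nat[of bad V card] by blast
  have UV: "U \<subseteq> V" and finU: "finite U" using U assms(1) finite_subset unfolding bad_def by auto
  define nb where "nb u = {v\<in>U. E u v}" for u
  have finnb: "finite (nb u)" for u using finU unfolding nb_def by auto
  \<comment> \<open>Otherwise a colouring of U - {u} leaves a colour free for u.\<close>
  have deg: "m \<le> card (nb u)" if u: "u \<in> U" for u
  proof (rule ccontr)
    assume "\<not> m \<le> card (nb u)"
    have "card (U - {u}) < card U" using u finU by (metis card_Diff1_less)
    then have "\<not> bad (U - {u})" using minU by fastforce
    then obtain c where c: "proper_colouring (U - {u}) E m c" using UV unfolding bad_def by auto
    have "card (c ` nb u) < m" using card_image_le[OF finnb[of u], of c] \<open>\<not> m \<le> card (nb u)\<close> by linarith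
    then have "\<not> {..<m} \<subseteq> c ` nb u" using card_mono[of "c ` nb u" "{..<m}"] finnb by fastforce
    then obtain k where k: "k < m" "k \<notin> c ` nb u" by auto
    have "proper_colouring U E m (c(u := k))"
      unfolding proper_colouring_def
    proof (intro conjI ballI impI)
      fix v assume "v \<in> U" then show "(c(u := k)) v < m" using c k unfolding proper_colouring_def by auto
    next
      fix v w assume vw: "v \<in> U" "w \<in> U" "v \<noteq> w \<and> E v w"
      show "(c(u := k)) v \<noteq> (c(u := k)) w"
      proof (cases "v = u \<or> w = u")
        case True
        then show ?thesis using vw k sym unfolding nb_def by auto
      next
        case False
        then show ?thesis using vw c unfolding proper_colouring_def by auto
      qed
    qed
    then show False using U unfolding bad_def by blast
  qed
  have "U \<noteq> {}" using U unfolding bad_def proper_colouring_def by auto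
  then obtain u where u: "u \<in> U" by auto
  define W where "W u = {v\<in>V. v = u \<or> E u v \<or> (\<exists>w\<in>V. E u w \<and> E w v)}" for u
  have finW: "finite (W a)" for a using assms(1) unfolding W_def by auto
  have cW: "card (W a) \<le> m + 1" if "a \<in> U" for a using ball[of a] that UV m unfolding W_def by auto
  have cnb: "card (insert a (nb a)) = card (nb a) + 1" for a using finnb irr unfolding nb_def by auto
  have nbW: "insert a (nb a) \<subseteq> W a" if "a \<in> U" for a using that UV unfolding nb_def W_def by auto
  have deg': "card (nb a) = m" if a: "a \<in> U" for a
    using card_mono[OF finW nbW[OF a]] cW[OF a] deg[OF a] cnb[of a] by linarith
  \<comment> \<open>The ball of radius two about u in V has at most j + 1 \<le> m + 1 points and
    contains the m + 1 points of the closed neighbourhood in U, so the two coincide.\<close>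
  have WU: "W u = insert u (nb u)"
    using card_subset_eq[OF finW nbW[OF u]] cW[OF u] card_mono[OF finW nbW[OF u]] cnb[of u] deg'[OF u] by force
  have clique: "E a v" if av: "a \<in> insert u (nb u)" "v \<in> insert u (nb u)" "a \<noteq> v" for a v
  proof (cases "a = u")
    case True
    then show ?thesis using av unfolding nb_def by auto
  next
    case False
    then have a: "a \<in> U" "E u a" using av unfolding nb_def by auto
    \<comment> \<open>Neighbours of a have distance at most two from u, hence lie in the closed
      neighbourhood of u. As a also has m neighbours in U, it is joined to every other vertex
      there.\<close>
    have "nb a \<subseteq> insert u (nb u) - {a}"
    proof
      fix w assume w: "w \<in> nb a"
      then have "w \<in> W u" using a UV unfolding nb_def W_def by auto
      then show "w \<in> insert u (nb u) - {a}" using WU w irr unfolding nb_def by auto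
    qed
    moreover have "card (insert u (nb u) - {a}) = m"
      using av(1) finnb cnb[of u] deg'[OF u] by (simp add: card_Diff_singleton)
    ultimately have "nb a = insert u (nb u) - {a}"
      using deg'[OF a(1)] finnb by (metis card_subset_eq finite.insertI finite_Diff)
    then show ?thesis using av unfolding nb_def by blast
  qed
  have "real (card (insert u (nb u))) \<le> T"
  proof (rule fractional_cover_clique[OF assms(1) _ cov])
    show "insert u (nb u) \<subseteq> V" using u UV by (auto simp: nb_def)
  qed (rule clique)
  then show ?thesis using cnb[of u] deg'[OF u] m by simp
qed

section \<open>Counts of independent labels\<close>

text \<open>Only the exceptional set has to be an event. The predicates bounded later quantify over
  all real radii at once, so their own measurability is left open.\<close>

definition (in prob_space) except :: "real \<Rightarrow> ('a \<Rightarrow> bool) \<Rightarrow> bool" where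
  "except \<epsilon> Q \<longleftrightarrow> (\<exists>A\<in>events. prob A \<le> \<epsilon> \<and> (\<forall>\<omega>\<in>space M - A. Q \<omega>))"

context prob_space
begin

lemma except_mono:
  assumes "except \<epsilon> Q" "\<epsilon> \<le> \<epsilon>'" "\<And>\<omega>. \<omega> \<in> space M \<Longrightarrow> Q \<omega> \<Longrightarrow> Q' \<omega>"
  shows "except \<epsilon>' Q'"
  using assms unfolding except_def by (meson DiffE order_trans)

lemma except_conj:
  assumes "except \<epsilon> Q" "except \<epsilon>' Q'"
  shows "except (\<epsilon> + \<epsilon>') (\<lambda>\<omega>. Q \<omega> \<and> Q' \<omega>)"
proof -
  obtain A B where "A \<in> events" "prob A \<le> \<epsilon>" "\<forall>\<omega>\<in>space M - A. Q \<omega>"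
    "B \<in> events" "prob B \<le> \<epsilon>'" "\<forall>\<omega>\<in>space M - B. Q' \<omega>"
    using assms unfolding except_def by blast
  then show ?thesis unfolding except_def
    using measure_Un_le[of A M B] by (intro bexI[of _ "A \<union> B"]) auto
qed

lemma except_True: "0 \<le> \<epsilon> \<Longrightarrow> (\<And>\<omega>. \<omega> \<in> space M \<Longrightarrow> Q \<omega>) \<Longrightarrow> except \<epsilon> Q"
  unfolding except_def by (intro bexI[of _ "{}"]) auto

lemma except_ball:
  assumes "finite I" "\<And>i. i \<in> I \<Longrightarrow> except (\<epsilon> i) (Q i)"
  shows "except (\<Sum>i\<in>I. \<epsilon> i) (\<lambda>\<omega>. \<forall>i\<in>I. Q i \<omega>)"
  using assms
proof (induction I rule: finite_induct)
  case empty
  then show ?case by (auto intro: except_True)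
next
  case (insert i I)
  then have "except (\<epsilon> i + (\<Sum>i\<in>I. \<epsilon> i)) (\<lambda>\<omega>. Q i \<omega> \<and> (\<forall>i\<in>I. Q i \<omega>))"
    by (intro except_conj) auto
  then show ?case using insert by (auto elim: except_mono)
qed

lemma except_set:
  assumes "{\<omega>\<in>space M. \<not> Q \<omega>} \<in> events" "prob {\<omega>\<in>space M. \<not> Q \<omega>} \<le> \<epsilon>"
  shows "except \<epsilon> Q"
  unfolding except_def using assms by (intro bexI[of _ "{\<omega>\<in>space M. \<not> Q \<omega>}"]) auto

lemma except_Markov:
  assumes [measurable]: "g \<in> borel_measurable M" and "(\<integral>\<^sup>+\<omega>. g \<omega> \<partial>M) \<le> ennreal \<epsilon>" "0 \<le> \<epsilon>"
  shows "except \<epsilon> (\<lambda>\<omega>. g \<omega> < 1)"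
proof (rule except_set)
  show m: "{\<omega>\<in>space M. \<not> g \<omega> < 1} \<in> events" by measurable
  have "emeasure M {\<omega>\<in>space M. \<not> g \<omega> < 1} = (\<integral>\<^sup>+\<omega>. indicator {\<omega>\<in>space M. \<not> g \<omega> < 1} \<omega> \<partial>M)"
    using m by simp
  also have "\<dots> \<le> (\<integral>\<^sup>+\<omega>. g \<omega> \<partial>M)"
    by (rule nn_integral_mono) (auto simp: indicator_def not_less)
  also have "\<dots> \<le> ennreal \<epsilon>" by fact
  finally show "prob {\<omega>\<in>space M. \<not> g \<omega> < 1} \<le> \<epsilon>"
    using assms(3) by (simp add: emeasure_eq_measure)
qed

text \<open>Chebyshev for the number Y of events that occur. With mean S, the pair bound gives a
  second moment of at most S + (1 + \<gamma>) S^2, so the variance is at most the fraction 1 / S +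
  \<gamma> of S^2, while Y = 0 is a deviation by S.\<close>

lemma prob_none_le_second_moment:
  assumes "finite Z" "\<And>z. z \<in> Z \<Longrightarrow> A z \<in> events" "0 < m" "0 \<le> \<gamma>"
    and m: "m \<le> (\<Sum>z\<in>Z. prob (A z))"
    and pair: "\<And>z z'. z \<in> Z \<Longrightarrow> z' \<in> Z \<Longrightarrow> z \<noteq> z' \<Longrightarrow> prob (A z \<inter> A z') \<le> (1 + \<gamma>) * prob (A z) * prob (A z')"
  shows "except (1 / m + \<gamma>) (\<lambda>\<omega>. \<exists>z\<in>Z. \<omega> \<in> A z)"
proof -
  define S where "S = (\<Sum>z\<in>Z. prob (A z))"
  have S: "0 < S" using assms unfolding S_def by linarith
  define Y where "Y \<omega> = (\<Sum>z\<in>Z. indicator (A z) \<omega> :: real)" for \<omega>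
  have [measurable]: "Y \<in> borel_measurable M" unfolding Y_def using assms by measurable
  have EY: "expectation Y = S" "integrable M Y"
    unfolding Y_def S_def using assms by (auto simp: emeasure_eq_measure)
  have Ysq: "Y \<omega> * Y \<omega> = (\<Sum>z\<in>Z. \<Sum>z'\<in>Z. indicator (A z \<inter> A z') \<omega>)" for \<omega>
    unfolding Y_def by (simp add: sum_product indicator_inter_arith)
  have int2: "integrable M (\<lambda>\<omega>. Y \<omega> * Y \<omega>)"
    unfolding Ysq using assms by (intro Bochner_Integration.integrable_sum) (auto simp: emeasure_eq_measure)
  have E2: "expectation (\<lambda>\<omega>. Y \<omega> * Y \<omega>) = (\<Sum>z\<in>Z. \<Sum>z'\<in>Z. prob (A z \<inter> A z'))"
  proof -
    have "expectation (\<lambda>\<omega>. Y \<omega> * Y \<omega>) = (\<Sum>z\<in>Z. expectation (\<lambda>\<omega>. \<Sum>z'\<in>Z. indicator (A z \<inter> A z') \<omega>))"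
      unfolding Ysq using assms
      by (intro Bochner_Integration.integral_sum Bochner_Integration.integrable_sum) (auto simp: emeasure_eq_measure)
    also have "\<dots> = (\<Sum>z\<in>Z. \<Sum>z'\<in>Z. expectation (indicator (A z \<inter> A z')))"
      using assms by (intro sum.cong refl Bochner_Integration.integral_sum) (auto simp: emeasure_eq_measure)
    also have "\<dots> = (\<Sum>z\<in>Z. \<Sum>z'\<in>Z. prob (A z \<inter> A z'))"
      using assms by (intro sum.cong refl) auto
    finally show ?thesis .
  qed
  \<comment> \<open>The product bound is written for diagonal pairs as well, where the true term
    \<open>prob (A z)\<close> is added separately.\<close>
  have "(\<Sum>z\<in>Z. \<Sum>z'\<in>Z. prob (A z \<inter> A z'))
      \<le> (\<Sum>z\<in>Z. \<Sum>z'\<in>Z. (if z = z' then prob (A z) else 0) + (1 + \<gamma>) * prob (A z) * prob (A z'))"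
  proof (intro sum_mono)
    fix z z' assume z: "z \<in> Z" "z' \<in> Z"
    show "prob (A z \<inter> A z') \<le> (if z = z' then prob (A z) else 0) + (1 + \<gamma>) * prob (A z) * prob (A z')"
      using pair[OF z] assms(4) by auto
  qed
  also have "\<dots> = S + (\<Sum>z\<in>Z. \<Sum>z'\<in>Z. (1 + \<gamma>) * prob (A z) * prob (A z'))"
    using assms(1) unfolding S_def by (simp add: sum.distrib)
  also have "(\<Sum>z\<in>Z. \<Sum>z'\<in>Z. (1 + \<gamma>) * prob (A z) * prob (A z')) = (1 + \<gamma>) * S * S"
    unfolding S_def sum_distrib_left[symmetric] sum_distrib_right[symmetric] by (rule refl)
  finally have E2le: "expectation (\<lambda>\<omega>. Y \<omega> * Y \<omega>) \<le> S + (1 + \<gamma>) * S * S" using E2 by simp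
  define g where "g \<omega> = (Y \<omega> - S) * (Y \<omega> - S) / (S * S)" for \<omega>
  have geq: "g = (\<lambda>\<omega>. (Y \<omega> * Y \<omega> - 2 * S * Y \<omega> + S * S) / (S * S))"
    unfolding g_def by (auto simp: algebra_simps)
  have gint: "integrable M g" unfolding geq using int2 EY by auto
  have "expectation g = (expectation (\<lambda>\<omega>. Y \<omega> * Y \<omega>) - 2 * S * S + S * S) / (S * S)"
    unfolding geq using int2 EY by (simp add: prob_space)
  also have "\<dots> \<le> (S + \<gamma> * S * S) / (S * S)"
    using E2le S by (intro divide_right_mono) (auto simp: algebra_simps)
  also have "\<dots> = 1 / S + \<gamma>" using S by (simp add: field_simps)
  also have "\<dots> \<le> 1 / m + \<gamma>" using m assms(3) unfolding S_def[symmetric] by (simp add: frac_le)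
  finally have "expectation g \<le> 1 / m + \<gamma>" .
  moreover have "(\<integral>\<^sup>+\<omega>. ennreal (g \<omega>) \<partial>M) = ennreal (expectation g)"
    by (intro nn_integral_eq_integral gint) (auto simp: g_def)
  ultimately have "except (1 / m + \<gamma>) (\<lambda>\<omega>. ennreal (g \<omega>) < 1)"
    using assms(3,4) gint by (intro except_Markov) (auto intro: ennreal_leI simp del: ennreal_plus)
  then show ?thesis
  proof (rule except_mono)
    fix \<omega> assume "ennreal (g \<omega>) < 1"
    then have "g \<omega> < 1" by (metis ennreal_1 ennreal_leI not_less)
    then have "Y \<omega> \<noteq> 0" unfolding g_def using S by auto
    moreover have "Y \<omega> = 0" if "\<forall>z\<in>Z. \<omega> \<notin> A z"
      unfolding Y_def using that by (intro sum.neutral) auto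
    ultimately show "\<exists>z\<in>Z. \<omega> \<in> A z" by blast
  qed simp
qed

end

section \<open>Tail bounds, multinomial law and second moment for labels in a countable
  group\<close>

locale iid_labels = prob_space M for M :: "'m measure" +
  fixes C :: "nat \<Rightarrow> 'm \<Rightarrow> 'c::{countable,ab_group_add}" and p :: "'c \<Rightarrow> real"
  assumes indep: "indep_vars (\<lambda>_. count_space UNIV) C {1..}"
    and p: "\<And>i z. i \<ge> 1 \<Longrightarrow> prob {\<omega>\<in>space M. C i \<omega> = z} = p z"
begin

definition cnt :: "nat \<Rightarrow> 'c \<Rightarrow> 'm \<Rightarrow> nat" where
  "cnt n z \<omega> = card {i\<in>{1..n}. C i \<omega> = z}"

lemma measurable_C: "i \<ge> 1 \<Longrightarrow> C i \<in> measurable M (count_space UNIV)"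
  using indep unfolding indep_vars_def by auto

lemma cnt_sum: "cnt n z \<omega> = (\<Sum>i\<in>{1..n}. if C i \<omega> = z then 1 else 0)"
  unfolding cnt_def by (simp add: sum.If_cases Int_def)

lemma measurable_cnt[measurable]: "cnt n z \<in> measurable M (count_space UNIV)"
proof -
  have "(\<lambda>\<omega>. if C i \<omega> = z then 1 else (0::nat)) \<in> measurable M (count_space UNIV)" if "i \<in> {1..n}" for i
  proof -
    have [measurable]: "C i \<in> measurable M (count_space UNIV)" using measurable_C that by auto
    show ?thesis by measurable
  qed
  then have "(\<lambda>\<omega>. \<Sum>i\<in>{1..n}. if C i \<omega> = z then 1 else (0::nat)) \<in> measurable M (count_space UNIV)"
    by (rule measurable_sum_nat)
  then show ?thesis unfolding cnt_sum[abs_def] .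
qed

lemma p_nonneg: "0 \<le> p z" using p[of 1 z] measure_nonneg by (metis order_refl)

lemma expectation_prod_labels:
  assumes "\<And>j. j \<in> {1..n} \<Longrightarrow> (\<integral>\<^sup>+\<omega>. g j (C j \<omega>) \<partial>M) = ennreal (e j)" "\<And>j. j \<in> {1..n} \<Longrightarrow> 0 \<le> e j"
  shows "(\<integral>\<^sup>+\<omega>. (\<Prod>j\<in>{1..n}. g j (C j \<omega>)) \<partial>M) = ennreal (\<Prod>j\<in>{1..n}. e j)"
proof -
  have "indep_vars (\<lambda>_. borel) (\<lambda>j \<omega>. g j (C j \<omega>)) {1..n}"
    by (rule indep_vars_compose2[OF indep_vars_subset[OF indep]]) auto
  then have "(\<integral>\<^sup>+\<omega>. (\<Prod>j\<in>{1..n}. g j (C j \<omega>)) \<partial>M) = (\<Prod>j\<in>{1..n}. \<integral>\<^sup>+\<omega>. g j (C j \<omega>) \<partial>M)"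
    by (intro indep_vars_nn_integral) auto
  also have "\<dots> = (\<Prod>j\<in>{1..n}. ennreal (e j))" by (intro prod.cong) (use assms in auto)
  also have "\<dots> = ennreal (\<Prod>j\<in>{1..n}. e j)" using assms by (intro prod_ennreal) auto
  finally show ?thesis .
qed

lemma nn_integral_label:
  assumes "i \<ge> 1"
  shows "(\<integral>\<^sup>+\<omega>. (if C i \<omega> = a then ennreal x else 0) \<partial>M) = ennreal x * ennreal (p a)"
proof -
  have [measurable]: "C i \<in> measurable M (count_space UNIV)" using measurable_C assms by auto
  have "(\<integral>\<^sup>+\<omega>. (if C i \<omega> = a then ennreal x else 0) \<partial>M) = 
     (\<integral>\<^sup>+\<omega>. ennreal x * indicator {\<omega>\<in>space M. C i \<omega> = a} \<omega> \<partial>M)"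
    by (rule nn_integral_cong) (auto simp: indicator_def)
  also have "\<dots> = ennreal x * emeasure M {\<omega>\<in>space M. C i \<omega> = a}"
    by (rule nn_integral_cmult_indicator) measurable
  finally show ?thesis using p[OF assms, of a] by (simp add: emeasure_eq_measure)
qed

text \<open>The contribution of one label to an exponential moment: with k = exp h - 1 the integrand
  is exp h on F and 1 elsewhere. The form 1 + x of the value prepares for 1 + x \<le> exp x.\<close>

lemma nn_integral_label_tilt:
  assumes "i \<ge> 1" "finite F" "\<And>a. a \<in> F \<Longrightarrow> 0 \<le> k a"
  shows "(\<integral>\<^sup>+\<omega>. ennreal (if C i \<omega> \<in> F then 1 + k (C i \<omega>) else 1) \<partial>M) = ennreal (1 + (\<Sum>a\<in>F. k a * p a))"
proof -
  have [measurable]: "C i \<in> measurable M (count_space UNIV)" using measurable_C assms by auto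
  have "(\<integral>\<^sup>+\<omega>. ennreal (if C i \<omega> \<in> F then 1 + k (C i \<omega>) else 1) \<partial>M)
    = (\<integral>\<^sup>+\<omega>. 1 + (\<Sum>a\<in>F. if C i \<omega> = a then ennreal (k a) else 0) \<partial>M)"
    using assms by (intro nn_integral_cong) (auto simp: sum.delta')
  also have "\<dots> = 1 + (\<Sum>a\<in>F. \<integral>\<^sup>+\<omega>. (if C i \<omega> = a then ennreal (k a) else 0) \<partial>M)"
    by (subst nn_integral_add) (auto simp: nn_integral_sum emeasure_space_1)
  also have "\<dots> = ennreal 1 + (\<Sum>a\<in>F. ennreal (k a * p a))"
    using assms p_nonneg by (simp add: nn_integral_label ennreal_mult)
  also have "\<dots> = ennreal (1 + (\<Sum>a\<in>F. k a * p a))"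
    using assms p_nonneg by (simp add: sum_ennreal sum_nonneg)
  finally show ?thesis .
qed

text \<open>This makes bounds proportional to p (z + a) summable over the infinitely many translates
  z.\<close>

lemma sum_shifted_p: "(\<integral>\<^sup>+z. ennreal (p (z + a)) \<partial>count_space UNIV) = 1"
proof -
  have [measurable]: "C 1 \<in> measurable M (count_space UNIV)" using measurable_C by auto
  have "emeasure M (\<Union>z\<in>UNIV. {\<omega>\<in>space M. C 1 \<omega> = z + a}) = 
     (\<integral>\<^sup>+z. emeasure M {\<omega>\<in>space M. C 1 \<omega> = z + a} \<partial>count_space UNIV)"
  proof (rule emeasure_UN_countable)
    show "{\<omega>\<in>space M. C 1 \<omega> = z + a} \<in> events" for z by measurable
  qed (auto simp: disjoint_family_on_def)
  moreover have "(\<Union>z\<in>UNIV. {\<omega>\<in>space M. C 1 \<omega> = z + a}) = space M"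
    by (auto, metis diff_add_cancel)
  ultimately show ?thesis using p[of 1] by (simp add: emeasure_eq_measure prob_space)
qed

text \<open>Exponential Markov for the count in every translate z + F simultaneously. The factor
  counting a point of z + F makes the bounds summable over all z.\<close>
lemma tilted_counts_bound:
  assumes F: "finite F" "\<And>a. a \<in> F \<Longrightarrow> 0 \<le> h a" "\<And>a. a \<in> F \<Longrightarrow> h a \<le> H" "\<And>z. p z \<le> q"
  shows "except (real n * real (card F) * exp H * exp (real n * q * (\<Sum>a\<in>F. exp (h a) - 1) - \<theta>))
    (\<lambda>\<omega>. \<forall>z. (\<exists>a\<in>F. 0 < cnt n (z + a) \<omega>) \<longrightarrow> (\<Sum>a\<in>F. h a * real (cnt n (z + a) \<omega>)) < \<theta>)"
proof -
  have [measurable]: "C i \<in> measurable M (count_space UNIV)" if "i \<in> {1..n}" for i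
    using measurable_C that by auto
  define g where "g z x = (if x - z \<in> F then exp (h (x - z)) else 1)" for z x
  have g0: "0 < g z x" for z x unfolding g_def by auto
  \<comment> \<open>For j = i the factor also demands that the i-th label be z + a. Summed over i
    and a, the products weight the exponential by the number of points in z + F, and every term
    acquires the summable factor p (z + a).\<close>
  define G where "G z i a j x = (if j = i then (if x = z + a then ennreal (g z x) else 0) else ennreal (g z x))"
    for z i a and j :: nat and x
  define Y where "Y z \<omega> = ennreal (exp (-\<theta>)) * (\<Sum>i\<in>{1..n}. \<Sum>a\<in>F. \<Prod>j\<in>{1..n}. G z i a j (C j \<omega>))" for z \<omega>
  define s where "s = (\<Sum>a\<in>F. exp (h a) - 1)"
  have [measurable]: "Y z \<in> borel_measurable M" for z unfolding Y_def by measurable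
  have Ig: "(\<integral>\<^sup>+\<omega>. ennreal (g z (C j \<omega>)) \<partial>M) = ennreal (1 + (\<Sum>a\<in>F. (exp (h a) - 1) * p (z + a)))"
    if j: "j \<in> {1..n}" for z j
  proof -
    let ?F = "(\<lambda>a. z + a) ` F"
    have "(\<integral>\<^sup>+\<omega>. ennreal (g z (C j \<omega>)) \<partial>M) =
       (\<integral>\<^sup>+\<omega>. ennreal (if C j \<omega> \<in> ?F then 1 + (exp (h (C j \<omega> - z)) - 1) else 1) \<partial>M)"
    proof (rule nn_integral_cong)
      fix \<omega>
      have "C j \<omega> \<in> ?F \<longleftrightarrow> C j \<omega> - z \<in> F" by (auto simp: image_iff algebra_simps intro: bexI[of _ "C j \<omega> - z"])
      then show "ennreal (g z (C j \<omega>)) = ennreal (if C j \<omega> \<in> ?F then 1 + (exp (h (C j \<omega> - z)) - 1) else 1)"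
        unfolding g_def by auto
    qed
    also have "\<dots> = ennreal (1 + (\<Sum>a\<in>?F. (exp (h (a - z)) - 1) * p a))"
      by (rule nn_integral_label_tilt) (use j F in auto)
    also have "(\<Sum>a\<in>?F. (exp (h (a - z)) - 1) * p a) = (\<Sum>a\<in>F. (exp (h a) - 1) * p (z + a))"
      by (subst sum.reindex) (auto simp: inj_on_def)
    finally show ?thesis .
  qed
  have IG: "(\<integral>\<^sup>+\<omega>. (\<Prod>j\<in>{1..n}. G z i a j (C j \<omega>)) \<partial>M) \<le> ennreal (exp H * exp (n * q * s)) * ennreal (p (z + a))"
    if i: "i \<in> {1..n}" and a: "a \<in> F" for z i a
  proof -
    let ?m = "1 + (\<Sum>a\<in>F. (exp (h a) - 1) * p (z + a))"
    have m1: "1 \<le> ?m" using F p_nonneg by (auto intro!: sum_nonneg)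
    have "?m \<le> 1 + (\<Sum>a\<in>F. (exp (h a) - 1) * q)"
      using F p_nonneg by (intro add_left_mono sum_mono mult_left_mono) auto
    also have "\<dots> = 1 + q * s" unfolding s_def sum_distrib_right[symmetric] by simp
    also have "\<dots> \<le> exp (q * s)" by (rule exp_ge_add_one_self)
    finally have m2: "?m \<le> exp (q * s)" .
    have "(\<integral>\<^sup>+\<omega>. (\<Prod>j\<in>{1..n}. G z i a j (C j \<omega>)) \<partial>M)
       = ennreal (\<Prod>j\<in>{1..n}. if j = i then exp (h a) * p (z + a) else ?m)"
    proof (rule expectation_prod_labels)
      fix j assume j: "j \<in> {1..n}"
      show "0 \<le> (if j = i then exp (h a) * p (z + a) else ?m)" using m1 p_nonneg by auto
      show "(\<integral>\<^sup>+\<omega>. G z i a j (C j \<omega>) \<partial>M) = ennreal (if j = i then exp (h a) * p (z + a) else ?m)"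
      proof (cases "j = i")
        case True
        have "(\<integral>\<^sup>+\<omega>. G z i a j (C j \<omega>) \<partial>M) = (\<integral>\<^sup>+\<omega>. (if C j \<omega> = z + a then ennreal (exp (h a)) else 0) \<partial>M)"
          unfolding G_def g_def using True a by (intro nn_integral_cong) auto
        then show ?thesis using True j nn_integral_label[of j "z + a"] p_nonneg by (simp add: ennreal_mult)
      next
        case False
        then show ?thesis unfolding G_def using Ig[OF j] by simp
      qed
    qed
    also have "(\<Prod>j\<in>{1..n}. if j = i then exp (h a) * p (z + a) else ?m)
        = (exp (h a) * p (z + a)) * ?m ^ (n - 1)"
    proof -
      have "(\<Prod>j\<in>{1..n}. if j = i then exp (h a) * p (z + a) else ?m) = 
        (exp (h a) * p (z + a)) * (\<Prod>j\<in>{1..n} - {i}. if j = i then exp (h a) * p (z + a) else ?m)"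
        using i by (subst prod.remove[of _ i]) auto
      also have "(\<Prod>j\<in>{1..n} - {i}. if j = i then exp (h a) * p (z + a) else ?m) = (\<Prod>j\<in>{1..n} - {i}. ?m)"
        by (intro prod.cong) auto
      also have "\<dots> = ?m ^ (n - 1)" using i by simp
      finally show ?thesis .
    qed
    also have "(exp (h a) * p (z + a)) * ?m ^ (n - 1) \<le> (exp H * p (z + a)) * exp (n * q * s)"
    proof (rule mult_mono)
      show "exp (h a) * p (z + a) \<le> exp H * p (z + a)" using F a p_nonneg by (intro mult_right_mono) auto
      have "?m ^ (n - 1) \<le> ?m ^ n" using m1 by (intro power_increasing) auto
      also have "\<dots> \<le> exp (q * s) ^ n" using m1 m2 by (intro power_mono) auto
      also have "\<dots> = exp (n * q * s)" by (simp add: exp_of_nat_mult[symmetric] mult.assoc)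
      finally show "?m ^ (n - 1) \<le> exp (n * q * s)" .
    qed (use p_nonneg m1 in auto)
    finally have "(\<integral>\<^sup>+\<omega>. (\<Prod>j\<in>{1..n}. G z i a j (C j \<omega>)) \<partial>M) \<le> ennreal ((exp H * p (z + a)) * exp (n * q * s))"
      by (simp add: ennreal_leI)
    then show ?thesis using p_nonneg by (simp add: ennreal_mult[symmetric] mult_ac)
  qed
  have IY: "(\<integral>\<^sup>+\<omega>. Y z \<omega> \<partial>M) \<le> (\<Sum>a\<in>F. ennreal (n * exp H * exp (n * q * s - \<theta>)) * ennreal (p (z + a)))" for z
  proof -
    have "(\<integral>\<^sup>+\<omega>. Y z \<omega> \<partial>M) = ennreal (exp (-\<theta>)) * (\<Sum>i\<in>{1..n}. \<Sum>a\<in>F. \<integral>\<^sup>+\<omega>. (\<Prod>j\<in>{1..n}. G z i a j (C j \<omega>)) \<partial>M)"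
      unfolding Y_def by (simp add: nn_integral_cmult nn_integral_sum)
    also have "\<dots> \<le> ennreal (exp (-\<theta>)) * (\<Sum>i\<in>{1..n}. \<Sum>a\<in>F. ennreal (exp H * exp (n * q * s)) * ennreal (p (z + a)))"
      by (intro mult_left_mono sum_mono IG) auto
    also have "\<dots> = (\<Sum>a\<in>F. ennreal (exp (-\<theta>) * (n * (exp H * exp (n * q * s) * p (z + a)))))"
      using p_nonneg by (simp add: ennreal_mult[symmetric] ennreal_of_nat_eq_real_of_nat sum_distrib_left sum_nonneg)
    also have "\<dots> = (\<Sum>a\<in>F. ennreal (n * exp H * exp (n * q * s - \<theta>)) * ennreal (p (z + a)))"
      using p_nonneg by (intro sum.cong refl) (simp add: ennreal_mult[symmetric] exp_diff exp_minus field_simps)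
    finally show ?thesis .
  qed
  have meas: "(\<lambda>\<omega>. \<integral>\<^sup>+z. Y z \<omega> \<partial>count_space UNIV) \<in> borel_measurable M"
  proof (rule sigma_finite_measure.borel_measurable_nn_integral)
    show "sigma_finite_measure (count_space (UNIV :: 'c set))"
      by (rule sigma_finite_measure_count_space_countable) simp
    have "(\<lambda>x. Y (snd x) (fst x)) \<in> borel_measurable (M \<Otimes>\<^sub>M count_space (UNIV :: 'c set))"
      by (rule measurable_compose_countable[where g = snd and f = "\<lambda>z x. Y z (fst x)"]) measurable
    then show "(\<lambda>(\<omega>, z). Y z \<omega>) \<in> borel_measurable (M \<Otimes>\<^sub>M count_space (UNIV :: 'c set))"
      by (simp add: case_prod_beta')
  qed
  have "(\<integral>\<^sup>+\<omega>. \<integral>\<^sup>+z. Y z \<omega> \<partial>count_space UNIV \<partial>M) = (\<integral>\<^sup>+z. \<integral>\<^sup>+\<omega>. Y z \<omega> \<partial>M \<partial>count_space UNIV)"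
    by (rule nn_integral_count_space_nn_integral) auto
  also have "\<dots> \<le> (\<integral>\<^sup>+z. (\<Sum>a\<in>F. ennreal (n * exp H * exp (n * q * s - \<theta>)) * ennreal (p (z + a))) \<partial>count_space UNIV)"
    by (intro nn_integral_mono IY)
  also have "\<dots> = (\<Sum>a\<in>F. ennreal (n * exp H * exp (n * q * s - \<theta>)) * 1)"
    by (subst nn_integral_sum) (auto simp: nn_integral_cmult sum_shifted_p)
  also have "\<dots> = ennreal (real n * real (card F) * exp H * exp (n * q * s - \<theta>))"
    by (simp add: ennreal_mult[symmetric] ennreal_of_nat_eq_real_of_nat mult_ac)
  finally have "except (real n * real (card F) * exp H * exp (n * q * s - \<theta>)) 
      (\<lambda>\<omega>. (\<integral>\<^sup>+z. Y z \<omega> \<partial>count_space UNIV) < 1)"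
    by (intro except_Markov meas) auto
  then show ?thesis unfolding s_def[symmetric]
  proof (rule except_mono)
    fix \<omega> assume lt: "(\<integral>\<^sup>+z. Y z \<omega> \<partial>count_space UNIV) < 1"
    show "\<forall>z. (\<exists>a\<in>F. 0 < cnt n (z + a) \<omega>) \<longrightarrow> (\<Sum>a\<in>F. h a * real (cnt n (z + a) \<omega>)) < \<theta>"
    proof (intro allI impI, rule ccontr)
      fix z assume ex: "\<exists>a\<in>F. 0 < cnt n (z + a) \<omega>" and ge: "\<not> (\<Sum>a\<in>F. h a * real (cnt n (z + a) \<omega>)) < \<theta>"
      obtain a where a: "a \<in> F" "0 < cnt n (z + a) \<omega>" using ex by auto
      then obtain i where i: "i \<in> {1..n}" "C i \<omega> = z + a"
        unfolding cnt_def by (auto simp: card_gt_0_iff)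
      have prod: "(\<Prod>j\<in>{1..n}. g z (C j \<omega>)) = exp (\<Sum>a\<in>F. h a * real (cnt n (z + a) \<omega>))"
      proof -
        have "(\<Prod>j\<in>{1..n}. g z (C j \<omega>)) = exp (\<Sum>j\<in>{1..n}. if C j \<omega> - z \<in> F then h (C j \<omega> - z) else 0)"
          unfolding g_def by (subst exp_sum) (auto intro!: prod.cong)
        also have "(\<Sum>j\<in>{1..n}. if C j \<omega> - z \<in> F then h (C j \<omega> - z) else 0)
            = (\<Sum>j\<in>{1..n}. \<Sum>a\<in>F. h a * (if C j \<omega> = z + a then 1 else 0))"
        proof (rule sum.cong)
          fix j
          have "(\<Sum>a\<in>F. h a * (if C j \<omega> = z + a then 1 else 0)) = (\<Sum>a\<in>F. if C j \<omega> - z = a then h a else 0)"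
            by (intro sum.cong) (auto simp: algebra_simps)
          then show "(if C j \<omega> - z \<in> F then h (C j \<omega> - z) else 0) = (\<Sum>a\<in>F. h a * (if C j \<omega> = z + a then 1 else 0))"
            using F(1) by (simp add: sum.delta')
        qed simp
        also have "\<dots> = (\<Sum>a\<in>F. h a * real (cnt n (z + a) \<omega>))"
          unfolding cnt_sum by (subst sum.swap) (simp add: sum_distrib_left of_nat_sum if_distrib cong: if_cong)
        finally show ?thesis .
      qed
      have "(\<Prod>j\<in>{1..n}. G z i a j (C j \<omega>)) = (\<Prod>j\<in>{1..n}. ennreal (g z (C j \<omega>)))"
        unfolding G_def using i by (intro prod.cong) auto
      also have "\<dots> = ennreal (\<Prod>j\<in>{1..n}. g z (C j \<omega>))" using g0 by (intro prod_ennreal) (auto simp: less_imp_le)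
      finally have P: "(\<Prod>j\<in>{1..n}. G z i a j (C j \<omega>)) = ennreal (exp (\<Sum>a\<in>F. h a * real (cnt n (z + a) \<omega>)))"
        using prod by simp
      \<comment> \<open>One violating translate already has Y at least 1: some label i sits at z +
        a, and the term of this pair is the full exponential.\<close>
      have "1 \<le> exp (-\<theta>) * exp (\<Sum>a\<in>F. h a * real (cnt n (z + a) \<omega>))"
        using ge by (simp add: exp_add[symmetric])
      then have "1 \<le> ennreal (exp (-\<theta>) * exp (\<Sum>a\<in>F. h a * real (cnt n (z + a) \<omega>)))"
        by (metis ennreal_1 ennreal_leI)
      also have "\<dots> = ennreal (exp (-\<theta>)) * (\<Prod>j\<in>{1..n}. G z i a j (C j \<omega>))"
        unfolding P by (simp add: ennreal_mult)
      also have "\<dots> \<le> Y z \<omega>" unfolding Y_def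
      proof (rule mult_left_mono)
        have "(\<Prod>j\<in>{1..n}. G z i a j (C j \<omega>)) \<le> (\<Sum>a\<in>F. \<Prod>j\<in>{1..n}. G z i a j (C j \<omega>))"
          using F(1) a(1) by (intro member_le_sum) auto
        also have "\<dots> \<le> (\<Sum>i\<in>{1..n}. \<Sum>a\<in>F. \<Prod>j\<in>{1..n}. G z i a j (C j \<omega>))"
          using i by (intro member_le_sum) auto
        finally show "(\<Prod>j\<in>{1..n}. G z i a j (C j \<omega>)) \<le> (\<Sum>i\<in>{1..n}. \<Sum>a\<in>F. \<Prod>j\<in>{1..n}. G z i a j (C j \<omega>))" .
      qed simp
      also have "\<dots> \<le> (\<integral>\<^sup>+z. Y z \<omega> \<partial>count_space UNIV)" by (rule nn_integral_ge_point) simp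
      finally show False using lt by simp
    qed
  qed simp
qed

text \<open>Chernoff with the tilt exp (-h), at the level exp (-h) times the mean. One label
  contributes 1 - p a (1 - exp (-h)), which is at most exp (- p a (1 - exp (-h))). The resulting
  exponent is negative for h > 0 because exp h > 1 + h.\<close>

lemma lower_tail_bound:
  assumes "0 \<le> h"
  shows "except (exp (real n * p a * (exp (-h) * (1 + h) - 1))) (\<lambda>\<omega>. exp (-h) * (real n * p a) < real (cnt n a \<omega>))"
proof -
  have [measurable]: "C i \<in> measurable M (count_space UNIV)" if "i \<in> {1..n}" for i
    using measurable_C that by auto
  have p1: "p a \<le> 1" using p[of 1 a] by (metis order_refl prob_le_1)
  define g where "g x = (if x = a then exp (-h) else 1)" for x
  let ?e = "1 - p a * (1 - exp (-h))"
  have e0: "0 \<le> ?e"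
  proof -
    have "p a * (1 - exp (-h)) \<le> 1 * 1" using p1 p_nonneg assms by (intro mult_mono) auto
    then show ?thesis by simp
  qed
  have Ig: "(\<integral>\<^sup>+\<omega>. ennreal (g (C j \<omega>)) \<partial>M) = ennreal ?e" if j: "j \<in> {1..n}" for j
  proof -
    have [measurable]: "C j \<in> measurable M (count_space UNIV)" using measurable_C j by auto
    have eq: "g (C j \<omega>) = 1 - (1 - exp (-h)) * indicator {\<omega>\<in>space M. C j \<omega> = a} \<omega>" if "\<omega> \<in> space M" for \<omega>
      using that unfolding g_def by (auto simp: indicator_def)
    have int: "integrable M (\<lambda>\<omega>. 1 - (1 - exp (-h)) * indicator {\<omega>\<in>space M. C j \<omega> = a} \<omega>)"
      by (auto simp: emeasure_eq_measure)
    have "(\<integral>\<^sup>+\<omega>. ennreal (g (C j \<omega>)) \<partial>M) = 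
      (\<integral>\<^sup>+\<omega>. ennreal (1 - (1 - exp (-h)) * indicator {\<omega>\<in>space M. C j \<omega> = a} \<omega>) \<partial>M)"
      by (rule nn_integral_cong) (simp add: eq)
    also have "\<dots> = ennreal (expectation (\<lambda>\<omega>. 1 - (1 - exp (-h)) * indicator {\<omega>\<in>space M. C j \<omega> = a} \<omega>))"
      using int assms by (intro nn_integral_eq_integral) (auto simp: indicator_def)
    also have "expectation (\<lambda>\<omega>. 1 - (1 - exp (-h)) * indicator {\<omega>\<in>space M. C j \<omega> = a} \<omega>) = ?e"
      using p[of j a] j by (subst Bochner_Integration.integral_diff) (auto simp: prob_space emeasure_eq_measure Int_absorb1)
    finally show ?thesis .
  qed
  define Y where "Y \<omega> = ennreal (exp (h * (exp (-h) * (n * p a)))) * (\<Prod>j\<in>{1..n}. ennreal (g (C j \<omega>)))" for \<omega>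
  have "(\<integral>\<^sup>+\<omega>. Y \<omega> \<partial>M) = ennreal (exp (h * (exp (-h) * (n * p a)))) * ennreal (\<Prod>j\<in>{1..n}. ?e)"
    unfolding Y_def
  proof (subst nn_integral_cmult)
    show "(\<lambda>\<omega>. \<Prod>j\<in>{1..n}. ennreal (g (C j \<omega>))) \<in> borel_measurable M" by measurable
    show "ennreal (exp (h * (exp (-h) * (n * p a)))) * (\<integral>\<^sup>+\<omega>. (\<Prod>j\<in>{1..n}. ennreal (g (C j \<omega>))) \<partial>M)
      = ennreal (exp (h * (exp (-h) * (n * p a)))) * ennreal (\<Prod>j\<in>{1..n}. ?e)"
      by (subst expectation_prod_labels[of n "\<lambda>_ x. ennreal (g x)" "\<lambda>_. ?e"]) (use Ig e0 in auto)
  qed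
  also have "\<dots> = ennreal (exp (h * (exp (-h) * (n * p a))) * ?e ^ n)" using e0 by (simp add: ennreal_mult)
  also have "\<dots> \<le> ennreal (exp (real n * p a * (exp (-h) * (1 + h) - 1)))"
  proof (rule ennreal_leI)
    have "?e ^ n \<le> exp (- (p a * (1 - exp (-h)))) ^ n"
      using e0 exp_ge_add_one_self[of "- (p a * (1 - exp (-h)))"] by (intro power_mono) auto
    also have "\<dots> = exp (n * (- (p a * (1 - exp (-h)))))" by (rule exp_of_nat_mult[symmetric])
    finally have "exp (h * (exp (-h) * (n * p a))) * ?e ^ n \<le> exp (h * (exp (-h) * (n * p a))) * exp (n * (- (p a * (1 - exp (-h)))))"
      by (intro mult_left_mono) auto
    also have "\<dots> = exp (real n * p a * (exp (-h) * (1 + h) - 1))"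
      unfolding exp_add[symmetric] by (simp add: algebra_simps)
    finally show "exp (h * (exp (-h) * (n * p a))) * ?e ^ n \<le> exp (real n * p a * (exp (-h) * (1 + h) - 1))" .
  qed
  finally have "except (exp (real n * p a * (exp (-h) * (1 + h) - 1))) (\<lambda>\<omega>. Y \<omega> < 1)"
    by (intro except_Markov) (auto simp: Y_def)
  then show ?thesis
  proof (rule except_mono)
    fix \<omega> assume lt: "Y \<omega> < 1"
    have "(\<Prod>j\<in>{1..n}. g (C j \<omega>)) = exp (\<Sum>j\<in>{1..n}. - h * (if C j \<omega> = a then 1 else 0))"
      unfolding g_def by (subst exp_sum) (auto intro!: prod.cong)
    also have "(\<Sum>j\<in>{1..n}. - h * (if C j \<omega> = a then 1 else 0)) = - h * real (cnt n a \<omega>)"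
      unfolding cnt_sum by (simp add: sum_distrib_left of_nat_sum if_distrib cong: if_cong)
    finally have "(\<Prod>j\<in>{1..n}. g (C j \<omega>)) = exp (- h * real (cnt n a \<omega>))" .
    moreover have "(\<Prod>j\<in>{1..n}. ennreal (g (C j \<omega>))) = ennreal (\<Prod>j\<in>{1..n}. g (C j \<omega>))"
      by (intro prod_ennreal) (auto simp: g_def)
    ultimately have "Y \<omega> = ennreal (exp (h * (exp (-h) * (n * p a)) - h * real (cnt n a \<omega>)))"
      unfolding Y_def by (simp add: ennreal_mult[symmetric] exp_diff exp_minus divide_inverse)
    then have "exp (h * (exp (-h) * (n * p a)) - h * real (cnt n a \<omega>)) < 1"
      using lt by (metis ennreal_1 ennreal_leI not_less)
    then have "h * (exp (-h) * (n * p a)) < h * real (cnt n a \<omega>)" by simp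
    then show "exp (-h) * (real n * p a) < real (cnt n a \<omega>)" using assms by (simp add: mult_less_cancel_left)
  qed simp
qed

text \<open>The multinomial law, with all labels outside F merged into \<open>None\<close>. The
  event is a disjoint union over the label sequences with a prescribed multiset; all of them have
  the same probability, and their number is that of the permutations of a multiset.\<close>

lemma prob_cnt_eq:
  assumes F: "finite F" and W: "(\<Sum>a\<in>F. w a) \<le> n"
  shows "prob {\<omega>\<in>space M. \<forall>a\<in>F. cnt n a \<omega> = w a} =
    fact n / ((\<Prod>a\<in>F. fact (w a)) * fact (n - (\<Sum>a\<in>F. w a))) *
    (\<Prod>a\<in>F. p a ^ w a) * (1 - (\<Sum>a\<in>F. p a)) ^ (n - (\<Sum>a\<in>F. w a))"
proof -
  have meas[measurable]: "C i \<in> measurable M (count_space UNIV)" if "i \<in> {1..n}" for i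
    using measurable_C that by auto
  define W where "W = (\<Sum>a\<in>F. w a)"
  define lab where "lab x = (if x \<in> F then Some x else None)" for x :: 'c
  define q where "q l = (case l of Some a \<Rightarrow> p a | None \<Rightarrow> 1 - (\<Sum>a\<in>F. p a))" for l
  define A where "A = (\<Sum>a\<in>F. replicate_mset (w a) (Some a)) + replicate_mset (n - W) None"
  have q_lab: "prob {\<omega>\<in>space M. lab (C i \<omega>) = l} = q l" if i: "i \<in> {1..n}" and l: "l \<in> set_mset A" for i l
  proof (cases l)
    case (Some a)
    then have "a \<in> F" using l F unfolding A_def by (auto simp: set_mset_sum in_replicate_mset split: if_splits)
    then have "{\<omega>\<in>space M. lab (C i \<omega>) = l} = {\<omega>\<in>space M. C i \<omega> = a}" unfolding lab_def Some by auto
    then show ?thesis using p[of i a] i by (simp add: q_def Some)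
  next
    case None
    have [measurable]: "C i \<in> measurable M (count_space UNIV)" using meas i by auto
    have e: "{\<omega>\<in>space M. C i \<omega> = a} \<in> events" for a by measurable
    have "{\<omega>\<in>space M. lab (C i \<omega>) = l} = space M - (\<Union>a\<in>F. {\<omega>\<in>space M. C i \<omega> = a})"
      unfolding lab_def None by auto
    moreover have "prob (\<Union>a\<in>F. {\<omega>\<in>space M. C i \<omega> = a}) = (\<Sum>a\<in>F. prob {\<omega>\<in>space M. C i \<omega> = a})"
      using F e by (intro finite_measure_finite_Union) (auto simp: disjoint_family_on_def)
    moreover have "(\<Union>a\<in>F. {\<omega>\<in>space M. C i \<omega> = a}) \<in> events" using F e by auto
    ultimately show ?thesis using i p[of i] by (simp add: prob_compl q_def None)
  qed
  have sizeA: "size A = n" unfolding A_def using W by (simp add: W_def[symmetric] size_multiset_sum)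
  have cntA: "count A (Some a) = w a" if "a \<in> F" for a
    using that F unfolding A_def by (simp add: count_sum)
  have cntA0: "count A None = n - W" unfolding A_def by (simp add: count_sum)
  define L where "L \<omega> = map (\<lambda>i. lab (C (i+1) \<omega>)) [0..<n]" for \<omega>
  have cntL: "count (mset (L \<omega>)) (Some a) = cnt n a \<omega>" if "a \<in> F" for a \<omega>
  proof -
    have "count (mset (L \<omega>)) (Some a) = card {i\<in>{0..<n}. lab (C (i+1) \<omega>) = Some a}"
      unfolding L_def count_mset count_list_eq_length_filter length_filter_conv_card
      by (auto intro!: arg_cong[of _ _ card])
    also have "\<dots> = card {i\<in>{1..n}. C i \<omega> = a}"
      by (rule bij_betw_same_card[of "\<lambda>i. i + 1"], rule bij_betwI[where g = "\<lambda>i. i - 1"])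
        (use that in \<open>auto simp: lab_def split: if_splits\<close>)
    finally show ?thesis by (simp add: cnt_def)
  qed
  have ev: "(\<forall>a\<in>F. cnt n a \<omega> = w a) \<longleftrightarrow> mset (L \<omega>) = A" for \<omega>
  proof
    assume c: "\<forall>a\<in>F. cnt n a \<omega> = w a"
    have setL: "set_mset (mset (L \<omega>)) \<subseteq> insert None (Some ` F)" unfolding L_def lab_def by auto
    have setA: "set_mset A \<subseteq> insert None (Some ` F)"
      using F unfolding A_def by (auto simp: set_mset_sum in_replicate_mset split: if_splits)
    have some: "count (mset (L \<omega>)) (Some a) = count A (Some a)" for a
    proof (cases "a \<in> F")
      case False
      then have "Some a \<notin># mset (L \<omega>)" "Some a \<notin># A" using setL setA by auto
      then show ?thesis by (simp add: not_in_iff)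
    qed (use c cntA cntL in auto)
    have sz: "size B = count B None + (\<Sum>a\<in>F. count B (Some a))" if "set_mset B \<subseteq> insert None (Some ` F)" for B
    proof -
      have "size B = (\<Sum>x\<in>set_mset B. count B x)" by (simp add: size_multiset_overloaded_eq)
      also have "\<dots> = (\<Sum>x\<in>insert None (Some ` F). count B x)"
        using that F by (intro sum.mono_neutral_left) (auto simp: not_in_iff)
      also have "\<dots> = count B None + (\<Sum>a\<in>F. count B (Some a))"
        using F by (subst sum.insert) (auto simp: sum.reindex)
      finally show ?thesis .
    qed
    have "size (mset (L \<omega>)) = n" unfolding L_def by simp
    \<comment> \<open>The multiplicity of \<open>None\<close> is forced, since both multisets have n
      elements.\<close>
    then have "count (mset (L \<omega>)) None = count A None"
      using sz[OF setL] sz[OF setA] sizeA some by simp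
    then show "mset (L \<omega>) = A" using some by (intro multiset_eqI) (metis option.exhaust)
  next
    assume "mset (L \<omega>) = A"
    then show "\<forall>a\<in>F. cnt n a \<omega> = w a" using cntL cntA by metis
  qed
  have probL: "prob {\<omega>\<in>space M. L \<omega> = xs} = prod_mset (image_mset q A)"
    and evL: "{\<omega>\<in>space M. L \<omega> = xs} \<in> events" if xs: "xs \<in> permutations_of_multiset A" for xs
  proof -
    have len: "length xs = n" and ms: "mset xs = A"
      using xs sizeA by (auto simp: permutations_of_multiset_def)
    have eq: "{\<omega>\<in>space M. L \<omega> = xs} = {\<omega>\<in>space M. \<forall>i\<in>{1..n}. lab (C i \<omega>) = xs ! (i - 1)}"
    proof -
      have "L \<omega> = xs \<longleftrightarrow> (\<forall>i\<in>{1..n}. lab (C i \<omega>) = xs ! (i - 1))" for \<omega>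
      proof
        assume h: "\<forall>i\<in>{1..n}. lab (C i \<omega>) = xs ! (i - 1)"
        show "L \<omega> = xs" unfolding L_def
        proof (rule nth_equalityI)
          fix i assume "i < length (map (\<lambda>i. lab (C (i+1) \<omega>)) [0..<n])"
          then show "map (\<lambda>i. lab (C (i+1) \<omega>)) [0..<n] ! i = xs ! i" using h[rule_format, of "i + 1"] by simp
        qed (simp add: len)
      next
        assume "L \<omega> = xs"
        then show "\<forall>i\<in>{1..n}. lab (C i \<omega>) = xs ! (i - 1)" unfolding L_def by auto
      qed
      then show ?thesis by auto
    qed
    show "{\<omega>\<in>space M. L \<omega> = xs} \<in> events" unfolding eq by measurable
    have "prob {\<omega>\<in>space M. L \<omega> = xs} = (\<Prod>i\<in>{1..n}. q (xs ! (i - 1)))"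
    proof (cases "n = 0")
      case True
      then show ?thesis unfolding eq by (simp add: prob_space)
    next
      case False
      have "{\<omega>\<in>space M. L \<omega> = xs} = (\<Inter>i\<in>{1..n}. C i -` (lab -` {xs ! (i-1)}) \<inter> space M)"
        unfolding eq using False by auto
      then have "prob {\<omega>\<in>space M. L \<omega> = xs} = (\<Prod>i\<in>{1..n}. prob (C i -` (lab -` {xs ! (i-1)}) \<inter> space M))"
        using indep_varsD[OF indep, of "{1..n}" "\<lambda>i. lab -` {xs ! (i-1)}"] False by auto
      also have "\<dots> = (\<Prod>i\<in>{1..n}. q (xs ! (i - 1)))"
      proof (rule prod.cong)
        fix i assume i: "i \<in> {1..n}"
        then have "xs ! (i - 1) \<in># A" unfolding ms[symmetric] using len by auto
        moreover have "C i -` (lab -` {xs ! (i-1)}) \<inter> space M = {\<omega>\<in>space M. lab (C i \<omega>) = xs ! (i - 1)}" by auto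
        ultimately show "prob (C i -` (lab -` {xs ! (i-1)}) \<inter> space M) = q (xs ! (i - 1))" using q_lab[OF i] by simp
      qed simp
      finally show ?thesis .
    qed
    also have "\<dots> = (\<Prod>i\<in>{0..<n}. q (xs ! i))"
      by (rule prod.reindex_bij_witness[of _ "\<lambda>i. i + 1" "\<lambda>i. i - 1"]) auto
    also have "\<dots> = prod_list (map q xs)" using len by (simp add: prod.list_conv_set_nth)
    also have "\<dots> = prod_mset (image_mset q A)" unfolding ms[symmetric] by (simp add: prod_mset_prod_list[symmetric])
    finally show "prob {\<omega>\<in>space M. L \<omega> = xs} = prod_mset (image_mset q A)" .
  qed
  have "{\<omega>\<in>space M. \<forall>a\<in>F. cnt n a \<omega> = w a} = (\<Union>xs\<in>permutations_of_multiset A. {\<omega>\<in>space M. L \<omega> = xs})"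
    unfolding ev by (auto simp: permutations_of_multiset_def)
  then have "prob {\<omega>\<in>space M. \<forall>a\<in>F. cnt n a \<omega> = w a} = (\<Sum>xs\<in>permutations_of_multiset A. prob {\<omega>\<in>space M. L \<omega> = xs})"
    using evL by (simp only:) (intro finite_measure_finite_Union, auto simp: disjoint_family_on_def)
  also have "\<dots> = card (permutations_of_multiset A) * prod_mset (image_mset q A)"
    using probL by simp
  also have "real (card (permutations_of_multiset A)) = fact n / ((\<Prod>a\<in>F. fact (w a)) * fact (n - W))"
  proof -
    have "(\<Prod>x\<in>set_mset A. fact (count A x)) = (\<Prod>x\<in>insert None (Some ` F). fact (count A x) :: nat)"
    proof (rule prod.mono_neutral_left)
      show "set_mset A \<subseteq> insert None (Some ` F)"
        using F unfolding A_def by (auto simp: set_mset_sum in_replicate_mset split: if_splits)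
      show "\<forall>i\<in>insert None (Some ` F) - set_mset A. fact (count A i) = (1::nat)"
        by (auto simp: not_in_iff)
    qed (use F in simp)
    also have "\<dots> = fact (n - W) * (\<Prod>a\<in>F. fact (w a))"
      using F by (subst prod.insert) (auto simp: prod.reindex cntA cntA0)
    finally have "card (permutations_of_multiset A) * (fact (n - W) * (\<Prod>a\<in>F. fact (w a))) = fact n"
      using card_permutations_of_multiset_aux[of A] sizeA by simp
    then have "real (card (permutations_of_multiset A)) * (fact (n - W) * (\<Prod>a\<in>F. fact (w a))) = fact n"
      by (metis (mono_tags, lifting) of_nat_fact of_nat_mult of_nat_prod prod.cong)
    moreover have "(fact (n - W) * (\<Prod>a\<in>F. fact (w a)) :: real) \<noteq> 0" using F by (simp add: prod_zero_iff)
    ultimately show ?thesis by (simp add: field_simps)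
  qed
  also have "prod_mset (image_mset q A) = (\<Prod>a\<in>F. p a ^ w a) * (1 - (\<Sum>a\<in>F. p a)) ^ (n - W)"
  proof -
    have "prod_mset (image_mset q (\<Sum>a\<in>F. replicate_mset (w a) (Some a))) = (\<Prod>a\<in>F. p a ^ w a)"
      using F by (induction F rule: finite_induct) (auto simp: q_def)
    then show ?thesis unfolding A_def by (simp add: q_def)
  qed
  finally show ?thesis unfolding W_def by (simp add: mult.assoc)
qed

text \<open>Second moment method for the events that the cells z + F carry exactly the counts w:
  for disjoint z + F and z' + F these events are almost uncorrelated, because the joint
  multinomial probability exceeds the product only through the factors (1 - x)^-W.\<close>
lemma exists_translate_with_counts:
  assumes F: "finite F" and Z: "finite Z"
    and disj: "\<And>z z' a a'. z \<in> Z \<Longrightarrow> z' \<in> Z \<Longrightarrow> a \<in> F \<Longrightarrow> a' \<in> F \<Longrightarrow> z + a = z' + a' \<Longrightarrow> z = z'"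
    and W: "W = (\<Sum>a\<in>F. w a)" "2 * W \<le> n"
    and x: "\<And>z. z \<in> Z \<Longrightarrow> (\<Sum>a\<in>F. p (z + a)) \<le> x" "x * real W \<le> 1 / 4" "x < 1"
    and pr: "\<And>z. z \<in> Z \<Longrightarrow> pr \<le> prob {\<omega>\<in>space M. \<forall>a\<in>F. cnt n (z + a) \<omega> = w a}" "0 < pr"
    and ne: "Z \<noteq> {}"
  shows "except (1 / (real (card Z) * pr) + 4 * x * real W) (\<lambda>\<omega>. \<exists>z\<in>Z. \<forall>a\<in>F. cnt n (z + a) \<omega> = w a)"
proof -
  define A where "A z = {\<omega>\<in>space M. \<forall>a\<in>F. cnt n (z + a) \<omega> = w a}" for z
  have [measurable]: "A z \<in> events" for z unfolding A_def using F by measurable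
  have x0: "0 \<le> x"
  proof -
    obtain z where "z \<in> Z" using ne by auto
    then show ?thesis using x(1)[of z] p_nonneg by (meson order_trans sum_nonneg)
  qed
  define f where "f z = (\<Sum>a\<in>F. p (z + a))" for z
  define b where "b z = (\<Prod>a\<in>F. p (z + a) ^ w a)" for z
  define D where "D = (\<Prod>a\<in>F. fact (w a) :: real)"
  have D0: "D > 0" unfolding D_def by (intro prod_pos) auto
  have f0: "0 \<le> f z" for z unfolding f_def using p_nonneg by (intro sum_nonneg) auto
  have b0: "0 \<le> b z" for z unfolding b_def using p_nonneg by (intro prod_nonneg) auto
  have inj: "inj_on (\<lambda>a. z + a) F" for z by (auto simp: inj_on_def)
  have Aeq: "A z = {\<omega>\<in>space M. \<forall>c\<in>(\<lambda>a. z + a) ` F. cnt n c \<omega> = w (c - z)}" for z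
    unfolding A_def by auto
  have P1: "prob (A z) = fact n / (D * fact (n - W)) * b z * (1 - f z) ^ (n - W)" for z
  proof -
    have s: "(\<Sum>c\<in>(\<lambda>a. z + a) ` F. w (c - z)) = W" by (simp add: sum.reindex[OF inj] W)
    have "prob (A z) = fact n / ((\<Prod>c\<in>(\<lambda>a. z + a) ` F. fact (w (c - z))) * fact (n - W)) *
       (\<Prod>c\<in>(\<lambda>a. z + a) ` F. p c ^ w (c - z)) * (1 - (\<Sum>c\<in>(\<lambda>a. z + a) ` F. p c)) ^ (n - W)"
      unfolding Aeq using prob_cnt_eq[of "(\<lambda>a. z + a) ` F" "\<lambda>c. w (c - z)" n] F s W(2) by simp
    then show ?thesis by (simp add: sum.reindex[OF inj] prod.reindex[OF inj] D_def b_def f_def)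
  qed
  have P2: "prob (A z \<inter> A z') = fact n / (D * D * fact (n - 2 * W)) * (b z * b z') * (1 - (f z + f z')) ^ (n - 2 * W)"
    if z: "z \<in> Z" "z' \<in> Z" "z \<noteq> z'" for z z'
  proof -
    define F1 where "F1 = (\<lambda>a. z + a) ` F"
    define F2 where "F2 = (\<lambda>a. z' + a) ` F"
    have dj: "F1 \<inter> F2 = {}" unfolding F1_def F2_def using disj z by auto
    have fin: "finite F1" "finite F2" unfolding F1_def F2_def using F by auto
    define u where "u c = (if c \<in> F1 then w (c - z) else w (c - z'))" for c
    have u2: "u c = w (c - z')" if "c \<in> F2" for c using that dj unfolding u_def by auto
    have u1: "u c = w (c - z)" if "c \<in> F1" for c using that unfolding u_def by auto
    have AA: "A z \<inter> A z' = {\<omega>\<in>space M. \<forall>c\<in>F1 \<union> F2. cnt n c \<omega> = u c}"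
      unfolding Aeq F1_def[symmetric] F2_def[symmetric] using u1 u2 by (simp add: ball_Un) auto
    have S1: "(\<Sum>c\<in>F1. u c) = W" "(\<Sum>c\<in>F1. p c) = f z" "(\<Prod>c\<in>F1. fact (u c)) = D" "(\<Prod>c\<in>F1. p c ^ u c) = b z"
      using u1 by (auto simp: F1_def sum.reindex[OF inj] prod.reindex[OF inj] W D_def f_def b_def)
    have S2: "(\<Sum>c\<in>F2. u c) = W" "(\<Sum>c\<in>F2. p c) = f z'" "(\<Prod>c\<in>F2. fact (u c)) = D" "(\<Prod>c\<in>F2. p c ^ u c) = b z'"
      using u2 by (auto simp: F2_def sum.reindex[OF inj] prod.reindex[OF inj] W D_def f_def b_def)
    have sW: "(\<Sum>c\<in>F1 \<union> F2. u c) = 2 * W" using S1 S2 fin dj by (simp add: sum.union_disjoint)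
    have "prob (A z \<inter> A z') = fact n / ((\<Prod>c\<in>F1 \<union> F2. fact (u c)) * fact (n - 2 * W)) *
       (\<Prod>c\<in>F1 \<union> F2. p c ^ u c) * (1 - (\<Sum>c\<in>F1 \<union> F2. p c)) ^ (n - 2 * W)"
      unfolding AA using prob_cnt_eq[of "F1 \<union> F2" u n] fin sW W(2) by simp
    then show ?thesis using S1 S2 fin dj by (simp add: sum.union_disjoint prod.union_disjoint)
  qed
  have pair: "prob (A z \<inter> A z') \<le> (1 + 4 * x * W) * prob (A z) * prob (A z')"
    if z: "z \<in> Z" "z' \<in> Z" "z \<noteq> z'" for z z'
  proof -
    have fx: "f z \<le> x" "f z' \<le> x" using x z unfolding f_def by auto
    have f1: "0 < 1 - f z" "0 < 1 - f z'" using fx x by auto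
    \<comment> \<open>The two translates are disjoint, so their total mass is a probability; this
      keeps the base of the power in \<open>P2\<close> nonnegative.\<close>
    have le1: "0 \<le> 1 - (f z + f z')"
    proof -
      have "(\<Sum>c\<in>(\<lambda>a. z + a) ` F \<union> (\<lambda>a. z' + a) ` F. p c) \<le> 1"
      proof -
        have [measurable]: "C 1 \<in> measurable M (count_space UNIV)" using measurable_C by auto
        have fin: "finite ((\<lambda>a. z + a) ` F \<union> (\<lambda>a. z' + a) ` F)" using F by auto
        have e: "{\<omega>\<in>space M. C 1 \<omega> = c} \<in> events" for c by measurable
        have "(\<Sum>c\<in>(\<lambda>a. z + a) ` F \<union> (\<lambda>a. z' + a) ` F. prob {\<omega>\<in>space M. C 1 \<omega> = c})
          = prob (\<Union>c\<in>(\<lambda>a. z + a) ` F \<union> (\<lambda>a. z' + a) ` F. {\<omega>\<in>space M. C 1 \<omega> = c})"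
          using fin e by (intro finite_measure_finite_Union[symmetric]) (auto simp: disjoint_family_on_def)
        then show ?thesis using p[of 1] by simp
      qed
      moreover have "(\<Sum>c\<in>(\<lambda>a. z + a) ` F \<union> (\<lambda>a. z' + a) ` F. p c) = f z + f z'"
      proof (subst sum.union_disjoint)
        show "(\<lambda>a. z + a) ` F \<inter> (\<lambda>a. z' + a) ` F = {}" using disj z by auto
      qed (use F in \<open>auto simp: sum.reindex[OF inj] f_def\<close>)
      ultimately show ?thesis by simp
    qed
    have fa: "fact n / (D * D * fact (n - 2 * W)) \<le> fact n / (D * fact (n - W)) * (fact n / (D * fact (n - W)))"
    proof -
      \<comment> \<open>Log-convexity of the factorial: the factors of (n - W)! / (n - 2 W)! are
        those of n! / (n - W)!, each lowered by W.\<close>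
      have "fact (n - W) * fact (n - W) \<le> fact n * (fact (n - 2 * W) :: nat)"
      proof -
        have "fact (n - W) = fact (n - 2 * W) * (\<Prod>i\<in>{n - 2 * W<..n - W}. i)"
        proof -
          have "fact (n - W) = \<Prod>{1..n - W}" by (simp add: fact_prod)
          also have "{1..n - W} = {1..n - 2 * W} \<union> {n - 2 * W<..n - W}" using W by auto
          also have "\<Prod>\<dots> = \<Prod>{1..n - 2 * W} * \<Prod>{n - 2 * W<..n - W}" by (rule prod.union_disjoint) auto
          finally show ?thesis by (simp add: fact_prod)
        qed
        also have "(\<Prod>i\<in>{n - 2 * W<..n - W}. i) \<le> (\<Prod>i\<in>{n - 2 * W<..n - W}. i + W)"
          by (intro prod_mono) auto
        also have "(\<Prod>i\<in>{n - 2 * W<..n - W}. i + W) = \<Prod>{n - W<..n}"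
          by (rule prod.reindex_bij_witness[of _ "\<lambda>i. i - W" "\<lambda>i. i + W"]) (use W in auto)
        finally have "fact (n - W) \<le> fact (n - 2 * W) * (\<Prod>{n - W<..n} :: nat)" by simp
        then have "fact (n - W) * fact (n - W) \<le> (fact (n - W) * \<Prod>{n - W<..n}) * (fact (n - 2 * W) :: nat)"
          by (metis mult.assoc mult.commute mult_le_mono2)
        also have "fact (n - W) * \<Prod>{n - W<..n} = (fact n :: nat)"
        proof -
          have "fact n = \<Prod>{1..n}" by (simp add: fact_prod)
          also have "{1..n} = {1..n - W} \<union> {n - W<..n}" using W by auto
          also have "\<Prod>\<dots> = \<Prod>{1..n - W} * \<Prod>{n - W<..n}" by (rule prod.union_disjoint) auto
          finally show ?thesis by (simp add: fact_prod)
        qed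
        finally show ?thesis .
      qed
      then have "real (fact (n - W) * fact (n - W)) \<le> real (fact n * fact (n - 2 * W))"
        by (simp only: of_nat_le_iff)
      then have "fact (n - W) * fact (n - W) \<le> fact n * (fact (n - 2 * W) :: real)" by simp
      then show ?thesis using D0 by (simp add: field_simps)
    qed
    have pw: "(1 - (f z + f z')) ^ (n - 2 * W) \<le> (1 + 4 * x * W) * ((1 - f z) ^ (n - W) * (1 - f z') ^ (n - W))"
    proof -
      let ?y = "(1 - f z) * (1 - f z')"
      have y: "1 - (f z + f z') \<le> ?y" using f0[of z] f0[of z'] by (simp add: algebra_simps)
      have y0: "0 < ?y" using f1 by simp
      \<comment> \<open>The exponents n - 2 W and n - W differ by W. The missing factor
        \<open>?y ^ W\<close> is at least 1 - 2 W x by Bernoulli, and x W \<le> 1 / 4 makes (1 + 4 x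
        W) (1 - 2 W x) at least 1.\<close>
      have "(1 - x) ^ (2 * W) \<le> ?y ^ W"
      proof -
        have "(1 - x) ^ (2 * W) = ((1 - x) * (1 - x)) ^ W" by (simp add: power_mult power2_eq_square)
        also have "\<dots> \<le> ?y ^ W" using fx x(3) by (intro power_mono mult_mono) auto
        finally show ?thesis .
      qed
      moreover have "1 - 2 * W * x \<le> (1 - x) ^ (2 * W)"
        using Bernoulli_inequality[of "-x" "2 * W"] x(3) by simp
      ultimately have yW: "1 - 2 * W * x \<le> ?y ^ W" by linarith
      have h: "1 \<le> (1 + 4 * x * W) * (1 - 2 * W * x)"
      proof -
        have "(1 + 4 * x * W) * (1 - 2 * W * x) = 1 + 2 * (x * W) * (1 - 4 * (x * W))" by (simp add: algebra_simps)
        moreover have "0 \<le> 2 * (x * W) * (1 - 4 * (x * W))" using x(2) x0 by simp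
        ultimately show ?thesis by linarith
      qed
      have xW: "0 \<le> 4 * x * W" using x0 by simp
      have "1 \<le> (1 + 4 * x * W) * ?y ^ W"
        using h mult_left_mono[OF yW, of "1 + 4 * x * W"] xW by linarith
      then have "?y ^ (n - 2 * W) \<le> ((1 + 4 * x * W) * ?y ^ W) * ?y ^ (n - 2 * W)"
        using y0 by (metis mult_le_cancel_right1 not_less_iff_gr_or_eq order_less_imp_le zero_less_power linorder_not_less)
      also have "\<dots> = (1 + 4 * x * W) * ?y ^ (n - W)"
      proof -
        have e: "W + (n - 2 * W) = n - W" using W by auto
        have "?y ^ W * ?y ^ (n - 2 * W) = ?y ^ (n - W)" unfolding power_add[symmetric] e by (rule refl)
        then show ?thesis by (simp only: mult.assoc)
      qed
      finally have "?y ^ (n - 2 * W) \<le> (1 + 4 * x * W) * ?y ^ (n - W)" .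
      moreover have "(1 - (f z + f z')) ^ (n - 2 * W) \<le> ?y ^ (n - 2 * W)" using le1 y by (intro power_mono) auto
      ultimately show ?thesis by (simp add: power_mult_distrib)
    qed
    have "prob (A z \<inter> A z') \<le> (fact n / (D * fact (n - W)) * (fact n / (D * fact (n - W)))) * (b z * b z') *
       ((1 + 4 * x * W) * ((1 - f z) ^ (n - W) * (1 - f z') ^ (n - W)))"
      unfolding P2[OF z] using fa pw b0 D0 le1
      by (intro mult_mono mult_right_mono mult_nonneg_nonneg zero_le_power divide_nonneg_nonneg) auto
    then show ?thesis unfolding P1 by (simp add: mult_ac)
  qed
  have "except (1 / (real (card Z) * pr) + 4 * x * real W) (\<lambda>\<omega>. \<exists>z\<in>Z. \<omega> \<in> A z)"
  proof (rule prob_none_le_second_moment[OF Z])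
    show "0 < real (card Z) * pr" using ne Z pr(2) by (simp add: card_gt_0_iff)
    have "(\<Sum>z\<in>Z. pr) \<le> (\<Sum>z\<in>Z. prob (A z))" unfolding A_def by (intro sum_mono pr)
    then show "real (card Z) * pr \<le> (\<Sum>z\<in>Z. prob (A z))" by simp
    show "0 \<le> 4 * x * real W" using x0 by simp
  qed (use pair in auto)
  then show ?thesis by (rule except_mono) (auto simp: A_def)
qed

end

section \<open>Cells of a grid\<close>

definition cell :: "real \<Rightarrow> real^'d \<Rightarrow> int^'d" where
  "cell s x = (\<chi> i. \<lfloor>x $ i / s\<rfloor>)"

lemma cell_eq_iff:
  assumes "s > 0"
  shows "cell s x = z \<longleftrightarrow> (\<forall>i. s * of_int (z $ i) \<le> x $ i \<and> x $ i < s * (of_int (z $ i) + 1))"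
proof -
  have "\<lfloor>x $ i / s\<rfloor> = z $ i \<longleftrightarrow> s * of_int (z $ i) \<le> x $ i \<and> x $ i < s * (of_int (z $ i) + 1)" for i
    using assms by (auto simp: floor_eq_iff field_simps)
  then show ?thesis by (simp add: cell_def vec_eq_iff)
qed

lemma measurable_cell: "cell s \<in> measurable borel (count_space UNIV)"
  unfolding measurable_count_space_eq2_countable
proof (intro conjI ballI)
  fix z :: "int^'d"
  have "cell s -` {z} \<inter> space borel = {x\<in>space borel. \<forall>i\<in>UNIV. \<lfloor>x $ i / s\<rfloor> = z $ i}"
    by (auto simp: cell_def vec_eq_iff)
  also have "\<dots> \<in> sets borel" by measurable
  finally show "cell s -` {z} \<inter> space borel \<in> sets borel" .
qed simp

lemma sets_cell[measurable]: "cell s -` {z} \<in> sets borel"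
  using measurable_sets[OF measurable_cell, of "{z}" s] by simp

lemma emeasure_cell:
  fixes z :: "int^'d"
  assumes "s > 0"
  shows "emeasure lborel (cell s -` {z}) = ennreal (s ^ CARD('d))"
proof -
  define a where "a = (\<chi> i. s * of_int (z $ i) :: real^'d)"
  define b where "b = (\<chi> i. s * (of_int (z $ i) + 1) :: real^'d)"
  have ab: "\<forall>v\<in>Basis. a \<bullet> v \<le> b \<bullet> v"
    using assms by (auto simp: a_def b_def Basis_vec_def inner_axis)
  have pr: "(\<Prod>v\<in>Basis. (b - a) \<bullet> v) = s ^ CARD('d)"
  proof -
    have "(\<Prod>v\<in>Basis. (b - a) \<bullet> v) = (\<Prod>v\<in>(Basis :: (real^'d) set). s)"
    proof (rule prod.cong)
      fix v :: "real^'d" assume "v \<in> Basis"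
      then obtain i where "v = axis i 1" by (auto simp: Basis_vec_def)
      then show "(b - a) \<bullet> v = s" by (simp add: a_def b_def inner_axis algebra_simps)
    qed simp
    then show ?thesis by simp
  qed
  have "cell s -` {z} = {x. \<forall>i. a $ i \<le> x $ i \<and> x $ i < b $ i}"
    using cell_eq_iff[OF assms, of _ z] by (simp add: a_def b_def vimage_def)
  then have sub: "box a b \<subseteq> cell s -` {z}" "cell s -` {z} \<subseteq> cbox a b"
    by (auto simp: mem_box_cart less_imp_le)
  have "emeasure lborel (box a b) \<le> emeasure lborel (cell s -` {z})"
    by (rule emeasure_mono[OF sub(1)]) simp
  moreover have "emeasure lborel (cell s -` {z}) \<le> emeasure lborel (cbox a b)"
    by (rule emeasure_mono[OF sub(2)]) simp
  ultimately show ?thesis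
    using ab pr by (simp add: emeasure_lborel_box_eq emeasure_lborel_cbox_eq)
qed

text \<open>Equivalence of N with the maximum norm, with one constant for both directions. Expanding
  along the axes bounds N from above and makes it Lipschitz; so N attains its minimum on the
  Euclidean sphere, and this minimum is positive.\<close>

lemma is_norm_component_bounds:
  fixes N :: "real^'d \<Rightarrow> real"
  assumes "is_norm N"
  obtains \<beta> where "\<beta> > 0" "\<And>x i. \<bar>x $ i\<bar> \<le> \<beta> * N x" "\<And>x c. (\<And>i. \<bar>x $ i\<bar> \<le> c) \<Longrightarrow> N x \<le> \<beta> * c"
proof -
  have N0: "\<And>x. N x = 0 \<longleftrightarrow> x = 0" and tri: "\<And>x y. N (x + y) \<le> N x + N y"
    and hom: "\<And>c x. N (c *\<^sub>R x) = \<bar>c\<bar> * N x"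
    using assms unfolding is_norm_def by auto
  have neg: "N (- x) = N x" for x using hom[of "-1" x] by simp
  have nonneg: "0 \<le> N x" for x using tri[of x "-x"] N0[of 0] neg[of x] by simp
  define L where "L = (\<Sum>i\<in>UNIV. N (axis i 1))"
  have L0: "0 \<le> L" unfolding L_def using nonneg by (intro sum_nonneg) auto
  have sumle: "N (\<Sum>i\<in>I. g i) \<le> (\<Sum>i\<in>I. N (g i))" if "finite I" for I :: "'d set" and g
    using that
  proof (induction I rule: finite_induct)
    case (insert i I) then show ?case using tri[of "g i" "sum g I"] by simp
  qed (use N0[of 0] in simp)
  have up: "N x \<le> L * c" if "\<And>i. \<bar>x $ i\<bar> \<le> c" for x c
  proof -
    have "x = (\<Sum>i\<in>UNIV. x $ i *\<^sub>R axis i 1)" by (simp add: vec_eq_iff axis_def if_distrib cong: if_cong)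
    then have "N x \<le> (\<Sum>i\<in>UNIV. N (x $ i *\<^sub>R axis i 1))" using sumle[of UNIV] by (metis finite)
    also have "\<dots> \<le> (\<Sum>i\<in>UNIV. c * N (axis i 1))"
      using that nonneg by (intro sum_mono) (simp add: hom mult_right_mono)
    also have "\<dots> = L * c" by (simp add: L_def sum_distrib_left mult.commute)
    finally show ?thesis .
  qed
  have upn: "N x \<le> L * norm x" for x by (rule up) (rule component_le_norm_cart)
  have "L-lipschitz_on UNIV N"
  proof (rule lipschitz_onI)
    fix x y
    have "N x \<le> N (x - y) + N y" "N y \<le> N (y - x) + N x" using tri[of "x - y" y] tri[of "y - x" x] by simp_all
    moreover have "N (y - x) = N (x - y)" using neg[of "x - y"] by simp
    ultimately have "\<bar>N x - N y\<bar> \<le> N (x - y)" by linarith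
    also have "\<dots> \<le> L * norm (x - y)" by (rule upn)
    finally show "dist (N x) (N y) \<le> L * dist x y" by (simp add: dist_norm)
  qed (rule L0)
  then have cont: "continuous_on (sphere 0 1) N"
    by (meson lipschitz_on_continuous_on continuous_on_subset subset_UNIV)
  have "axis undefined 1 \<in> sphere (0 :: real^'d) 1" by simp
  then obtain x0 where x0: "x0 \<in> sphere 0 1" "\<And>y. y \<in> sphere 0 1 \<Longrightarrow> N x0 \<le> N y"
    using continuous_attains_inf[OF compact_sphere _ cont] by (metis empty_iff)
  define m where "m = N x0"
  have m0: "m > 0" using x0(1) N0[of x0] nonneg[of x0] unfolding m_def by (force simp: less_le)
  have low: "m * norm x \<le> N x" for x
  proof (cases "x = 0")
    case False
    then have "m \<le> N (inverse (norm x) *\<^sub>R x)" unfolding m_def by (intro x0(2)) simp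
    then show ?thesis using False by (simp add: hom field_simps)
  qed (use nonneg[of 0] in simp)
  define \<beta> where "\<beta> = max (1 / m) L"
  have "\<bar>x $ i\<bar> \<le> \<beta> * N x" for x i
  proof -
    have "\<bar>x $ i\<bar> \<le> norm x" by (rule component_le_norm_cart)
    also have "\<dots> \<le> 1 / m * N x" using low[of x] m0 by (simp add: field_simps)
    also have "\<dots> \<le> \<beta> * N x" unfolding \<beta>_def using nonneg by (intro mult_right_mono) auto
    finally show ?thesis .
  qed
  moreover have "N x \<le> \<beta> * c" if "\<And>i. \<bar>x $ i\<bar> \<le> c" for x c
  proof -
    have "0 \<le> c" using that[of undefined] by linarith
    then have "L * c \<le> \<beta> * c" unfolding \<beta>_def by (intro mult_right_mono) auto
    then show ?thesis using up[OF that] by linarith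
  qed
  moreover have "\<beta> > 0" unfolding \<beta>_def using m0 by (simp add: less_max_iff_disj)
  ultimately show thesis using that by blast
qed

text \<open>Two cells whose index vectors differ by e contain points at N-distance at most 1/\<epsilon>, in units of
  the side length.\<close>
definition cell_adj :: "(real^'d \<Rightarrow> real) \<Rightarrow> real \<Rightarrow> int^'d \<Rightarrow> bool" where
  "cell_adj N \<epsilon> e \<longleftrightarrow> (\<exists>u. (\<forall>i. \<bar>u $ i - of_int (e $ i)\<bar> < 1) \<and> N u \<le> 1 / \<epsilon>)"

lemma cell_diff_bound:
  fixes x y :: "real^'d"
  assumes "s > 0"
  shows "\<bar>(x $ i - y $ i) / s - of_int ((cell s x - cell s y) $ i)\<bar> < 1"
proof -
  have "(x $ i - y $ i) / s - of_int ((cell s x - cell s y) $ i)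
     = (x $ i / s - of_int \<lfloor>x $ i / s\<rfloor>) - (y $ i / s - of_int \<lfloor>y $ i / s\<rfloor>)"
    by (simp add: cell_def diff_divide_distrib)
  then show ?thesis by linarith
qed

lemma cell_adj_of_close:
  assumes "is_norm N" "s > 0" "\<epsilon> > 0" "N (x - y) \<le> s / \<epsilon>"
  shows "cell_adj N \<epsilon> (cell s x - cell s y)"
  unfolding cell_adj_def
proof (intro exI[of _ "(1 / s) *\<^sub>R (x - y)"] conjI allI)
  fix i show "\<bar>((1 / s) *\<^sub>R (x - y)) $ i - of_int ((cell s x - cell s y) $ i)\<bar> < 1"
    using cell_diff_bound[OF assms(2), of x i y] by simp
  have "N ((1 / s) *\<^sub>R (x - y)) = (1 / s) * N (x - y)"
    using assms(1,2) unfolding is_norm_def by simp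
  also have "\<dots> \<le> (1 / s) * (s / \<epsilon>)" using assms by (intro mult_left_mono) auto
  finally show "N ((1 / s) *\<^sub>R (x - y)) \<le> 1 / \<epsilon>" using assms by simp
qed

lemma cell_adj_0: 
  assumes "is_norm N" "\<epsilon> > 0"
  shows "cell_adj N \<epsilon> 0"
proof -
  have "N 0 = 0" using assms(1) unfolding is_norm_def by blast
  then show ?thesis unfolding cell_adj_def using assms(2) by (intro exI[of _ 0]) simp
qed

text \<open>The witness u and (x - y) / s are both within 1 of the index difference in every
  coordinate, so they differ by at most 2 there. Compared with s / \<epsilon> this loses the factor
  1 + 2 \<beta> \<epsilon>, which the finer grid has to compensate.\<close>

lemma close_of_cell_adj:
  assumes "is_norm N" "s > 0" and \<beta>: "\<And>x c. (\<And>i. \<bar>x $ i\<bar> \<le> c) \<Longrightarrow> N x \<le> \<beta> * c"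
    and "cell_adj N \<epsilon> (cell s x - cell s y)"
  shows "N (x - y) \<le> s * (1 / \<epsilon> + 2 * \<beta>)"
proof -
  obtain u where u: "\<And>i. \<bar>u $ i - of_int ((cell s x - cell s y) $ i)\<bar> < 1" "N u \<le> 1 / \<epsilon>"
    using assms(4) unfolding cell_adj_def by blast
  define w where "w = (1 / s) *\<^sub>R (x - y) - u"
  have "N w \<le> \<beta> * 2"
  proof (rule \<beta>)
    fix i
    have "w $ i = ((x $ i - y $ i) / s - of_int ((cell s x - cell s y) $ i)) - (u $ i - of_int ((cell s x - cell s y) $ i))"
      unfolding w_def by simp
    then show "\<bar>w $ i\<bar> \<le> 2" using cell_diff_bound[OF assms(2), of x i y] u(1)[of i] by linarith
  qed
  moreover have "x - y = s *\<^sub>R (u + w)" unfolding w_def using assms(2) by simp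
  then have "N (x - y) = s * N (u + w)" using assms(1,2) unfolding is_norm_def by simp
  moreover have "N (u + w) \<le> N u + N w" using assms(1) unfolding is_norm_def by blast
  ultimately show ?thesis using u(2) assms(2) by (simp add: mult_left_mono)
qed

lemma cell_adj_bound:
  assumes \<beta>: "\<And>x i. \<bar>x $ i\<bar> \<le> \<beta> * N x" and "\<beta> > 0" and "cell_adj N \<epsilon> e"
  shows "\<bar>e $ i\<bar> \<le> int (nat \<lceil>\<beta> / \<epsilon> + 1\<rceil>)"
proof -
  obtain u where u: "\<And>i. \<bar>u $ i - of_int (e $ i)\<bar> < 1" "N u \<le> 1 / \<epsilon>"
    using assms(3) unfolding cell_adj_def by blast
  have "\<bar>u $ i\<bar> \<le> \<beta> * (1 / \<epsilon>)" using \<beta>[of u i] mult_left_mono[OF u(2), of \<beta>] assms(2) by linarith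
  then have "real_of_int \<bar>e $ i\<bar> \<le> \<beta> / \<epsilon> + 1" using u(1)[of i] by simp
  then show ?thesis by linarith
qed

section \<open>Cell masses under a bounded density\<close>

lemma measure_cell_le:
  fixes f :: "real^'d \<Rightarrow> ennreal"
  assumes [measurable]: "f \<in> borel_measurable lborel" and "AE x in lborel. f x \<le> ennreal \<sigma>" "0 \<le> \<sigma>" "s > 0"
  shows "measure (density lborel f) (cell s -` {z}) \<le> \<sigma> * s ^ CARD('d)"
proof -
  have "emeasure (density lborel f) (cell s -` {z}) = (\<integral>\<^sup>+x. f x * indicator (cell s -` {z}) x \<partial>lborel)"
    by (rule emeasure_density) auto
  also have "\<dots> \<le> (\<integral>\<^sup>+x. ennreal \<sigma> * indicator (cell s -` {z}) x \<partial>lborel)"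
    by (rule nn_integral_mono_AE) (use assms(2) in \<open>auto simp: mult_right_mono\<close>)
  also have "\<dots> = ennreal (\<sigma> * s ^ CARD('d))"
    using assms by (simp add: nn_integral_cmult_indicator emeasure_cell ennreal_mult)
  finally show ?thesis using assms by (simp add: measure_def enn2real_leI)
qed

text \<open>Near a compact set B of positive measure on which the density almost attains its essential
  supremum, most boxes meeting B are almost filled by B.\<close>
lemma many_dense_boxes:
  fixes f :: "real^'d \<Rightarrow> ennreal"
  assumes [measurable]: "f \<in> borel_measurable lborel" and "prob_space (density lborel f)"
    and \<sigma>: "0 < \<sigma>" "\<And>\<sigma>'. \<sigma>' < \<sigma> \<Longrightarrow> \<not> (AE x in lborel. f x \<le> ennreal \<sigma>')"
    and \<epsilon>: "0 < \<epsilon>" "\<epsilon> < 1" and K: "0 < K"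
  obtains c s0 where "0 < c" "0 < s0"
    "\<And>s. 0 < s \<Longrightarrow> s < s0 \<Longrightarrow> \<exists>Z :: (int^'d) set. finite Z \<and> c \<le> real (card Z) * s ^ CARD('d) \<and>
       (\<forall>z\<in>Z. \<forall>z'\<in>Z. \<forall>a\<in>cube K. \<forall>a'\<in>cube K. z + a = z' + a' \<longrightarrow> z = z') \<and>
       (\<forall>z\<in>Z. \<forall>a\<in>cube K. (1 - \<epsilon>) * (\<sigma> * s ^ CARD('d)) \<le> measure (density lborel f) (cell s -` {z + a}))"
proof -
  interpret \<nu>: prob_space "density lborel f" by fact
  define \<nu> where "\<nu> = density lborel f"
  define d where "d = CARD('d)"
  define v where "v = real K ^ d"
  have v1: "1 \<le> v" unfolding v_def using K by (simp add: one_le_power)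
  \<comment> \<open>The tolerance \<epsilon> is split in two: one half for density values between
    \<sigma>' and \<sigma>, the other for the part of a cell outside B.\<close>
  define \<sigma>' where "\<sigma>' = (1 - \<epsilon> / 2) * \<sigma>"
  have \<sigma>'0: "0 < \<sigma>'" "\<sigma>' < \<sigma>" unfolding \<sigma>'_def using \<sigma> \<epsilon> by (auto simp: field_simps)
  define A where "A = {x. ennreal \<sigma>' < f x}"
  have Am[measurable]: "A \<in> sets borel"
  proof -
    have "{x\<in>space lborel. ennreal \<sigma>' < f x} \<in> sets lborel" by measurable
    then show ?thesis unfolding A_def by simp
  qed
  have "emeasure lborel A \<noteq> 0"
  proof
    assume "emeasure lborel A = 0"
    then have "AE x in lborel. f x \<le> ennreal \<sigma>'"
      by (intro AE_I[of _ _ A]) (auto simp: A_def not_le)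
    then show False using \<sigma>(2) \<sigma>'0 by blast
  qed
  have dens_ge: "ennreal \<sigma>' * emeasure lborel S \<le> emeasure \<nu> S" if "S \<subseteq> A" "S \<in> sets borel" for S
  proof -
    have "ennreal \<sigma>' * emeasure lborel S = (\<integral>\<^sup>+x. ennreal \<sigma>' * indicator S x \<partial>lborel)"
      using that by (simp add: nn_integral_cmult_indicator)
    also have "\<dots> \<le> (\<integral>\<^sup>+x. f x * indicator S x \<partial>lborel)"
      by (rule nn_integral_mono) (use that in \<open>auto simp: indicator_def A_def less_imp_le\<close>)
    also have "\<dots> = emeasure \<nu> S" unfolding \<nu>_def using that by (simp add: emeasure_density)
    finally show ?thesis .
  qed
  have "0 < emeasure \<nu> A"
  proof -
    have "0 < ennreal \<sigma>' * emeasure lborel A"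
      using \<sigma>'0 \<open>emeasure lborel A \<noteq> 0\<close> by (simp add: ennreal_zero_less_mult_iff zero_less_iff_neq_zero)
    then show ?thesis using dens_ge[of A] by (auto intro: less_le_trans)
  qed
  moreover have "emeasure \<nu> A = (SUP B\<in>{B. B \<subseteq> A \<and> compact B}. emeasure \<nu> B)"
    unfolding \<nu>_def by (rule inner_regular) (auto simp: \<nu>.emeasure_space_1)
  ultimately obtain B where B: "B \<subseteq> A" "compact B" "0 < emeasure \<nu> B"
    by (metis (mono_tags, lifting) less_SUP_iff mem_Collect_eq)
  have Bm[measurable]: "B \<in> sets borel" using B by (simp add: borel_compact)
  have Bfin: "emeasure lborel B < \<infinity>" using B(2) emeasure_compact_finite by blast
  define lB where "lB = measure lborel B"
  have lB0: "0 < lB"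
  proof -
    have "emeasure lborel B \<noteq> 0"
    proof
      assume "emeasure lborel B = 0"
      then have "B \<in> null_sets lborel" by (simp add: null_sets_def)
      then have "B \<in> null_sets \<nu>"
        using absolutely_continuousI_density[of f lborel] unfolding \<nu>_def absolutely_continuous_def by auto
      then have "emeasure \<nu> B = 0" by (rule null_setsD1)
      then show False using B by simp
    qed
    then show ?thesis unfolding lB_def using Bfin by (simp add: measure_def enn2real_positive_iff zero_less_iff_neq_zero)
  qed
  \<comment> \<open>A box has v cells, so a box with at most the share e5 of its volume outside B
    has every single cell filled up to the share \<epsilon> / 2.\<close>
  define e5 where "e5 = \<epsilon> / (2 * v)"
  have e50: "0 < e5" unfolding e5_def using \<epsilon> v1 by simp
  \<comment> \<open>Shrinking neighbourhoods of B. Their measure tends to that of B, so boxes that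
    meet B and stay inside a small neighbourhood waste little volume.\<close>
  define U where "U k = (\<Union>b\<in>B. ball b (1 / (real k + 1)))" for k
  have Uopen: "open (U k)" for k unfolding U_def by auto
  have Um[measurable]: "U k \<in> sets borel" for k using Uopen by simp
  have Ubdd: "bounded (U k)" for k
  proof -
    obtain R where R: "\<And>b. b \<in> B \<Longrightarrow> norm b \<le> R" using compact_imp_bounded[OF B(2)] unfolding bounded_iff by blast
    have "norm x \<le> R + 1" if xU: "x \<in> U k" for x
    proof -
      obtain b where b: "b \<in> B" "dist b x < 1 / (real k + 1)" using xU unfolding U_def by auto
      have "1 / (real k + 1) \<le> 1" by simp
      then have "norm (x - b) \<le> 1" using b(2) unfolding dist_norm norm_minus_commute[of x b] by linarith
      then show ?thesis using R[OF b(1)] norm_triangle_ineq[of "x - b" b] by simp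
    qed
    then show ?thesis unfolding bounded_iff by blast
  qed
  have Ufin: "emeasure lborel (U k) < \<infinity>" for k using emeasure_bounded_finite[OF Ubdd] .
  have "(\<lambda>k. measure lborel (U k)) \<longlonglongrightarrow> measure lborel (\<Inter>k. U k)"
  proof (rule Lim_measure_decseq)
    show "decseq U"
    proof (rule decseq_SucI)
      fix k
      have "1 / (real (Suc k) + 1) \<le> 1 / (real k + 1)" by (simp add: field_simps)
      then show "U (Suc k) \<subseteq> U k" unfolding U_def by fastforce
    qed
  qed (use Ufin in \<open>auto simp: less_top\<close>)
  moreover have "(\<Inter>k. U k) = B"
  proof
    show "B \<subseteq> (\<Inter>k. U k)" unfolding U_def by auto
    show "(\<Inter>k. U k) \<subseteq> B"
    proof
      fix x assume x: "x \<in> (\<Inter>k. U k)"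
      have "x \<in> closure B" unfolding closure_approachable
      proof (intro allI impI)
        fix e :: real assume "0 < e"
        then obtain k where k: "1 / (real k + 1) < e"
          using reals_Archimedean[of e] by (auto simp: inverse_eq_divide add.commute)
        obtain b where "b \<in> B" "dist b x < 1 / (real k + 1)" using x unfolding U_def by auto
        then show "\<exists>y\<in>B. dist y x < e" using k by (intro bexI[of _ b]) auto
      qed
      then show "x \<in> B" using compact_imp_closed[OF B(2)] by simp
    qed
  qed
  ultimately have "(\<lambda>k. measure lborel (U k)) \<longlonglongrightarrow> lB" unfolding lB_def by simp
  moreover have "lB < lB + e5 / 2 * lB" using lB0 e50 by simp
  ultimately have "eventually (\<lambda>k. measure lborel (U k) < lB + e5 / 2 * lB) sequentially"
    by (rule order_tendstoD)
  then obtain k where k: "measure lborel (U k) < lB + e5 / 2 * lB" by (auto simp: eventually_sequentially)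
  define \<eta> where "\<eta> = 1 / (real k + 1)"
  have \<eta>0: "0 < \<eta>" unfolding \<eta>_def by simp
  \<comment> \<open>For s < s0 a box of side K s has diameter below \<eta>, hence lies in
    \<open>U k\<close> as soon as it meets B.\<close>
  define s0 where "s0 = \<eta> / (real d * real K)"
  have d0: "0 < d" unfolding d_def by simp
  have s00: "0 < s0" unfolding s0_def using \<eta>0 d0 K by simp
  show thesis
  proof (rule that[of "lB / (2 * v)" s0])
    show "0 < lB / (2 * v)" using lB0 v1 by simp
    show "0 < s0" by fact
    fix s :: real assume s: "0 < s" "s < s0"
    define L where "L = real K * s"
    have L0: "0 < L" unfolding L_def using K s by simp
    define Z0 where "Z0 = cell L ` B"
    have mb: "measure lborel (cell L -` {y}) = L ^ d" for y :: "int^'d"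
      using emeasure_cell[OF L0, of y] L0 by (simp add: measure_def d_def)
    have fmb: "cell L -` {y} \<in> fmeasurable lborel" for y :: "int^'d"
      using emeasure_cell[OF L0, of y] by (intro fmeasurableI) auto
    have subU: "cell L -` {y} \<subseteq> U k" if yZ: "y \<in> Z0" for y
    proof
      fix x assume x: "x \<in> cell L -` {y}"
      obtain b where b: "b \<in> B" "cell L b = y" using yZ unfolding Z0_def by auto
      have "\<bar>(x - b) $ i\<bar> < L" for i
      proof -
        have "L * of_int (y $ i) \<le> x $ i" "x $ i < L * (of_int (y $ i) + 1)"
          "L * of_int (y $ i) \<le> b $ i" "b $ i < L * (of_int (y $ i) + 1)"
          using x b(2) cell_eq_iff[OF L0, of x y] cell_eq_iff[OF L0, of b y] by auto
        then show ?thesis by (simp add: distrib_left abs_less_iff)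
      qed
      then have "(\<Sum>i\<in>UNIV. \<bar>(x - b) $ i\<bar>) \<le> (\<Sum>i\<in>(UNIV :: 'd set). L)" by (intro sum_mono) (simp add: less_imp_le)
      then have "norm (x - b) \<le> real d * L" using norm_le_l1_cart[of "x - b"] by (simp add: d_def)
      also have "\<dots> < \<eta>" using s d0 K unfolding L_def s0_def by (simp add: field_simps)
      finally show "x \<in> U k" unfolding U_def \<eta>_def[symmetric] using b(1) by (auto simp: dist_norm norm_minus_commute)
    qed
    have fmU: "U k \<in> fmeasurable lborel" using Ufin by (intro fmeasurableI) auto
    have djb: "disjoint_family_on (\<lambda>y. cell L -` {y}) G" for G :: "(int^'d) set" by (auto simp: disjoint_family_on_def)
    have cardle: "real (card G) * L ^ d \<le> measure lborel (U k)" if "G \<subseteq> Z0" "finite G" for G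
    proof -
      have "real (card G) * L ^ d = (\<Sum>y\<in>G. measure lborel (cell L -` {y}))" by (simp add: mb)
      also have "\<dots> = measure lborel (\<Union>y\<in>G. cell L -` {y})"
        by (rule measure_finite_Union[symmetric, OF that(2)]) (auto simp: emeasure_cell[OF L0] djb)
      also have "\<dots> \<le> measure lborel (U k)"
        using that subU fmU by (intro measure_mono_fmeasurable) (auto simp: subset_iff)
      finally show ?thesis .
    qed
    have "finite Z0 \<and> card Z0 \<le> nat \<lceil>measure lborel (U k) / L ^ d\<rceil>"
    proof (rule finite_if_finite_subsets_card_bdd)
      fix G assume "G \<subseteq> Z0" "finite G"
      then have "real (card G) \<le> measure lborel (U k) / L ^ d" using cardle[of G] L0 by (simp add: field_simps)
      then show "card G \<le> nat \<lceil>measure lborel (U k) / L ^ d\<rceil>" by linarith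
    qed
    then have finZ0: "finite Z0" by simp
    have sumB: "(\<Sum>y\<in>Z0. measure lborel (cell L -` {y} \<inter> B)) = lB"
    proof -
      have "(\<Sum>y\<in>Z0. measure lborel (cell L -` {y} \<inter> B)) = measure lborel (\<Union>y\<in>Z0. cell L -` {y} \<inter> B)"
      proof (rule measure_finite_Union[symmetric, OF finZ0])
        fix y show "emeasure lborel (cell L -` {y} \<inter> B) \<noteq> \<infinity>"
          using emeasure_mono[of "cell L -` {y} \<inter> B" B lborel] Bfin by (auto simp: top_unique)
      qed (auto simp: disjoint_family_on_def)
      also have "(\<Union>y\<in>Z0. cell L -` {y} \<inter> B) = B" unfolding Z0_def by auto
      finally show ?thesis unfolding lB_def .
    qed
    have split: "measure lborel (cell L -` {y} - B) = L ^ d - measure lborel (cell L -` {y} \<inter> B)" for y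
    proof -
      have "measure lborel (cell L -` {y} - (cell L -` {y} \<inter> B)) = measure lborel (cell L -` {y}) - measure lborel (cell L -` {y} \<inter> B)"
        using fmb[of y] by (intro measure_Diff) (auto simp: fmeasurable_def less_top)
      moreover have "cell L -` {y} - (cell L -` {y} \<inter> B) = cell L -` {y} - B" by auto
      ultimately show ?thesis by (simp add: mb)
    qed
    define Z1 where "Z1 = {y\<in>Z0. measure lborel (cell L -` {y} - B) \<le> e5 * L ^ d}"
    have finZ1: "finite Z1" "Z1 \<subseteq> Z0" unfolding Z1_def using finZ0 by auto
    have cardZ1: "lB / 2 \<le> real (card Z1) * L ^ d"
    proof -
      \<comment> \<open>The boxes meeting B lie in \<open>U k\<close>, so their total volume outside
        B is at most e5 / 2 * lB. Those of which more than the share e5 is outside B thus have total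
        volume at most lB / 2.\<close>
      have "real (card (Z0 - Z1)) * (e5 * L ^ d) = (\<Sum>y\<in>Z0 - Z1. e5 * L ^ d)" by simp
      also have "\<dots> \<le> (\<Sum>y\<in>Z0 - Z1. measure lborel (cell L -` {y} - B))"
        by (rule sum_mono) (auto simp: Z1_def)
      also have "\<dots> \<le> (\<Sum>y\<in>Z0. measure lborel (cell L -` {y} - B))"
        by (rule sum_mono2) (use finZ0 in auto)
      also have "\<dots> = real (card Z0) * L ^ d - lB" by (simp add: split sum_subtractf sumB)
      also have "\<dots> \<le> e5 / 2 * lB" using cardle[OF order_refl finZ0] k by linarith
      finally have "e5 * (real (card (Z0 - Z1)) * L ^ d) \<le> e5 * (lB / 2)" by (simp add: mult_ac)
      then have 1: "real (card (Z0 - Z1)) * L ^ d \<le> lB / 2" using e50 by (simp add: mult_le_cancel_left)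
      have "0 \<le> (\<Sum>y\<in>Z0. measure lborel (cell L -` {y} - B))" by (intro sum_nonneg) auto
      then have 2: "lB \<le> real (card Z0) * L ^ d" by (simp add: split sum_subtractf sumB)
      have "card Z0 = card Z1 + card (Z0 - Z1)"
        using finZ1 finZ0 by (metis card_Diff_subset card_mono le_add_diff_inverse)
      then have "real (card Z0) * L ^ d = real (card Z1) * L ^ d + real (card (Z0 - Z1)) * L ^ d" by (simp add: algebra_simps)
      then show ?thesis using 1 2 by linarith
    qed
    \<comment> \<open>Index of the lowest corner cell of the box y; adding the elements of
      \<open>cube K\<close> lists the cells of the box.\<close>
    define up where "up y = (\<chi> i. int K * y $ i)" for y :: "int^'d"
    have up_cell: "cell L x = y" if "cell s x = up y + a" "a \<in> cube K" for x y a
    proof -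
      have "\<lfloor>x $ i / L\<rfloor> = y $ i" for i
      proof -
        have eL: "x $ i / L = (x $ i / s) / real_of_int (int K)" unfolding L_def by simp
        have "\<lfloor>x $ i / L\<rfloor> = \<lfloor>x $ i / s\<rfloor> div int K" unfolding eL by (rule floor_divide_real_eq_div) simp
        also have "\<lfloor>x $ i / s\<rfloor> = int K * y $ i + a $ i" using arg_cong[OF that(1), of "\<lambda>v. v $ i"] by (simp add: cell_def up_def)
        also have "\<dots> div int K = y $ i" using that(2) K by (simp add: cube_def)
        finally show ?thesis .
      qed
      then show ?thesis by (simp add: cell_def vec_eq_iff)
    qed
    have up_inj: "y = y'" if "up y + a = up y' + a'" "a \<in> cube K" "a' \<in> cube K" for y y' a a'
    proof -
      define x where "x = (\<chi> i. s * of_int ((up y + a) $ i) :: real^'d)"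
      have "cell s x = up y + a" unfolding cell_def x_def using s by (simp add: vec_eq_iff)
      then show ?thesis using up_cell[of x y a] up_cell[of x y' a'] that by simp
    qed
    have "inj_on up Z1"
    proof (rule inj_onI)
      fix y y' assume "up y = up y'"
      then show "y = y'" using up_inj[of y 0 y' 0] K by (auto simp: cube_def)
    qed
    then have cardup: "card (up ` Z1) = card Z1" by (rule card_image)
    show "\<exists>Z :: (int^'d) set. finite Z \<and> lB / (2 * v) \<le> real (card Z) * s ^ CARD('d) \<and>
       (\<forall>z\<in>Z. \<forall>z'\<in>Z. \<forall>a\<in>cube K. \<forall>a'\<in>cube K. z + a = z' + a' \<longrightarrow> z = z') \<and>
       (\<forall>z\<in>Z. \<forall>a\<in>cube K. (1 - \<epsilon>) * (\<sigma> * s ^ CARD('d)) \<le> measure (density lborel f) (cell s -` {z + a}))"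
    proof (intro exI[of _ "up ` Z1"] conjI ballI impI)
      show "finite (up ` Z1)" using finZ1 by simp
      show "lB / (2 * v) \<le> real (card (up ` Z1)) * s ^ CARD('d)"
      proof -
        have "L ^ d = v * s ^ d" unfolding L_def v_def by (rule power_mult_distrib)
        then have "lB \<le> real (card Z1) * s ^ d * (2 * v)" using cardZ1 by (simp add: mult_ac)
        then show ?thesis unfolding cardup d_def[symmetric] using v1 by (subst pos_divide_le_eq) auto
      qed
      fix z z' a a' assume zz: "z \<in> up ` Z1" "z' \<in> up ` Z1" "a \<in> cube K" "a' \<in> cube K" "z + a = z' + a'"
      then show "z = z'" using up_inj by auto
    next
      fix z a :: "int^'d" assume z: "z \<in> up ` Z1" and a: "a \<in> cube K"
      then obtain y where y: "y \<in> Z1" "z = up y" by auto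
      let ?c = "cell s -` {z + a}"
      have sd: "measure lborel ?c = s ^ d" "?c \<in> fmeasurable lborel"
        using emeasure_cell[OF s(1), of "z + a"] s by (auto simp: measure_def d_def intro!: fmeasurableI)
      have cs: "?c \<subseteq> cell L -` {y}" using up_cell y a by auto
      have "measure lborel (?c - B) \<le> measure lborel (cell L -` {y} - B)"
        using cs fmb[of y] Bm by (intro measure_mono_fmeasurable fmeasurable_Diff) auto
      also have "\<dots> \<le> e5 * L ^ d" using y unfolding Z1_def by simp
      also have "\<dots> = \<epsilon> / 2 * s ^ d" unfolding e5_def L_def v_def using K by (simp add: power_mult_distrib)
      finally have "measure lborel (?c - B) \<le> \<epsilon> / 2 * s ^ d" .
      moreover have "measure lborel (?c - (?c \<inter> B)) = measure lborel ?c - measure lborel (?c \<inter> B)"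
        using sd by (intro measure_Diff) (auto simp: fmeasurable_def less_top)
      moreover have "?c - (?c \<inter> B) = ?c - B" by auto
      ultimately have cB: "(1 - \<epsilon> / 2) * s ^ d \<le> measure lborel (?c \<inter> B)" using sd by (simp add: algebra_simps)
      have "ennreal \<sigma>' * emeasure lborel (?c \<inter> B) \<le> emeasure \<nu> (?c \<inter> B)" using B by (intro dens_ge) auto
      also have "\<dots> \<le> emeasure \<nu> ?c" unfolding \<nu>_def by (intro emeasure_mono) auto
      finally have "ennreal \<sigma>' * emeasure lborel (?c \<inter> B) \<le> emeasure \<nu> ?c" .
      moreover have "emeasure lborel (?c \<inter> B) = ennreal (measure lborel (?c \<inter> B))"
        by (rule emeasure_eq_measure2, rule fmeasurable_Int_fmeasurable) (use sd in auto)
      moreover have "emeasure \<nu> ?c = ennreal (measure \<nu> ?c)" unfolding \<nu>_def by (rule \<nu>.emeasure_eq_measure)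
      ultimately have "ennreal (\<sigma>' * measure lborel (?c \<inter> B)) \<le> ennreal (measure \<nu> ?c)"
        using \<sigma>'0 by (simp add: ennreal_mult)
      then have ge: "\<sigma>' * measure lborel (?c \<inter> B) \<le> measure \<nu> ?c" by simp
      have "(1 - \<epsilon>) * (\<sigma> * s ^ d) \<le> ((1 - \<epsilon> / 2) * (1 - \<epsilon> / 2)) * (\<sigma> * s ^ d)"
        using \<sigma> s by (intro mult_right_mono) (auto simp: algebra_simps)
      also have "\<dots> = \<sigma>' * ((1 - \<epsilon> / 2) * s ^ d)" unfolding \<sigma>'_def by simp
      also have "\<dots> \<le> \<sigma>' * measure lborel (?c \<inter> B)" using cB \<sigma>'0 by (intro mult_left_mono) auto
      finally show "(1 - \<epsilon>) * (\<sigma> * s ^ CARD('d)) \<le> measure (density lborel f) ?c"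
        using ge unfolding \<nu>_def d_def by linarith
    qed
  qed
qed

section \<open>Poisson bounds\<close>

text \<open>Half of Stirling's formula up to a factor polynomial in k, which is harmless against
  powers of t. The induction step is e \<le> ((k + 2) / (k + 1))^(k + 2).\<close>

lemma fact_le_power_exp: "fact k \<le> (real k + 1) ^ (k + 1) * exp (- real k)"
proof (induction k)
  case (Suc k)
  have "1 \<le> (real k + 2) * ln ((real k + 2) / (real k + 1))"
  proof -
    have "1 - 1 / ((real k + 2) / (real k + 1)) \<le> ln ((real k + 2) / (real k + 1))"
      using ln_le_minus_one[of "(real k + 1) / (real k + 2)"] by (simp add: ln_div)
    moreover have "1 - 1 / ((real k + 2) / (real k + 1)) = 1 / (real k + 2)" by (simp add: field_simps)
    ultimately show ?thesis by (simp add: field_simps)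
  qed
  then have "exp 1 \<le> exp ((real (k + 2)) * ln ((real k + 2) / (real k + 1)))" by (simp add: add.commute)
  also have "\<dots> = exp (ln ((real k + 2) / (real k + 1))) ^ (k + 2)" by (rule exp_of_nat_mult)
  also have "\<dots> = (real k + 2) ^ (k + 2) / (real k + 1) ^ (k + 2)" by (simp add: power_divide del: power_Suc)
  finally have "exp 1 * (real k + 1) ^ (k + 2) \<le> (real k + 2) ^ (k + 2)" by (simp add: field_simps del: power_Suc)
  then have h: "(real k + 1) ^ (k + 2) \<le> (real k + 2) ^ (k + 2) * exp (-1)"
    by (simp add: exp_minus field_simps del: power_Suc)
  have "fact (Suc k) = (real k + 1) * fact k" by (simp add: add.commute)
  also have "\<dots> \<le> (real k + 1) * ((real k + 1) ^ (k + 1) * exp (- real k))"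
    using Suc by (intro mult_left_mono) auto
  also have "\<dots> = (real k + 1) ^ (k + 2) * exp (- real k)" by simp
  also have "\<dots> \<le> (real k + 2) ^ (k + 2) * exp (-1) * exp (- real k)" using h by (intro mult_right_mono) auto
  also have "\<dots> = (real (Suc k) + 1) ^ (Suc k + 1) * exp (- real (Suc k))"
    by (simp add: exp_add[symmetric] add.commute mult.assoc)
  finally show ?case .
qed simp

text \<open>The Cramer rate function of the Poisson law with mean \<mu>, set to 0 below the mean:
  only counts above the mean are penalized.\<close>

definition rate :: "real \<Rightarrow> real \<Rightarrow> real" where
  "rate x \<mu> = max x \<mu> * ln (max x \<mu> / \<mu>) - max x \<mu> + \<mu>"

lemma rate_scale:
  assumes "0 < a"
  shows "rate (a * x) (a * \<mu>) = a * rate x \<mu>"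
proof -
  have m: "max (a * x) (a * \<mu>) = a * max x \<mu>" using assms by (auto simp: max_def)
  have "a * max x \<mu> / (a * \<mu>) = max x \<mu> / \<mu>" using assms by simp
  then show ?thesis unfolding rate_def m by (simp add: right_diff_distrib distrib_left mult.assoc)
qed

text \<open>Stirling at k = floor x, but with the rate taken at x itself. Replacing ln (k + 1) by ln
  x and k by x cost at most 1 each in the exponent, hence exp (-2); Stirling's bound costs 1 / (k +
  1). The terms in x - k have the right sign because \<mu> \<le> x.\<close>

lemma poisson_weight_ge:
  assumes "0 < \<mu>" "\<mu> \<le> x"
  shows "exp (- rate x \<mu>) * (exp (-2) / (real (nat \<lfloor>x\<rfloor>) + 1)) \<le> exp (-\<mu>) * \<mu> ^ nat \<lfloor>x\<rfloor> / fact (nat \<lfloor>x\<rfloor>)"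
proof -
  define k where "k = nat \<lfloor>x\<rfloor>"
  have x0: "0 < x" using assms by simp
  have k: "real k \<le> x" "x < real k + 1" unfolding k_def using x0 by linarith+
  have lnf: "ln (fact k) \<le> (real k + 1) * ln (real k + 1) - real k"
  proof -
    have "ln (fact k) \<le> ln ((real k + 1) ^ (k + 1) * exp (- real k))"
      using fact_le_power_exp[of k] by (subst ln_le_cancel_iff) auto
    also have "\<dots> = (real k + 1) * ln (real k + 1) - real k"
      by (subst ln_mult) (auto simp: ln_realpow add.commute simp del: power_Suc)
    finally show ?thesis .
  qed
  have kl: "real k * ln (real k + 1) \<le> real k * ln x + 1"
  proof (cases "k = 0")
    case False
    have "ln (real k + 1) - ln x \<le> ln (real k + 1) - ln (real k)" using False k(1) by simp
    also have "\<dots> = ln ((real k + 1) / real k)" using False by (simp add: ln_div)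
    also have "\<dots> \<le> (real k + 1) / real k - 1" using False by (intro ln_le_minus_one) auto
    also have "\<dots> = 1 / real k" using False by (simp add: field_simps)
    finally have "real k * (ln (real k + 1) - ln x) \<le> real k * (1 / real k)" by (intro mult_left_mono) auto
    then show ?thesis using False by (simp add: algebra_simps)
  qed simp
  have mu: "(x - real k) * ln \<mu> \<le> (x - real k) * ln x" using k assms by (intro mult_left_mono) auto
  have "- rate x \<mu> - 2 - ln (real k + 1) \<le> -\<mu> + real k * ln \<mu> - ln (fact k)"
  proof -
    have "rate x \<mu> = x * ln x - x * ln \<mu> - x + \<mu>"
      using assms x0 by (simp add: rate_def max_def ln_div algebra_simps)
    then show ?thesis using lnf kl mu k by (simp add: algebra_simps)
  qed
  then have "exp (- rate x \<mu> - 2 - ln (real k + 1)) \<le> exp (-\<mu> + real k * ln \<mu> - ln (fact k))" by simp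
  moreover have "exp (- rate x \<mu> - 2 - ln (real k + 1)) = exp (- rate x \<mu>) * (exp (-2) / (real k + 1))"
    by (simp add: exp_diff exp_minus divide_inverse add_pos_nonneg)
  moreover have "exp (-\<mu> + real k * ln \<mu> - ln (fact k)) = exp (-\<mu>) * \<mu> ^ k / fact k"
    using assms by (simp add: exp_diff exp_add exp_of_nat_mult exp_minus field_simps)
  ultimately show ?thesis unfolding k_def by simp
qed

lemma power_mult_fact_le: "real m ^ k * fact m \<le> fact (m + k)"
proof (induction k)
  case (Suc k)
  have "real m ^ Suc k * fact m = real m * (real m ^ k * fact m)" by simp
  also have "\<dots> \<le> (real (m + k) + 1) * fact (m + k)" using Suc by (intro mult_mono) auto
  also have "\<dots> = fact (m + Suc k)" by (simp add: algebra_simps)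
  finally show ?case .
qed simp

text \<open>Replaces the multinomial law by independent Poisson counts. The factor n! / (n - W)! is
  at least n^W / 2 because W^2 is small against n, and the power of 1 - f loses another factor 2
  against exp (- n q card F) because n (q card F)^2 is small. Masses below q cost (1 -
  \<epsilon>)^W.\<close>

lemma (in iid_labels) prob_cnt_ge_poisson:
  fixes q :: real
  assumes F: "finite F" "F \<noteq> {}" and W: "W = (\<Sum>a\<in>F. w a)" "2 * real W ^ 2 \<le> real n" "0 < n"
    and q: "0 < q" "\<And>a. a \<in> F \<Longrightarrow> (1 - \<epsilon>) * q \<le> p (z + a)" "\<And>a. a \<in> F \<Longrightarrow> p (z + a) \<le> q"
    and \<epsilon>: "0 \<le> \<epsilon>" "\<epsilon> < 1" and small: "card F * q \<le> 1 / 2" "4 * n * (card F * q) ^ 2 \<le> 1"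
  shows "1 / 4 * (1 - \<epsilon>) ^ W * (\<Prod>a\<in>F. exp (- (n * q)) * (n * q) ^ w a / fact (w a))
    \<le> prob {\<omega>\<in>space M. \<forall>a\<in>F. cnt n (z + a) \<omega> = w a}"
proof -
  have inj: "inj_on (\<lambda>a. z + a) F" by (auto simp: inj_on_def)
  have Wn: "W \<le> n"
  proof -
    have "W \<le> W ^ 2" by (simp add: power2_eq_square)
    moreover have "real (W ^ 2) \<le> real n" using W(2) zero_le_power2[of "real W"] unfolding of_nat_power by linarith
    then have "W ^ 2 \<le> n" by (simp only: of_nat_le_iff)
    ultimately show ?thesis by simp
  qed
  define f where "f = (\<Sum>a\<in>F. p (z + a))"
  define y where "y = card F * q"
  define D where "D = (\<Prod>a\<in>F. fact (w a) :: real)"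
  have D0: "D > 0" unfolding D_def by (intro prod_pos) auto
  have fy: "f \<le> y" unfolding f_def y_def using sum_mono[of F "\<lambda>a. p (z + a)" "\<lambda>_. q"] q by simp
  have P: "prob {\<omega>\<in>space M. \<forall>a\<in>F. cnt n (z + a) \<omega> = w a} =
    fact n / (D * fact (n - W)) * (\<Prod>a\<in>F. p (z + a) ^ w a) * (1 - f) ^ (n - W)"
  proof -
    have "(\<Sum>c\<in>(\<lambda>a. z + a) ` F. w (c - z)) = W" by (simp add: sum.reindex[OF inj] W)
    moreover have "{\<omega>\<in>space M. \<forall>a\<in>F. cnt n (z + a) \<omega> = w a} = {\<omega>\<in>space M. \<forall>c\<in>(\<lambda>a. z + a) ` F. cnt n c \<omega> = w (c - z)}"
      by auto
    ultimately show ?thesis using prob_cnt_eq[of "(\<lambda>a. z + a) ` F" "\<lambda>c. w (c - z)" n] F Wn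
      by (simp add: sum.reindex[OF inj] prod.reindex[OF inj] D_def f_def)
  qed
  have n0: "0 < real n" using W by simp
  have 1: "real n ^ W / 2 \<le> fact n / fact (n - W)"
  proof -
    have "real W * (real W / real n) \<le> 1 / 2" using W(2) n0 by (simp add: field_simps power2_eq_square)
    moreover have "1 + real W * (- (real W / real n)) \<le> (1 + (- (real W / real n))) ^ W"
      using Wn n0 by (intro Bernoulli_inequality) (simp add: field_simps)
    then have "1 - real W * (real W / real n) \<le> (1 - real W / real n) ^ W" by simp
    ultimately have "1 / 2 \<le> (1 - real W / real n) ^ W" by linarith
    then have "real n ^ W * (1 / 2) \<le> real n ^ W * (1 - real W / real n) ^ W" by (intro mult_left_mono) auto
    also have "\<dots> = real (n - W) ^ W" using n0 Wn by (simp add: power_mult_distrib[symmetric] field_simps of_nat_diff)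
    also have "\<dots> \<le> fact n / fact (n - W)" using power_mult_fact_le[of "n - W" W] Wn by (simp add: field_simps)
    finally show ?thesis by simp
  qed
  have 2: "((1 - \<epsilon>) * q) ^ W \<le> (\<Prod>a\<in>F. p (z + a) ^ w a)"
  proof -
    have "((1 - \<epsilon>) * q) ^ W = (\<Prod>a\<in>F. ((1 - \<epsilon>) * q) ^ w a)" unfolding W by (simp add: power_sum)
    also have "\<dots> \<le> (\<Prod>a\<in>F. p (z + a) ^ w a)" using q \<epsilon> by (intro prod_mono) (auto intro: power_mono)
    finally show ?thesis .
  qed
  have 3: "exp (- (n * y)) / 2 \<le> (1 - f) ^ (n - W)"
  proof -
    have y0: "0 \<le> y" "y \<le> 1 / 2" using small q(1) unfolding y_def by auto
    have "- y - 2 * y\<^sup>2 \<le> ln (1 - y)" using y0 by (intro ln_one_minus_pos_lower_bound) auto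
    then have "exp (- y - 2 * y\<^sup>2) \<le> 1 - y" using y0 by (metis exp_le_cancel_iff exp_ln add_less_cancel_left diff_gt_0_iff_gt divide_less_eq_1_pos le_less_trans less_numeral_extra(1) one_less_numeral_iff semiring_norm(76) zero_less_numeral)
    then have "exp (- y - 2 * y\<^sup>2) ^ n \<le> (1 - y) ^ n" by (intro power_mono) auto
    moreover have "exp (- y - 2 * y\<^sup>2) ^ n = exp (- (n * y)) * exp (- (2 * n * y\<^sup>2))"
      by (simp add: exp_of_nat_mult[symmetric] exp_add[symmetric] algebra_simps)
    moreover have "1 / 2 \<le> exp (- (2 * n * y\<^sup>2))"
    proof -
      have "2 * n * y\<^sup>2 \<le> 1 / 2" using small(2) unfolding y_def by simp
      then have "1 / 2 \<le> 1 + (- (2 * n * y\<^sup>2))" by simp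
      also have "\<dots> \<le> exp (- (2 * n * y\<^sup>2))" by (rule exp_ge_add_one_self)
      finally show ?thesis .
    qed
    then have "exp (- (n * y)) * (1 / 2) \<le> exp (- (n * y)) * exp (- (2 * n * y\<^sup>2))" by (intro mult_left_mono) auto
    ultimately have "exp (- (n * y)) / 2 \<le> (1 - y) ^ n" by linarith
    also have "\<dots> \<le> (1 - y) ^ (n - W)" using y0 by (intro power_decreasing) auto
    also have "\<dots> \<le> (1 - f) ^ (n - W)" using y0 fy by (intro power_mono) auto
    finally show ?thesis .
  qed
  have "1 / 4 * (1 - \<epsilon>) ^ W * (\<Prod>a\<in>F. exp (- (n * q)) * (n * q) ^ w a / fact (w a))
     = ((real n ^ W / 2) / D) * ((1 - \<epsilon>) * q) ^ W * (exp (- (n * y)) / 2)"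
  proof -
    have "(\<Prod>a\<in>F. exp (- (n * q)) * (n * q) ^ w a / fact (w a)) = exp (- (n * q)) ^ card F * (n * q) ^ W / D"
      unfolding D_def W by (simp add: prod_dividef prod.distrib power_sum)
    also have "exp (- (n * q)) ^ card F = exp (- (n * y))" unfolding y_def
      by (simp add: exp_of_nat_mult[symmetric] algebra_simps)
    finally show ?thesis by (simp add: power_mult_distrib)
  qed
  also have "\<dots> \<le> ((fact n / fact (n - W)) / D) * (\<Prod>a\<in>F. p (z + a) ^ w a) * (1 - f) ^ (n - W)"
    using 1 2 3 D0 \<epsilon> q(1) p_nonneg
    by (intro mult_mono divide_right_mono mult_nonneg_nonneg prod_nonneg zero_le_power) auto
  also have "\<dots> = prob {\<omega>\<in>space M. \<forall>a\<in>F. cnt n (z + a) \<omega> = w a}" unfolding P by (simp add: mult.commute)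
  finally show ?thesis .
qed

lemma eventually_polylog_le_powr:
  assumes "0 < e"
  shows "eventually (\<lambda>t::nat. C * ln (real t) ^ k \<le> real t powr e) sequentially"
proof -
  define a where "a = e / (2 * (real k + 1))"
  have a0: "0 < a" unfolding a_def using assms by simp
  have "filterlim (\<lambda>t::nat. real t powr (e / 2)) at_top sequentially"
    using assms by real_asymp
  then have "eventually (\<lambda>t::nat. \<bar>C\<bar> / a ^ k \<le> real t powr (e / 2)) sequentially"
    by (auto simp: filterlim_at_top)
  moreover have "eventually (\<lambda>t::nat. 1 \<le> t) sequentially" by (rule eventually_ge_at_top)
  ultimately show ?thesis
  proof eventually_elim
    case (elim t)
    have t: "1 \<le> real t" using elim by simp
    have "ln (real t) ^ k \<le> (real t powr a / a) ^ k"
      using t a0 ln_powr_bound[of "real t" a] by (intro power_mono) auto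
    also have "\<dots> = real t powr (a * k) / a ^ k" using t by (simp add: power_divide powr_realpow[symmetric] powr_powr)
    also have "\<dots> \<le> real t powr (e / 2) / a ^ k"
    proof (intro divide_right_mono powr_mono)
      have "a * k \<le> a * (real k + 1)" using a0 by (intro mult_left_mono) auto
      also have "\<dots> = e / 2" unfolding a_def by (simp add: field_simps)
      finally show "a * k \<le> e / 2" .
    qed (use t a0 in auto)
    finally have 1: "ln (real t) ^ k \<le> real t powr (e / 2) / a ^ k" .
    have "C * ln (real t) ^ k \<le> \<bar>C\<bar> * ln (real t) ^ k" using t by (intro mult_right_mono) auto
    also have "\<dots> \<le> \<bar>C\<bar> * (real t powr (e / 2) / a ^ k)" using 1 by (intro mult_left_mono) auto
    also have "\<dots> = (\<bar>C\<bar> / a ^ k) * real t powr (e / 2)" by simp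
    also have "\<dots> \<le> real t powr (e / 2) * real t powr (e / 2)" using elim by (intro mult_right_mono) auto
    also have "\<dots> = real t powr e" by (simp add: powr_add[symmetric])
    finally show ?case .
  qed
qed

section \<open>Cell counts of the random points\<close>

text \<open>The number \<sigma> is the essential supremum of the density, the last assumption being
  its minimality.\<close>

locale rgg = prob_space M for M :: "'m measure" +
  fixes X :: "nat \<Rightarrow> 'm \<Rightarrow> real^'d" and f :: "real^'d \<Rightarrow> ennreal" and \<sigma> :: real
  assumes indep_X: "indep_vars (\<lambda>_. borel) X {1..}"
    and distr_X: "\<And>i. i \<ge> 1 \<Longrightarrow> distributed M lborel (X i) f"
    and \<sigma>: "0 < \<sigma>" "AE x in lborel. f x \<le> ennreal \<sigma>" "\<And>\<sigma>'. \<sigma>' < \<sigma> \<Longrightarrow> \<not> (AE x in lborel. f x \<le> ennreal \<sigma>')"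
begin

definition count :: "real \<Rightarrow> nat \<Rightarrow> int^'d \<Rightarrow> 'm \<Rightarrow> nat" where
  "count s n z \<omega> = card {i\<in>{1..n}. cell s (X i \<omega>) = z}"

definition mass :: "real \<Rightarrow> int^'d \<Rightarrow> real" where
  "mass s z = measure (density lborel f) (cell s -` {z})"

lemma f_measurable[measurable]: "f \<in> borel_measurable lborel"
  using distr_X[of 1] by (auto dest: distributed_borel_measurable)

lemma distr_X_eq: "i \<ge> 1 \<Longrightarrow> distr M lborel (X i) = density lborel f"
  using distr_X by (auto dest: distributed_distr_eq_density)

lemma measurable_X: "i \<ge> 1 \<Longrightarrow> X i \<in> borel_measurable M"
  using indep_X unfolding indep_vars_def by auto

lemma prob_space_law: "prob_space (density lborel f)"
  using prob_space_distr[of "X 1" lborel] measurable_X[of 1] distr_X_eq[of 1] by simp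

lemma iid_labels_cell: "iid_labels M (\<lambda>i \<omega>. cell s (X i \<omega>)) (mass s)"
proof
  show "indep_vars (\<lambda>_. count_space UNIV) (\<lambda>i \<omega>. cell s (X i \<omega>)) {1..}"
    by (rule indep_vars_compose2[OF indep_X]) (rule measurable_cell)
  fix i :: nat and z assume i: "i \<ge> 1"
  have "{\<omega>\<in>space M. cell s (X i \<omega>) = z} = X i -` (cell s -` {z}) \<inter> space M" by auto
  then show "prob {\<omega>\<in>space M. cell s (X i \<omega>) = z} = mass s z"
    unfolding mass_def distr_X_eq[OF i, symmetric] using measurable_X[OF i] by (subst measure_distr) auto
qed

lemma cnt_cell: "iid_labels.cnt (\<lambda>i \<omega>. cell s (X i \<omega>)) n z \<omega> = count s n z \<omega>"
  unfolding iid_labels.cnt_def[OF iid_labels_cell] count_def ..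

lemma mass_le: "s > 0 \<Longrightarrow> mass s z \<le> \<sigma> * s ^ CARD('d)"
  unfolding mass_def using \<sigma> by (intro measure_cell_le) auto

lemmas count_tilted_bound = iid_labels.tilted_counts_bound[OF iid_labels_cell, unfolded cnt_cell]
lemmas count_lower_tail = iid_labels.lower_tail_bound[OF iid_labels_cell, unfolded cnt_cell]
lemmas exists_box_with_counts = iid_labels.exists_translate_with_counts[OF iid_labels_cell, unfolded cnt_cell]
lemmas prob_count_ge_poisson = iid_labels.prob_cnt_ge_poisson[OF iid_labels_cell, unfolded cnt_cell]

definition dense_boxes :: "real \<Rightarrow> nat \<Rightarrow> real \<Rightarrow> real \<Rightarrow> (int^'d) set \<Rightarrow> bool" where
  "dense_boxes \<epsilon> K c s Z \<longleftrightarrow> finite Z \<and> c \<le> real (card Z) * s ^ CARD('d) \<and>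
       (\<forall>z\<in>Z. \<forall>z'\<in>Z. \<forall>a\<in>cube K. \<forall>a'\<in>cube K. z + a = z' + a' \<longrightarrow> z = z') \<and>
       (\<forall>z\<in>Z. \<forall>a\<in>cube K. (1 - \<epsilon>) * (\<sigma> * s ^ CARD('d)) \<le> mass s (z + a))"

lemma ex_dense_boxes:
  assumes "0 < \<epsilon>" "\<epsilon> < 1" "0 < K"
  obtains c s0 where "0 < c" "0 < s0" "\<And>s. 0 < s \<Longrightarrow> s < s0 \<Longrightarrow> \<exists>Z. dense_boxes \<epsilon> K c s Z"
  using many_dense_boxes[OF f_measurable prob_space_law \<sigma>(1,3) assms]
  unfolding dense_boxes_def mass_def by metis

text \<open>There are at least c \<sigma> t / \<mu> dense boxes, so the first error term is the
  reciprocal of the expected number of hits. The number B, logarithmic or constant in the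
  applications, bounds both the prescribed counts and the mean count of the pattern; the correlation
  error is then of order B^2 / t.\<close>

lemma dense_box_with_counts:
  assumes Z: "dense_boxes \<epsilon> K c s Z" and "0 < c" "0 < s" and \<epsilon>: "0 < \<epsilon>" "\<epsilon> < 1" and F: "F \<subseteq> cube K" "F \<noteq> {}"
    and W: "W = (\<Sum>a\<in>F. w a)" and t: "0 < t" and \<mu>: "\<mu> = real t * (\<sigma> * s ^ CARD('d))"
    and B: "1 \<le> B" "real W \<le> B" "real (card F) * \<mu> \<le> B" "4 * B\<^sup>2 \<le> real t"
    and pr: "0 < pr" "pr \<le> 1 / 4 * (1 - \<epsilon>) ^ W * (\<Prod>a\<in>F. exp (- \<mu>) * \<mu> ^ w a / fact (w a))"
  shows "except (\<mu> / (c * \<sigma> * real t * pr) + 4 * B\<^sup>2 / real t) (\<lambda>\<omega>. \<exists>z\<in>Z. \<forall>a\<in>F. count s t (z + a) \<omega> = w a)"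
proof -
  define q where "q = \<sigma> * s ^ CARD('d)"
  have q0: "0 < q" unfolding q_def using \<sigma> assms by simp
  have t0: "0 < real t" using t by simp
  have finF: "finite F" using F finite_cube finite_subset by blast
  have mq: "\<mu> = real t * q" using \<mu> q_def by simp
  have \<mu>0: "0 < \<mu>" using mq q0 t0 by simp
  have ne: "Z \<noteq> {}" using Z assms(2) unfolding dense_boxes_def by auto
  have x: "real (card F) * q \<le> B / real t" using B(3) t0 unfolding mq by (simp add: field_simps)
  have Bt: "B / real t * B \<le> 1 / 4" using B(4) t0 by (simp add: field_simps power2_eq_square)
  have x0: "0 \<le> real (card F) * q" using q0 by simp
  have xW: "real (card F) * q * real W \<le> B / real t * B" using x x0 B by (intro mult_mono) auto
  have Bt2: "B / real t \<le> 1 / 4"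
  proof -
    have "B / real t * 1 \<le> B / real t * B" using B t0 by (intro mult_left_mono) auto
    then show ?thesis using Bt by linarith
  qed
  have W2: "2 * real W ^ 2 \<le> real t"
  proof -
    have "real W ^ 2 \<le> B ^ 2" using B by (intro power_mono) auto
    then show ?thesis using B(4) zero_le_power2[of B] by linarith
  qed
  have W1: "2 * W \<le> t"
  proof -
    have "B \<le> B\<^sup>2" using B(1) by (simp add: self_le_power)
    then have "2 * real W \<le> real t" using B by linarith
    then show ?thesis by linarith
  qed
  have card: "c / q * \<sigma> \<le> real (card Z)"
    using Z q0 \<sigma>(1) assms(3) unfolding dense_boxes_def q_def by (simp add: field_simps)
  have "except (1 / (real (card Z) * pr) + 4 * (real (card F) * q) * real W)
    (\<lambda>\<omega>. \<exists>z\<in>Z. \<forall>a\<in>F. count s t (z + a) \<omega> = w a)"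
  proof (rule exists_box_with_counts[OF finF _ _ W W1])
    show "finite Z" using Z unfolding dense_boxes_def by blast
    show "z = z'" if "z \<in> Z" "z' \<in> Z" "a \<in> F" "a' \<in> F" "z + a = z' + a'" for z z' a a'
      using that Z F unfolding dense_boxes_def by blast
    show "(\<Sum>a\<in>F. mass s (z + a)) \<le> real (card F) * q" for z
      using sum_mono[of F "\<lambda>a. mass s (z + a)" "\<lambda>_. q"] mass_le[OF assms(3)] unfolding q_def by simp
    show "real (card F) * q * real W \<le> 1 / 4" using xW Bt by linarith
    show "real (card F) * q < 1" using x Bt2 by linarith
    fix z assume z: "z \<in> Z"
    show "pr \<le> prob {\<omega> \<in> space M. \<forall>a\<in>F. count s t (z + a) \<omega> = w a}"
    proof (rule order_trans[OF pr(2)])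
      show "1 / 4 * (1 - \<epsilon>) ^ W * (\<Prod>a\<in>F. exp (- \<mu>) * \<mu> ^ w a / fact (w a))
        \<le> prob {\<omega> \<in> space M. \<forall>a\<in>F. count s t (z + a) \<omega> = w a}"
        unfolding mq
      proof (rule prob_count_ge_poisson[OF finF F(2) W W2 t q0])
        show "(1 - \<epsilon>) * q \<le> mass s (z + a)" if "a \<in> F" for a
          using z that Z F unfolding dense_boxes_def q_def by blast
        show "mass s (z + a) \<le> q" for a unfolding q_def by (rule mass_le) fact
        show "real (card F) * q \<le> 1 / 2" using x Bt2 by linarith
        have "4 * real t * (real (card F) * q)\<^sup>2 \<le> 4 * real t * (B / real t)\<^sup>2"
          using x x0 by (intro mult_left_mono power_mono) auto
        also have "\<dots> = 4 * B\<^sup>2 / real t" using t0 by (simp add: power2_eq_square field_simps)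
        also have "\<dots> \<le> 1" using B(4) t0 by simp
        finally show "4 * real t * (real (card F) * q)\<^sup>2 \<le> 1" .
      qed (use \<epsilon> in auto)
    qed
  qed (use pr ne in auto)
  then show ?thesis
  proof (rule except_mono)
    have "1 / (real (card Z) * pr) \<le> 1 / ((c / q * \<sigma>) * pr)"
      using card pr(1) assms(2) q0 \<sigma>(1) ne Z unfolding dense_boxes_def
      by (intro divide_left_mono mult_right_mono mult_pos_pos) (auto simp: card_gt_0_iff)
    also have "\<dots> = \<mu> / (c * \<sigma> * real t * pr)" unfolding mq using t0 by (simp add: field_simps)
    finally have 1: "1 / (real (card Z) * pr) \<le> \<mu> / (c * \<sigma> * real t * pr)" .
    have "4 * (real (card F) * q) * real W \<le> 4 * (B / real t * B)" using xW by simp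
    also have "\<dots> = 4 * B\<^sup>2 / real t" by (simp add: power2_eq_square)
    finally show "1 / (real (card Z) * pr) + 4 * (real (card F) * q) * real W
      \<le> \<mu> / (c * \<sigma> * real t * pr) + 4 * B\<^sup>2 / real t" using 1 by linarith
  qed
qed

text \<open>The first clause matches each coarse box with a fine one whose profile dominates it up
  to the factor 1 / a; the + 1 absorbs the rounding of a scaled profile to integers. The second
  clause provides a clique of size \<Omega>, against which additive constants are
  negligible.\<close>

definition comparable :: "nat \<Rightarrow> real \<Rightarrow> real \<Rightarrow> real \<Rightarrow> nat \<Rightarrow> real \<Rightarrow> nat \<Rightarrow> 'm \<Rightarrow> bool" where
  "comparable K \<rho> \<tau> a \<Omega> s t \<omega> \<longleftrightarrow>
    (\<forall>z. \<exists>z'. \<forall>o'\<in>cube K. real (count s (nat \<lfloor>\<rho> * real t\<rfloor>) (z + o') \<omega>) \<le> (real (count (\<tau> * s) t (z' + o') \<omega>) + 1) / a) \<and>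
    (\<exists>z. \<Omega> \<le> count (\<tau> * s) t z \<omega>)"

text \<open>Once the mean is a large multiple of ln t, Chernoff bounds confine all coarse counts
  from above and the counts of one dense fine box from below, within constant factors of the means.
  The same fine box then dominates every coarse box.\<close>

lemma comparable_dense_regime:
  assumes \<rho>: "1 \<le> \<rho>" and \<tau>: "0 < \<tau>" "\<tau> \<le> 1" and K: "0 < K" and a: "a = \<tau> ^ CARD('d) / \<rho>" "0 < a'" "a' < a"
  obtains Kc s0 where "0 < Kc" "0 < s0"
    "eventually (\<lambda>t. \<forall>s. 0 < s \<longrightarrow> s < s0 \<longrightarrow> Kc * ln (real t) \<le> \<rho> * real t * (\<sigma> * s ^ CARD('d)) \<longrightarrow>
      except (real t powr (-1/2)) (comparable K \<rho> \<tau> a' \<Omega> s t)) sequentially"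
proof -
  \<comment> \<open>The ratio a / a' is spent in three equal factors: on the upper deviation, on the
    lower deviation and on the density missing in the fine box.\<close>
  define \<Lambda> where "\<Lambda> = (a / a') powr (1/3)"
  have a0: "0 < a" using a(2,3) by simp
  have \<Lambda>1: "1 < \<Lambda>" unfolding \<Lambda>_def using a(2,3) by (intro gr_one_powr) auto
  have \<Lambda>3: "\<Lambda> * \<Lambda> * \<Lambda> = a / a'" unfolding \<Lambda>_def using a(2,3) by (simp add: powr_add[symmetric])
  define h where "h = ln \<Lambda>"
  have h0: "0 < h" and eh: "exp h = \<Lambda>" "exp (-h) = 1 / \<Lambda>" unfolding h_def using \<Lambda>1 by (auto simp: exp_minus inverse_eq_divide)
  \<comment> \<open>Chernoff exponents per unit of mean, for exceeding the mean by the factor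
    \<Lambda> and for falling below it by this factor.\<close>
  define \<phi> where "\<phi> = \<Lambda> * h - \<Lambda> + 1"
  define \<psi> where "\<psi> = 1 - exp (-h) * (1 + h)"
  have \<phi>0: "0 < \<phi>"
  proof -
    have "1 - h < exp (-h)" using h0 exp_minus_greater[of h] by simp
    then have "\<Lambda> * (1 - h) < \<Lambda> * (1 / \<Lambda>)" unfolding eh using \<Lambda>1 by (intro mult_strict_left_mono) auto
    then show ?thesis unfolding \<phi>_def using \<Lambda>1 by (simp add: algebra_simps)
  qed
  have \<psi>0: "0 < \<psi>"
  proof -
    have "1 + h < exp h" using h0 exp_minus_greater[of "-h"] by simp
    then have "1 / \<Lambda> * (1 + h) < 1 / \<Lambda> * \<Lambda>" unfolding eh using \<Lambda>1 by (intro mult_strict_left_mono) auto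
    then show ?thesis unfolding \<psi>_def eh using \<Lambda>1 by simp
  qed
  \<comment> \<open>Makes both tails at most t^(-2): the upper one has to beat the at most \<rho> t
    points, the lower one only the fixed number of cells in a box.\<close>
  define Kc where "Kc = 2 / \<phi> + 2 * \<Lambda> / (\<psi> * a) + 1"
  have Kc0: "0 < Kc" unfolding Kc_def using \<phi>0 \<psi>0 \<Lambda>1 a0 by (auto intro!: add_nonneg_pos add_nonneg_nonneg)
  have Kc1: "2 \<le> \<phi> * Kc" 
  proof -
    have "\<phi> * (2 / \<phi>) \<le> \<phi> * Kc" unfolding Kc_def using \<phi>0 \<psi>0 \<Lambda>1 a0 by (intro mult_left_mono) auto
    then show ?thesis using \<phi>0 by simp
  qed
  have Kc2: "2 \<le> \<psi> * a / \<Lambda> * Kc" 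
  proof -
    have "\<psi> * a / \<Lambda> * (2 * \<Lambda> / (\<psi> * a)) \<le> \<psi> * a / \<Lambda> * Kc" unfolding Kc_def using \<phi>0 \<psi>0 \<Lambda>1 a0 by (intro mult_left_mono) auto
    then show ?thesis using \<psi>0 \<Lambda>1 a0 by simp
  qed
  have "0 < 1 - 1 / \<Lambda>" "1 - 1 / \<Lambda> < 1" using \<Lambda>1 by auto
  then obtain c s0 where cs: "0 < c" "0 < s0" "\<And>s. 0 < s \<Longrightarrow> s < s0 \<Longrightarrow> \<exists>Z. dense_boxes (1 - 1 / \<Lambda>) K c s Z"
    using ex_dense_boxes[OF _ _ K] by blast
  have v0: "finite (cube K :: (int^'d) set)" by (rule finite_cube)
  define v where "v = card (cube K :: (int^'d) set)"
  show thesis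
  proof (rule that[of Kc s0])
    have "eventually (\<lambda>t::nat. \<rho> * \<Lambda> * real t powr (-1) + real v * real t powr (-2) \<le> real t powr (-1/2)) sequentially"
      by real_asymp
    moreover have "eventually (\<lambda>t::nat. real \<Omega> \<le> a * Kc / (\<Lambda> * \<Lambda>) * ln (real t)) sequentially"
    proof -
      have p: "0 < a * Kc / (\<Lambda> * \<Lambda>)" using a0 Kc0 \<Lambda>1 by simp
      have "filterlim (\<lambda>t::nat. a * Kc / (\<Lambda> * \<Lambda>) * ln (real t)) at_top sequentially"
        by (rule filterlim_tendsto_pos_mult_at_top[OF tendsto_const p]) real_asymp
      then show ?thesis by (auto simp: filterlim_at_top)
    qed
    moreover have "eventually (\<lambda>t::nat. 2 \<le> t) sequentially" by (rule eventually_ge_at_top)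
    ultimately show "eventually (\<lambda>t. \<forall>s. 0 < s \<longrightarrow> s < s0 \<longrightarrow> Kc * ln (real t) \<le> \<rho> * real t * (\<sigma> * s ^ CARD('d)) \<longrightarrow>
      except (real t powr (-1/2)) (comparable K \<rho> \<tau> a' \<Omega> s t)) sequentially"
    proof eventually_elim
      case (elim t)
      show ?case
      proof (intro allI impI)
      fix s :: real assume st: "0 < s" "s < s0" "Kc * ln (real t) \<le> \<rho> * real t * (\<sigma> * s ^ CARD('d))"
      note elim = elim st
      have t0: "0 < real t" using elim(3) by simp
      define \<mu> where "\<mu> = \<rho> * real t * (\<sigma> * s ^ CARD('d))"
      have \<mu>: "Kc * ln (real t) \<le> \<mu>" using elim unfolding \<mu>_def by simp
      have \<mu>0: "0 < \<mu>" unfolding \<mu>_def using \<rho> t0 \<sigma>(1) elim by simp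
      define n where "n = nat \<lfloor>\<rho> * real t\<rfloor>"
      have n: "real n \<le> \<rho> * real t" unfolding n_def using \<rho> t0 by simp
      have up: "except (real n * real (card {0 :: int^'d}) * exp h * exp (real n * (\<sigma> * s ^ CARD('d)) * (\<Sum>a\<in>{0 :: int^'d}. exp h - 1) - h * (\<Lambda> * \<mu>)))
         (\<lambda>\<omega>. \<forall>z. (\<exists>a\<in>{0 :: int^'d}. 0 < count s n (z + a) \<omega>) \<longrightarrow> (\<Sum>a\<in>{0}. h * real (count s n (z + a) \<omega>)) < h * (\<Lambda> * \<mu>))"
        by (rule count_tilted_bound) (use h0 mass_le elim in auto)
      have up': "except (\<rho> * \<Lambda> * real t powr (-1)) (\<lambda>\<omega>. \<forall>z. real (count s n z \<omega>) \<le> \<Lambda> * \<mu>)"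
      proof (rule except_mono[OF up])
        have nq: "real n * (\<sigma> * s ^ CARD('d)) \<le> \<mu>" unfolding \<mu>_def using n \<sigma>(1) elim by (intro mult_right_mono) auto
        have "real n * (\<sigma> * s ^ CARD('d)) * (exp h - 1) - h * (\<Lambda> * \<mu>) \<le> \<mu> * (exp h - 1) - h * (\<Lambda> * \<mu>)"
          using nq h0 by (intro diff_right_mono mult_right_mono) auto
        also have "\<dots> = - (\<phi> * \<mu>)" unfolding eh \<phi>_def by (simp add: algebra_simps)
        also have "\<dots> \<le> - (2 * ln (real t))"
        proof -
          have "2 * ln (real t) \<le> \<phi> * Kc * ln (real t)" using Kc1 elim(3) by (intro mult_right_mono) auto
          also have "\<dots> \<le> \<phi> * \<mu>" using \<mu> \<phi>0 by (simp add: mult.assoc)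
          finally show ?thesis by simp
        qed
        finally have "exp (real n * (\<sigma> * s ^ CARD('d)) * (exp h - 1) - h * (\<Lambda> * \<mu>)) \<le> exp (- (2 * ln (real t)))" by simp
        also have "\<dots> = real t powr (-2)" using t0 by (simp add: powr_def)
        finally have "real n * \<Lambda> * exp (real n * (\<sigma> * s ^ CARD('d)) * (exp h - 1) - h * (\<Lambda> * \<mu>)) \<le> (\<rho> * real t) * \<Lambda> * real t powr (-2)"
          using n \<Lambda>1 \<rho> by (intro mult_mono mult_nonneg_nonneg) auto
        also have "\<dots> = \<rho> * \<Lambda> * (real t powr 1 * real t powr (-2))" using t0 by simp
        also have "\<dots> = \<rho> * \<Lambda> * real t powr (-1)" by (simp only: powr_add[symmetric]) simp
        finally show "real n * real (card {0 :: int^'d}) * exp h * exp (real n * (\<sigma> * s ^ CARD('d)) * (\<Sum>a\<in>{0 :: int^'d}. exp h - 1) - h * (\<Lambda> * \<mu>))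
           \<le> \<rho> * \<Lambda> * real t powr (-1)" by (simp add: eh)
        fix \<omega> assume H: "\<forall>z. (\<exists>a\<in>{0 :: int^'d}. 0 < count s n (z + a) \<omega>) \<longrightarrow> (\<Sum>a\<in>{0}. h * real (count s n (z + a) \<omega>)) < h * (\<Lambda> * \<mu>)"
        show "\<forall>z. real (count s n z \<omega>) \<le> \<Lambda> * \<mu>"
        proof
          fix z show "real (count s n z \<omega>) \<le> \<Lambda> * \<mu>"
          proof (cases "count s n z \<omega> = 0")
            case True then show ?thesis using \<Lambda>1 \<mu>0 by simp
          next
            case False
            then have "h * real (count s n z \<omega>) < h * (\<Lambda> * \<mu>)" using H[rule_format, of z] by simp
            then show ?thesis using h0 by (simp add: mult_less_cancel_left less_imp_le)
          qed
        qed
      qed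
      define s' where "s' = \<tau> * s"
      have s': "0 < s'" "s' < s0"
      proof -
        show "0 < s'" unfolding s'_def using \<tau> elim by simp
        have "\<tau> * s \<le> 1 * s" using \<tau> elim by (intro mult_right_mono) auto
        then show "s' < s0" unfolding s'_def using elim by linarith
      qed
      have \<mu>': "real t * (\<sigma> * s' ^ CARD('d)) = a * \<mu>"
        unfolding s'_def \<mu>_def a(1) using \<rho> by (simp add: power_mult_distrib)
      obtain Z where Z: "dense_boxes (1 - 1 / \<Lambda>) K c s' Z" using cs(3)[OF s'] by blast
      then have "Z \<noteq> {}" using cs(1) unfolding dense_boxes_def by auto
      \<comment> \<open>A single dense box suffices, because all of its counts are
        concentrated.\<close>
      then obtain z0 where z0: "z0 \<in> Z" by auto
      have low1: "except (real t powr (-2)) (\<lambda>\<omega>. a * \<mu> / (\<Lambda> * \<Lambda>) \<le> real (count s' t (z0 + b) \<omega>))" if b: "b \<in> cube K" for b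
      proof (rule except_mono[OF count_lower_tail[where h = h and s = s' and n = t and a = "z0 + b"]])
        show "0 \<le> h" using h0 by simp
        have m: "1 / \<Lambda> * (\<sigma> * s' ^ CARD('d)) \<le> mass s' (z0 + b)" using Z z0 b unfolding dense_boxes_def by auto
        have "real t * (1 / \<Lambda> * (\<sigma> * s' ^ CARD('d))) \<le> real t * mass s' (z0 + b)" using m by (intro mult_left_mono) auto
        moreover have "real t * (1 / \<Lambda> * (\<sigma> * s' ^ CARD('d))) = a * \<mu> / \<Lambda>" using \<mu>' by (simp add: field_simps)
        ultimately have tm: "a * \<mu> / \<Lambda> \<le> real t * mass s' (z0 + b)" by linarith
        have "2 * ln (real t) \<le> \<psi> * a / \<Lambda> * Kc * ln (real t)" using Kc2 elim(3) by (intro mult_right_mono) auto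
        also have "\<dots> \<le> \<psi> * a / \<Lambda> * \<mu>" using \<mu> \<psi>0 a0 \<Lambda>1 by (simp add: mult.assoc divide_right_mono mult_left_mono)
        also have "\<dots> = \<psi> * (a * \<mu> / \<Lambda>)" by simp
        also have "\<dots> \<le> \<psi> * (real t * mass s' (z0 + b))" using tm \<psi>0 by (intro mult_left_mono) auto
        finally have "real t * mass s' (z0 + b) * (exp (-h) * (1 + h) - 1) \<le> - (2 * ln (real t))"
          unfolding \<psi>_def by (simp add: algebra_simps)
        then have "exp (real t * mass s' (z0 + b) * (exp (-h) * (1 + h) - 1)) \<le> exp (- (2 * ln (real t)))" by simp
        also have "\<dots> = real t powr (-2)" using t0 by (simp add: powr_def)
        finally show "exp (real t * mass s' (z0 + b) * (exp (-h) * (1 + h) - 1)) \<le> real t powr (-2)" .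
        fix \<omega> assume "exp (-h) * (real t * mass s' (z0 + b)) < real (count s' t (z0 + b) \<omega>)"
        moreover have "1 / \<Lambda> * (a * \<mu> / \<Lambda>) \<le> 1 / \<Lambda> * (real t * mass s' (z0 + b))" using tm \<Lambda>1 by (intro mult_left_mono) auto
        ultimately show "a * \<mu> / (\<Lambda> * \<Lambda>) \<le> real (count s' t (z0 + b) \<omega>)" unfolding eh by simp
      qed
      have low: "except (\<Sum>b\<in>(cube K :: (int^'d) set). real t powr (-2)) (\<lambda>\<omega>. \<forall>b\<in>cube K. a * \<mu> / (\<Lambda> * \<Lambda>) \<le> real (count s' t (z0 + b) \<omega>))"
        by (rule except_ball[OF v0 low1])
      show "except (real t powr (-1/2)) (comparable K \<rho> \<tau> a' \<Omega> s t)"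
      proof (rule except_mono[OF except_conj[OF up' low]])
        show "\<rho> * \<Lambda> * real t powr (-1) + (\<Sum>b\<in>(cube K :: (int^'d) set). real t powr (-2)) \<le> real t powr (-1/2)"
          using elim(1) unfolding v_def by simp
        fix \<omega> assume H: "(\<forall>z. real (count s n z \<omega>) \<le> \<Lambda> * \<mu>) \<and> (\<forall>b\<in>cube K. a * \<mu> / (\<Lambda> * \<Lambda>) \<le> real (count s' t (z0 + b) \<omega>))"
        have z0c: "(0 :: int^'d) \<in> cube K" using K by (simp add: cube_def)
        show "comparable K \<rho> \<tau> a' \<Omega> s t \<omega>"
          unfolding comparable_def n_def[symmetric] s'_def[symmetric]
        proof (intro conjI allI exI[of _ z0] ballI)
          fix z b :: "int^'d" assume b: "b \<in> cube K"
          have "real (count s n (z + b) \<omega>) \<le> \<Lambda> * \<mu>" using H by blast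
          also have "\<Lambda> * \<mu> = (a * \<mu> / (\<Lambda> * \<Lambda>)) / a'" 
          proof -
            have "a = a' * (\<Lambda> * \<Lambda> * \<Lambda>)" unfolding \<Lambda>3 using a(2,3) by simp
            then show ?thesis using \<Lambda>1 a(2) by simp
          qed
          also have "\<dots> \<le> (real (count s' t (z0 + b) \<omega>) + 1) / a'"
            using H b a(2) by (intro divide_right_mono) (auto intro: order_trans)
          finally show "real (count s n (z + b) \<omega>) \<le> (real (count s' t (z0 + b) \<omega>) + 1) / a'" .
        next
          have "real \<Omega> \<le> a * Kc / (\<Lambda> * \<Lambda>) * ln (real t)" by (rule elim(2))
          also have "\<dots> = a / (\<Lambda> * \<Lambda>) * (Kc * ln (real t))" by simp
          also have "\<dots> \<le> a / (\<Lambda> * \<Lambda>) * \<mu>" using \<mu> a0 by (intro mult_left_mono) auto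
          also have "\<dots> \<le> real (count s' t (z0 + 0) \<omega>)" using H z0c by auto
          finally show "\<Omega> \<le> count s' t z0 \<omega>" by simp
        qed
      qed
      qed
    qed
  qed (use Kc0 cs in auto)
qed

text \<open>Counts w are improbable at mean \<mu> per cell as soon as the total rate exceeds ln t. The rate
  is homogeneous, so passing to the mean a \<mu> and the counts a w multiplies it by a < 1, and every
  profile w that is not excluded at mean \<mu> appears, scaled by a, at mean a \<mu>.\<close>
lemma comparable_log_regime:
  assumes \<rho>: "1 \<le> \<rho>" and \<tau>: "0 < \<tau>" "\<tau> \<le> 1" and K: "0 < K" and a: "a = \<tau> ^ CARD('d) / \<rho>" "a < 1"
    and a': "0 < a'" "a' \<le> a" and Kc: "0 < Kc"
  obtains \<alpha> \<kappa> s0 where "0 < \<alpha>" "0 < \<kappa>" "0 < s0"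
    "eventually (\<lambda>t. \<forall>s. 0 < s \<longrightarrow> s < s0 \<longrightarrow> real t powr (-\<alpha>) \<le> \<rho> * real t * (\<sigma> * s ^ CARD('d)) \<longrightarrow>
      \<rho> * real t * (\<sigma> * s ^ CARD('d)) \<le> Kc * ln (real t) \<longrightarrow>
      except (real t powr (-\<kappa>)) (comparable K \<rho> \<tau> a' \<Omega> s t)) sequentially"
proof -
  have a0: "0 < a" using a(1) \<tau> \<rho> by simp
  define F where "F = (cube K :: (int^'d) set)"
  have finF: "finite F" unfolding F_def by (rule finite_cube)
  have F0: "0 \<in> F" unfolding F_def cube_def using K by simp
  define v where "v = card F"
  have v0: "0 < v" unfolding v_def using finF F0 card_gt_0_iff by blast
  \<comment> \<open>Chosen so that a (1 + \<eta>) = (1 + a) / 2. Coarse profiles of rate above (1 +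
    \<eta>) ln t are excluded; the others have, after scaling by a, a rate of at most (1 + a) / 2 ln
    t, still below ln t.\<close>
  define \<eta> where "\<eta> = (1 - a) / (2 * a)"
  have \<eta>0: "0 < \<eta>" unfolding \<eta>_def using a0 a(2) by simp
  have a\<eta>: "a * (1 + \<eta>) = (1 + a) / 2" unfolding \<eta>_def using a0 by (simp add: field_simps)
  \<comment> \<open>A count whose multiple by a, rounded down, is still at least \<Omega>.\<close>
  define \<Omega>1 where "\<Omega>1 = nat \<lceil>(real \<Omega> + 1) / a\<rceil>"
  have "0 < (real \<Omega> + 1) / a" using a0 by simp
  then have \<Omega>1: "(real \<Omega> + 1) / a \<le> real \<Omega>1" "0 < \<Omega>1" unfolding \<Omega>1_def by linarith+
  \<comment> \<open>The first bound controls the loss 1 / \<mu> \<le> t^\<alpha> in the tilted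
    bound. The second keeps the part \<Omega>1 \<alpha> ln t of the rate of \<Omega>1 points in one
    cell below ln t / 2.\<close>
  define \<alpha> where "\<alpha> = min (\<eta> / 2) (1 / (2 * real \<Omega>1))"
  have \<alpha>: "0 < \<alpha>" "\<alpha> \<le> \<eta> / 2" "\<alpha> \<le> 1 / (2 * real \<Omega>1)" unfolding \<alpha>_def using \<eta>0 \<Omega>1 by auto
  \<comment> \<open>Counts are cut off at L, about cL ln t. The term exp 2 * Kc makes ln (L / \<mu>)
    at least 2, so that a count L has rate at least L; the term 1 + \<eta> puts this rate above the
    threshold.\<close>
  define cL where "cL = exp 2 * Kc + (1 + \<eta>) + 1"
  have cL: "exp 2 * Kc \<le> cL" "1 + \<eta> < cL" "1 \<le> cL"     using \<eta>0 mult_pos_pos[OF exp_gt_zero[of 2] Kc] unfolding cL_def by linarith+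
  \<comment> \<open>In units of ln t, a bound for the total of a scaled profile and for the mean
    count of a box.\<close>
  define D where "D = real v * (cL + 1) + real v * Kc"
  have D1: "1 \<le> D"
  proof -
    have "1 * 1 \<le> real v * (cL + 1)" using v0 cL by (intro mult_mono) auto
    moreover have "0 \<le> real v * Kc" using Kc by simp
    ultimately show ?thesis unfolding D_def by linarith
  qed
  \<comment> \<open>The density loss is chosen so small that its power with exponent at most D ln t
    costs no more than t^(-(1 - a) / 8).\<close>
  define e2 where "e2 = 1 - exp (- ((1 - a) / (8 * D)))"
  have e2: "0 < e2" "e2 < 1" unfolding e2_def using a(2) D1 by auto
  have e2': "1 - e2 = exp (- ((1 - a) / (8 * D)))" unfolding e2_def by simp
  obtain c s0 where cs: "0 < c" "0 < s0" "\<And>s. 0 < s \<Longrightarrow> s < s0 \<Longrightarrow> \<exists>Z. dense_boxes e2 K c s Z"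
    using ex_dense_boxes[OF e2 K] by blast
  define C1 where "C1 = 4 * exp (2 * real v) * Kc / (c * \<sigma>)"
  have C10: "0 < C1" unfolding C1_def using Kc cs \<sigma> by simp
  define \<kappa> where "\<kappa> = min (1 / 2) (min ((1 - a) / 8) (\<eta> / 4))"
  have \<kappa>: "0 < \<kappa>" "\<kappa> \<le> 1 / 2" "\<kappa> \<le> (1 - a) / 8" "\<kappa> \<le> \<eta> / 4"     using \<eta>0 a(2) by (simp_all add: \<kappa>_def min_def)
  show thesis
  proof (rule that[of \<alpha> \<kappa> s0])
    have ev1: "eventually (\<lambda>t::nat. (4 * D\<^sup>2) * ln (real t) ^ 2 \<le> real t powr 1) sequentially"
      by (rule eventually_polylog_le_powr) simp
    have ev2: "eventually (\<lambda>t::nat. (3 * ((cL + 2) ^ (v + 1) * \<rho> * real v)) * ln (real t) ^ (v + 1) \<le> real t powr (\<eta> / 4)) sequentially"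
      by (rule eventually_polylog_le_powr) (use \<eta>0 in simp)
    have ev3: "eventually (\<lambda>t::nat. (3 * (C1 * (cL + 2) ^ (2 * v))) * ln (real t) ^ (2 * v + 1) \<le> real t powr ((1 - a) / 4)) sequentially"
      by (rule eventually_polylog_le_powr) (use a(2) in simp)
    have ev4: "eventually (\<lambda>t::nat. (3 * ((cL + 2) ^ v * (4 * D\<^sup>2))) * ln (real t) ^ (v + 2) \<le> real t powr (1 / 2)) sequentially"
      by (rule eventually_polylog_le_powr) simp
    have ev5: "eventually (\<lambda>t::nat. real \<Omega>1 * ln (real \<Omega>1) + 1 + real \<Omega>1 \<le> 1 / 2 * ln (real t)) sequentially"
      by real_asymp
    have ev6: "eventually (\<lambda>t::nat. 1 \<le> ln (real t)) sequentially" by real_asymp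
    have ev7: "eventually (\<lambda>t::nat. 1 \<le> t) sequentially" by (rule eventually_ge_at_top)
    show "eventually (\<lambda>t. \<forall>s. 0 < s \<longrightarrow> s < s0 \<longrightarrow> real t powr (-\<alpha>) \<le> \<rho> * real t * (\<sigma> * s ^ CARD('d)) \<longrightarrow>
      \<rho> * real t * (\<sigma> * s ^ CARD('d)) \<le> Kc * ln (real t) \<longrightarrow>
      except (real t powr (-\<kappa>)) (comparable K \<rho> \<tau> a' \<Omega> s t)) sequentially"
      using ev1 ev2 ev3 ev4 ev5 ev6 ev7
    proof eventually_elim
      case (elim t)
      show ?case
      proof (intro allI impI)
      fix s :: real assume st: "0 < s" "s < s0" "real t powr (-\<alpha>) \<le> \<rho> * real t * (\<sigma> * s ^ CARD('d))" "\<rho> * real t * (\<sigma> * s ^ CARD('d)) \<le> Kc * ln (real t)"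
      note elim = elim st
      have t0: "0 < real t" using elim(7) by simp
      have t1: "1 \<le> real t" using elim(7) by simp
      define l where "l = ln (real t)"
      have l1: "1 \<le> l" using elim(6) unfolding l_def .
      have tl: "exp (x * l) = real t powr x" for x unfolding l_def powr_def using t0 by simp
      define \<mu> where "\<mu> = \<rho> * real t * (\<sigma> * s ^ CARD('d))"
      have \<mu>: "real t powr (-\<alpha>) \<le> \<mu>" "\<mu> \<le> Kc * l" using elim unfolding \<mu>_def l_def by simp_all
      have \<mu>0: "0 < \<mu>" using t0 by (intro less_le_trans[OF _ \<mu>(1)]) simp
      define n where "n = nat \<lfloor>\<rho> * real t\<rfloor>"
      have n: "real n \<le> \<rho> * real t" unfolding n_def using \<rho> t0 by simp
      define L where "L = nat \<lceil>cL * l\<rceil>"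
      have "0 < cL * l" using cL l1 by simp
      then have L: "cL * l \<le> real L" "real L \<le> cL * l + 1" unfolding L_def by linarith+
      have L': "real L + 1 \<le> (cL + 2) * l" "real L \<le> (cL + 1) * l" using L l1 by (simp_all add: distrib_right)
      have LK: "exp 2 * \<mu> \<le> real L"
      proof -
        have "exp 2 * \<mu> \<le> exp 2 * (Kc * l)" using \<mu>(2) by simp
        also have "\<dots> = (exp 2 * Kc) * l" by simp
        also have "\<dots> \<le> cL * l" using cL l1 by (intro mult_right_mono) auto
        finally show ?thesis using L by linarith
      qed
      have L\<mu>: "\<mu> \<le> real L"
      proof -
        have "1 * \<mu> \<le> exp 2 * \<mu>" using \<mu>0 by (intro mult_right_mono) auto
        then show ?thesis using LK by linarith
      qed
      have Lpos: "1 \<le> real L" using L cL l1 mult_mono[of 1 cL 1 l] by linarith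
      \<comment> \<open>Profiles with counts up to L. There are only (L + 1)^v of them, a power of
        ln t, so a union bound over P costs nothing against a power of t.\<close>
      define P where "P = PiE F (\<lambda>_. {0..L})"
      have finP: "finite P" unfolding P_def using finF by (intro finite_PiE) auto
      have cardP: "card P = (L + 1) ^ v" unfolding P_def v_def using finF by (simp add: card_PiE)
      define R where "R w = (\<Sum>b\<in>F. rate (real (w b)) \<mu>)" for w :: "int^'d \<Rightarrow> nat"
      have rate0: "0 \<le> rate x \<mu>" for x
      proof -
        define y where "y = max x \<mu>"
        have y: "0 < y" unfolding y_def using \<mu>0 by simp
        have "ln (\<mu> / y) \<le> \<mu> / y - 1" using y \<mu>0 by (intro ln_le_minus_one) auto
        then have "1 - \<mu> / y \<le> ln (y / \<mu>)" using y \<mu>0 by (simp add: ln_div)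
        then have "y * (1 - \<mu> / y) \<le> y * ln (y / \<mu>)" using y by (intro mult_left_mono) auto
        then show ?thesis unfolding rate_def y_def[symmetric] using y by (simp add: right_diff_distrib)
      qed
      have up1: "except ((\<rho> * real t) * real v * (real L * real t powr \<alpha>) * real t powr (-(1 + \<eta>)))
          (\<lambda>\<omega>. \<forall>z. \<not> (\<forall>b\<in>F. w b \<le> count s n (z + b) \<omega>))"
        if w: "w \<in> P" and Rw: "(1 + \<eta>) * l < R w" for w
      proof -
        \<comment> \<open>The optimal Poisson tilt: with it the exponent in
          \<open>count_tilted_bound\<close> is at most minus the total rate of w. It vanishes on
          cells where w does not exceed the mean.\<close>
        define h where "h b = ln (max (real (w b)) \<mu> / \<mu>)" for b
        have h0: "0 \<le> h b" for b unfolding h_def using \<mu>0 by simp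
        have hH: "h b \<le> ln (real L / \<mu>)" if "b \<in> F" for b
        proof -
          have "real (w b) \<le> real L" using w that unfolding P_def by (auto simp: PiE_iff)
          then show ?thesis unfolding h_def using \<mu>0 L\<mu> Lpos by (subst ln_le_cancel_iff) (auto intro!: divide_right_mono)
        qed
        define \<theta> where "\<theta> = (\<Sum>b\<in>F. h b * real (w b))"
        have tb: "except (real n * real (card F) * exp (ln (real L / \<mu>)) * exp (real n * (\<sigma> * s ^ CARD('d)) * (\<Sum>b\<in>F. exp (h b) - 1) - \<theta>))
          (\<lambda>\<omega>. \<forall>z. (\<exists>b\<in>F. 0 < count s n (z + b) \<omega>) \<longrightarrow> (\<Sum>b\<in>F. h b * real (count s n (z + b) \<omega>)) < \<theta>)"
          by (rule count_tilted_bound) (use finF h0 hH mass_le elim in auto)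
        show ?thesis
        proof (rule except_mono[OF tb])
          have nq: "real n * (\<sigma> * s ^ CARD('d)) \<le> \<mu>" unfolding \<mu>_def using n \<sigma>(1) elim by (intro mult_right_mono) auto
          have "real n * (\<sigma> * s ^ CARD('d)) * (\<Sum>b\<in>F. exp (h b) - 1) \<le> \<mu> * (\<Sum>b\<in>F. exp (h b) - 1)"
            using nq h0 by (intro mult_right_mono sum_nonneg) auto
          also have "\<dots> - \<theta> = - R w"
          proof -
            have "\<mu> * (exp (h b) - 1) - h b * real (w b) = - rate (real (w b)) \<mu>" for b
            proof -
              have e: "\<mu> * exp (h b) = max (real (w b)) \<mu>" unfolding h_def using \<mu>0 by (subst exp_ln) auto
              have "h b * real (w b) = max (real (w b)) \<mu> * h b"
                unfolding h_def using \<mu>0 by (cases "real (w b) \<le> \<mu>") (auto simp: max_def)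
              then show ?thesis unfolding rate_def h_def[symmetric] using e by (simp add: right_diff_distrib)
            qed
            then show ?thesis unfolding R_def \<theta>_def
              by (simp add: sum_distrib_left sum_subtractf[symmetric] sum_negf)
          qed
          finally have "real n * (\<sigma> * s ^ CARD('d)) * (\<Sum>b\<in>F. exp (h b) - 1) - \<theta> \<le> - ((1 + \<eta>) * l)"
            using Rw by linarith
          then have "exp (real n * (\<sigma> * s ^ CARD('d)) * (\<Sum>b\<in>F. exp (h b) - 1) - \<theta>) \<le> exp ((-(1 + \<eta>)) * l)"
            by (simp only: exp_le_cancel_iff)
          then have ee: "exp (real n * (\<sigma> * s ^ CARD('d)) * (\<Sum>b\<in>F. exp (h b) - 1) - \<theta>) \<le> real t powr (-(1 + \<eta>))"
            unfolding tl .
          have "1 / \<mu> \<le> 1 / real t powr (-\<alpha>)" using \<mu>(1) t0 \<mu>0 by (intro divide_left_mono) auto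
          also have "\<dots> = real t powr \<alpha>" by (simp add: powr_minus_divide)
          finally have "real L * (1 / \<mu>) \<le> real L * real t powr \<alpha>" by (intro mult_left_mono) auto
          then have eH: "exp (ln (real L / \<mu>)) \<le> real L * real t powr \<alpha>" using Lpos \<mu>0 by simp
          show "real n * real (card F) * exp (ln (real L / \<mu>)) * exp (real n * (\<sigma> * s ^ CARD('d)) * (\<Sum>b\<in>F. exp (h b) - 1) - \<theta>)
             \<le> (\<rho> * real t) * real v * (real L * real t powr \<alpha>) * real t powr (-(1 + \<eta>))"
            unfolding v_def[symmetric] using n \<rho>
            by (intro mult_mono[OF _ ee] mult_mono[OF _ eH] mult_mono mult_nonneg_nonneg) auto
          fix \<omega> assume H: "\<forall>z. (\<exists>b\<in>F. 0 < count s n (z + b) \<omega>) \<longrightarrow> (\<Sum>b\<in>F. h b * real (count s n (z + b) \<omega>)) < \<theta>"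
          show "\<forall>z. \<not> (\<forall>b\<in>F. w b \<le> count s n (z + b) \<omega>)"
          proof (intro allI notI)
            fix z assume ge: "\<forall>b\<in>F. w b \<le> count s n (z + b) \<omega>"
            have "\<exists>b\<in>F. 0 < w b"
            proof (rule ccontr)
              assume "\<not> (\<exists>b\<in>F. 0 < w b)"
              then have "R w = 0" unfolding R_def rate_def using \<mu>0 by simp
              then show False using Rw \<eta>0 l1 by (simp add: mult_less_0_iff)
            qed
            then have "\<exists>b\<in>F. 0 < count s n (z + b) \<omega>" using ge by force
            then have "(\<Sum>b\<in>F. h b * real (count s n (z + b) \<omega>)) < \<theta>" using H by blast
            moreover have "\<theta> \<le> (\<Sum>b\<in>F. h b * real (count s n (z + b) \<omega>))"
              unfolding \<theta>_def using ge h0 by (intro sum_mono mult_left_mono) auto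
            ultimately show False by simp
          qed
        qed
      qed
      define s' where "s' = \<tau> * s"
      have s': "0 < s'" "s' < s0"
      proof -
        show "0 < s'" unfolding s'_def using \<tau> elim by simp
        have "\<tau> * s \<le> 1 * s" using \<tau> elim by (intro mult_right_mono) auto
        then show "s' < s0" unfolding s'_def using elim by linarith
      qed
      have \<mu>': "a * \<mu> = real t * (\<sigma> * s' ^ CARD('d))"
        unfolding s'_def \<mu>_def a(1) using \<rho> by (simp add: power_mult_distrib)
      have a\<mu>: "a * \<mu> \<le> \<mu>" "0 < a * \<mu>" using a(2) a0 \<mu>0 by (auto simp: mult_le_cancel_right1)
      obtain Z where Z: "dense_boxes e2 K c s' Z" using cs(3)[OF s'] by blast
      define B where "B = D * l"
      have B1: "1 \<le> B" unfolding B_def using D1 l1 mult_mono[of 1 D 1 l] by simp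
      have B4: "4 * B\<^sup>2 \<le> real t" using elim(1) t0 unfolding B_def l_def by (simp add: power_mult_distrib)
      \<comment> \<open>Counts below the mean are first raised to it. This costs no rate, only helps
        domination, and puts the scaled count into the range \<mu> \<le> x of
        \<open>poisson_weight_ge\<close>.\<close>
      define sc where "sc w b = nat \<lfloor>a * max (real (w b)) \<mu>\<rfloor>" for w :: "int^'d \<Rightarrow> nat" and b
      \<comment> \<open>The factors are, in order, the loss from multinomial to Poisson, the missing
        density, the rate of the scaled profile, and Stirling's error in each of the v
        cells.\<close>
      define pr where "pr = 1 / 4 * real t powr (- ((1 - a) / 8)) * (real t powr (- ((1 + a) / 2)) * (exp (-2) / (real L + 1)) ^ v)"
      have pr0: "0 < pr" unfolding pr_def using t0 by simp
      have low1: "except (a * \<mu> / (c * \<sigma> * real t * pr) + 4 * B\<^sup>2 / real t) (\<lambda>\<omega>. \<exists>z\<in>Z. \<forall>b\<in>F. count s' t (z + b) \<omega> = sc w b)"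
        if w: "w \<in> P" and Rw: "R w \<le> (1 + \<eta>) * l" for w
      proof (rule dense_box_with_counts[OF Z cs(1) s'(1) e2 _ _ refl _ \<mu>' B1 _ _ B4 pr0])
        show "F \<subseteq> cube K" unfolding F_def by simp
        show "F \<noteq> {}" using F0 by auto
        show "0 < t" using elim(7) by simp
        have wL: "real (sc w b) \<le> real L" if "b \<in> F" for b
        proof -
          have "real (w b) \<le> real L" using w that unfolding P_def by (auto simp: PiE_iff)
          then have "max (real (w b)) \<mu> \<le> real L" using L\<mu> by simp
          moreover have "a * max (real (w b)) \<mu> \<le> 1 * max (real (w b)) \<mu>" using a(2) \<mu>0 by (intro mult_right_mono) auto
          moreover have "real (sc w b) \<le> a * max (real (w b)) \<mu>" unfolding sc_def using a0 \<mu>0 by (simp add: le_max_iff_disj)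
          ultimately show ?thesis by linarith
        qed
        have "real (\<Sum>b\<in>F. sc w b) \<le> (\<Sum>b\<in>F. real L)" unfolding of_nat_sum by (intro sum_mono wL)
        also have "\<dots> = real v * real L" unfolding v_def by simp
        also have "\<dots> \<le> real v * ((cL + 1) * l)" using L' by (intro mult_left_mono) auto
        also have "\<dots> = real v * (cL + 1) * l" by simp
        also have "\<dots> \<le> D * l" unfolding D_def using Kc l1 by (intro mult_right_mono) auto
        finally show WB: "real (\<Sum>b\<in>F. sc w b) \<le> B" unfolding B_def .
        have "real (card F) * (a * \<mu>) \<le> real v * (Kc * l)"
          unfolding v_def[symmetric] using a\<mu> \<mu>(2) by (intro mult_left_mono) auto
        also have "\<dots> = real v * Kc * l" by simp
        also have "\<dots> \<le> D * l" unfolding D_def using cL l1 by (intro mult_right_mono) auto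
        finally show "real (card F) * (a * \<mu>) \<le> B" unfolding B_def .
        have p1: "real t powr (- ((1 - a) / 8)) \<le> (1 - e2) ^ (\<Sum>b\<in>F. sc w b)"
        proof -
          have "(1 - a) / (8 * D) * real (\<Sum>b\<in>F. sc w b) \<le> (1 - a) / (8 * D) * (D * l)"
            using WB a(2) D1 unfolding B_def by (intro mult_left_mono) auto
          also have "\<dots> = (1 - a) / 8 * l" using D1 by simp
          finally have "exp (- ((1 - a) / 8) * l) \<le> exp (real (\<Sum>b\<in>F. sc w b) * (- ((1 - a) / (8 * D))))"
            by (simp add: mult.commute)
          also have "\<dots> = (1 - e2) ^ (\<Sum>b\<in>F. sc w b)" unfolding e2' by (rule exp_of_nat_mult)
          finally show ?thesis unfolding tl .
        qed
        have p2: "real t powr (- ((1 + a) / 2)) * (exp (-2) / (real L + 1)) ^ v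
            \<le> (\<Prod>b\<in>F. exp (- (a * \<mu>)) * (a * \<mu>) ^ sc w b / fact (sc w b))"
        proof -
          have "real t powr (- ((1 + a) / 2)) \<le> exp (- (a * R w))"
          proof -
            have "a * R w \<le> a * ((1 + \<eta>) * l)" using Rw a0 by (intro mult_left_mono) auto
            also have "\<dots> = (1 + a) / 2 * l" unfolding a\<eta>[symmetric] by (rule mult.assoc[symmetric])
            finally have "exp (- ((1 + a) / 2) * l) \<le> exp (- (a * R w))" by simp
            then show ?thesis unfolding tl .
          qed
          then have "real t powr (- ((1 + a) / 2)) * (exp (-2) / (real L + 1)) ^ v \<le> exp (- (a * R w)) * (exp (-2) / (real L + 1)) ^ v"
            by (intro mult_right_mono) auto
          also have "\<dots> = (\<Prod>b\<in>F. exp (- (a * rate (real (w b)) \<mu>)) * (exp (-2) / (real L + 1)))"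
            unfolding R_def v_def prod.distrib prod_constant using finF
            by (simp add: exp_sum sum_distrib_left sum_negf[symmetric])
          also have "\<dots> \<le> (\<Prod>b\<in>F. exp (- (a * \<mu>)) * (a * \<mu>) ^ sc w b / fact (sc w b))"
          proof (rule prod_mono, intro conjI)
            fix b assume b: "b \<in> F"
            let ?x = "a * max (real (w b)) \<mu>"
            have "rate ?x (a * \<mu>) = a * rate (max (real (w b)) \<mu>) \<mu>" using a0 by (rule rate_scale)
            also have "rate (max (real (w b)) \<mu>) \<mu> = rate (real (w b)) \<mu>" unfolding rate_def by simp
            finally have r: "rate ?x (a * \<mu>) = a * rate (real (w b)) \<mu>" .
            have "exp (- (a * rate (real (w b)) \<mu>)) * (exp (-2) / (real L + 1)) \<le> exp (- (a * rate (real (w b)) \<mu>)) * (exp (-2) / (real (sc w b) + 1))"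
              using wL[OF b] by (intro mult_left_mono divide_left_mono) auto
            also have "\<dots> \<le> exp (- (a * \<mu>)) * (a * \<mu>) ^ sc w b / fact (sc w b)"
              unfolding r[symmetric] sc_def using a0 a\<mu> by (intro poisson_weight_ge) auto
            finally show "exp (- (a * rate (real (w b)) \<mu>)) * (exp (-2) / (real L + 1)) \<le> exp (- (a * \<mu>)) * (a * \<mu>) ^ sc w b / fact (sc w b)" .
          qed simp
          finally show ?thesis .
        qed
        have "real t powr (- ((1 - a) / 8)) * (real t powr (- ((1 + a) / 2)) * (exp (-2) / (real L + 1)) ^ v)
          \<le> (1 - e2) ^ (\<Sum>b\<in>F. sc w b) * (\<Prod>b\<in>F. exp (- (a * \<mu>)) * (a * \<mu>) ^ sc w b / fact (sc w b))"
          using p1 p2 e2 by (intro mult_mono) auto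
        then show "pr \<le> 1 / 4 * (1 - e2) ^ (\<Sum>b\<in>F. sc w b) * (\<Prod>b\<in>F. exp (- (a * \<mu>)) * (a * \<mu>) ^ sc w b / fact (sc w b))"
          unfolding pr_def by simp
      qed
      define E1 where "E1 = (\<rho> * real t) * real v * (real L * real t powr \<alpha>) * real t powr (-(1 + \<eta>))"
      define E2 where "E2 = a * \<mu> / (c * \<sigma> * real t * pr) + 4 * B\<^sup>2 / real t"
      have E10: "0 \<le> E1" unfolding E1_def using \<rho> by simp
      have E20: "0 \<le> E2" unfolding E2_def using a\<mu> cs \<sigma> pr0 by simp
      \<comment> \<open>The dichotomy for a single profile: beyond the threshold no coarse box
        reaches it, below the threshold its scaled copy occurs in a dense fine box.\<close>
      define good where "good w \<omega> \<longleftrightarrow> (if (1 + \<eta>) * l < R w then \<forall>z. \<not> (\<forall>b\<in>F. w b \<le> count s n (z + b) \<omega>)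
          else \<exists>z\<in>Z. \<forall>b\<in>F. count s' t (z + b) \<omega> = sc w b)" for w \<omega>
      have each: "except (E1 + E2) (good w)" if w: "w \<in> P" for w
      proof (cases "(1 + \<eta>) * l < R w")
        case True
        show ?thesis
          by (rule except_mono[OF up1[OF w True, folded E1_def]]) (use E20 True in \<open>auto simp: good_def\<close>)
      next
        case False
        then have "R w \<le> (1 + \<eta>) * l" by simp
        from low1[OF w this, folded E2_def] show ?thesis
          by (rule except_mono) (use E10 False in \<open>auto simp: good_def\<close>)
      qed
      have all: "except (\<Sum>w\<in>P. E1 + E2) (\<lambda>\<omega>. \<forall>w\<in>P. good w \<omega>)" by (rule except_ball[OF finP each])
      show "except (real t powr (-\<kappa>)) (comparable K \<rho> \<tau> a' \<Omega> s t)"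
      proof (rule except_mono[OF all])
        have Lv: "real (L + 1) ^ k \<le> ((cL + 2) * l) ^ k" for k using L' by (intro power_mono) auto
        have "real (L + 1) ^ v * E1 \<le> real t powr (-\<kappa>) / 3"
        proof -
          \<comment> \<open>The number of points, the factor 1 / \<mu> \<le> t^\<alpha> and the rate
            combine to the exponent \<alpha> - \<eta>, which is at most - \<eta> / 2.\<close>
          have pw: "real t * real t powr \<alpha> * real t powr (-(1 + \<eta>)) \<le> real t powr (-\<eta> / 2)"
          proof -
            have "real t * real t powr \<alpha> * real t powr (-(1 + \<eta>)) = real t powr 1 * real t powr \<alpha> * real t powr (-(1 + \<eta>))"
              using t0 by simp
            also have "\<dots> = real t powr (\<alpha> - \<eta>)" unfolding powr_add[symmetric] by (simp add: algebra_simps)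
            also have "\<dots> \<le> real t powr (-\<eta> / 2)" using t1 \<alpha> by (intro powr_mono) auto
            finally show ?thesis .
          qed
          have "real (L + 1) ^ v * E1 = real (L + 1) ^ v * real L * (\<rho> * real v) * (real t * real t powr \<alpha> * real t powr (-(1 + \<eta>)))"
            unfolding E1_def by simp
          also have "\<dots> \<le> real (L + 1) ^ v * real (L + 1) * (\<rho> * real v) * real t powr (-\<eta> / 2)"
            using pw \<rho> by (intro mult_mono mult_nonneg_nonneg) auto
          also have "real (L + 1) ^ v * real (L + 1) = real (L + 1) ^ (v + 1)" by simp
          also have "real (L + 1) ^ (v + 1) * (\<rho> * real v) * real t powr (-\<eta> / 2) \<le> ((cL + 2) * l) ^ (v + 1) * (\<rho> * real v) * real t powr (-\<eta> / 2)"
            using \<rho> by (intro mult_right_mono Lv) auto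
          also have "\<dots> = (3 * ((cL + 2) ^ (v + 1) * \<rho> * real v) * l ^ (v + 1)) * real t powr (-\<eta> / 2) / 3"
            by (simp add: power_mult_distrib del: power_Suc)
          also have "\<dots> \<le> real t powr (\<eta> / 4) * real t powr (-\<eta> / 2) / 3"
            using elim(2) unfolding l_def by (intro divide_right_mono mult_right_mono) auto
          also have "\<dots> = real t powr (-(\<eta> / 4)) / 3" unfolding powr_add[symmetric] by simp
          also have "\<dots> \<le> real t powr (-\<kappa>) / 3" using t1 \<kappa> by (intro divide_right_mono powr_mono) auto
          finally show ?thesis .
        qed
        moreover have "real (L + 1) ^ v * (a * \<mu> / (c * \<sigma> * real t * pr)) \<le> real t powr (-\<kappa>) / 3"
        proof -
          have pe: "1 / pr = 4 * exp (2 * real v) * real (L + 1) ^ v * (real t powr ((1 - a) / 8) * real t powr ((1 + a) / 2))"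
          proof -
            have "(exp (-2) / (real L + 1)) ^ v = 1 / (exp (2 * real v) * real (L + 1) ^ v)"
            proof -
              have "exp (-2) ^ v = 1 / exp (2 * real v)"
                unfolding exp_of_nat_mult[symmetric] by (simp add: exp_minus inverse_eq_divide mult.commute)
              then show ?thesis by (simp add: power_divide add.commute)
            qed
            then show ?thesis unfolding pr_def by (simp add: powr_minus_divide)
          qed
          have "a * \<mu> / (c * \<sigma> * real t * pr) = a * \<mu> / (c * \<sigma>) * (1 / real t) * (1 / pr)" by simp
          also have "\<dots> \<le> (Kc * l) / (c * \<sigma>) * (1 / real t) * (1 / pr)"
            using a\<mu> \<mu>(2) cs \<sigma>(1) pr0 by (intro mult_right_mono divide_right_mono) auto
          also have "1 / real t = real t powr (-1)" using t0 by (simp add: powr_minus_divide)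
          also have "(Kc * l) / (c * \<sigma>) * real t powr (-1) * (1 / pr) = C1 * l * real (L + 1) ^ v * (real t powr (-1) * real t powr ((1 - a) / 8) * real t powr ((1 + a) / 2))"
            unfolding pe C1_def by simp
          \<comment> \<open>The exponent is negative exactly because a < 1: up to logarithms there
            are t places, while the reciprocal of the probability is only t^((1 - a) / 8 + (1 + a) /
            2).\<close>
          also have "real t powr (-1) * real t powr ((1 - a) / 8) * real t powr ((1 + a) / 2) = real t powr (- (3 * (1 - a) / 8))"
            unfolding powr_add[symmetric] by (intro arg_cong[of _ _ "\<lambda>x. real t powr x"]) (simp add: field_simps)
          finally have "real (L + 1) ^ v * (a * \<mu> / (c * \<sigma> * real t * pr)) \<le> real (L + 1) ^ v * (C1 * l * real (L + 1) ^ v * real t powr (- (3 * (1 - a) / 8)))"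
            by (intro mult_left_mono) auto
          also have "\<dots> = real (L + 1) ^ (2 * v) * (C1 * l * real t powr (- (3 * (1 - a) / 8)))"
            by (simp add: mult_2 power_add)
          also have "\<dots> \<le> ((cL + 2) * l) ^ (2 * v) * (C1 * l * real t powr (- (3 * (1 - a) / 8)))"
            using C10 l1 by (intro mult_right_mono Lv) auto
          also have "\<dots> = ((3 * (C1 * (cL + 2) ^ (2 * v))) * l ^ (2 * v + 1)) * real t powr (- (3 * (1 - a) / 8)) / 3"
            by (simp add: power_mult_distrib)
          also have "\<dots> \<le> real t powr ((1 - a) / 4) * real t powr (- (3 * (1 - a) / 8)) / 3"
            using elim(3) unfolding l_def by (intro divide_right_mono mult_right_mono) auto
          also have "\<dots> = real t powr (- ((1 - a) / 8)) / 3"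
            unfolding powr_add[symmetric] by (intro arg_cong[of _ _ "\<lambda>x. real t powr x / 3"]) (simp add: field_simps)
          also have "\<dots> \<le> real t powr (-\<kappa>) / 3" using t1 \<kappa> by (intro divide_right_mono powr_mono) auto
          finally show ?thesis .
        qed
        moreover have "real (L + 1) ^ v * (4 * B\<^sup>2 / real t) \<le> real t powr (-\<kappa>) / 3"
        proof -
          have "real (L + 1) ^ v * (4 * B\<^sup>2 / real t) \<le> ((cL + 2) * l) ^ v * (4 * B\<^sup>2 / real t)"
            by (intro mult_right_mono Lv) auto
          also have "\<dots> = ((3 * ((cL + 2) ^ v * (4 * D\<^sup>2))) * l ^ (v + 2)) * (1 / real t) / 3"
            unfolding B_def by (simp add: power_mult_distrib power_add power2_eq_square)
          also have "\<dots> \<le> real t powr (1 / 2) * (1 / real t) / 3"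
            using elim(4) unfolding l_def by (intro divide_right_mono mult_right_mono) auto
          also have "1 / real t = real t powr (-1)" using t0 by (simp add: powr_minus_divide)
          also have "real t powr (1 / 2) * real t powr (-1) / 3 = real t powr (- (1/2)) / 3" unfolding powr_add[symmetric] by simp
          also have "\<dots> \<le> real t powr (-\<kappa>) / 3" using t1 \<kappa> by (intro divide_right_mono powr_mono) auto
          finally show ?thesis .
        qed
        moreover have "(\<Sum>w\<in>P. E1 + E2) = real (L + 1) ^ v * E1 +
            (real (L + 1) ^ v * (a * \<mu> / (c * \<sigma> * real t * pr)) + real (L + 1) ^ v * (4 * B\<^sup>2 / real t))"
          unfolding sum_constant cardP of_nat_power E2_def distrib_left ..
        ultimately show "(\<Sum>w\<in>P. E1 + E2) \<le> real t powr (-\<kappa>)" by linarith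
      next
        fix \<omega> assume G: "\<forall>w\<in>P. good w \<omega>"
        show "comparable K \<rho> \<tau> a' \<Omega> s t \<omega>"
          unfolding comparable_def n_def[symmetric] s'_def[symmetric] F_def[symmetric]
        proof (intro conjI allI)
          fix z
          define w where "w = restrict (\<lambda>b. min (count s n (z + b) \<omega>) L) F"
          have wP: "w \<in> P" unfolding w_def P_def by (auto simp: PiE_iff)
          have "\<forall>b\<in>F. w b \<le> count s n (z + b) \<omega>" unfolding w_def by simp
          then have nR: "\<not> (1 + \<eta>) * l < R w" using G wP unfolding good_def by auto
          \<comment> \<open>The cut-off never acts: a single count L has rate at least L > (1 +
            \<eta>) ln t, which is excluded.\<close>
          have wc: "w b = count s n (z + b) \<omega>" if b: "b \<in> F" for b
          proof (rule ccontr)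
            assume "w b \<noteq> count s n (z + b) \<omega>"
            then have wL: "w b = L" using b unfolding w_def by auto
            have "2 \<le> ln (real L / \<mu>)"
            proof -
              have "exp 2 \<le> real L / \<mu>" using LK \<mu>0 by (simp add: field_simps)
              then have "ln (exp 2) \<le> ln (real L / \<mu>)" by (subst ln_le_cancel_iff) (use Lpos \<mu>0 in auto)
              then show ?thesis by simp
            qed
            then have "real L * 2 \<le> real L * ln (real L / \<mu>)" by (intro mult_left_mono) auto
            moreover have "max (real L) \<mu> = real L" using L\<mu> by simp
            ultimately have "real L \<le> rate (real (w b)) \<mu>" unfolding wL rate_def using \<mu>0 by simp
            also have "\<dots> \<le> R w" unfolding R_def using finF b rate0 by (intro member_le_sum) auto
            finally have "real L \<le> R w" .
            moreover have "(1 + \<eta>) * l < cL * l" using cL l1 by (intro mult_strict_right_mono) auto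
            ultimately show False using nR L by linarith
          qed
          have "good w \<omega>" using G wP by blast
          then obtain z' where z': "\<forall>b\<in>F. count s' t (z' + b) \<omega> = sc w b" using nR unfolding good_def by auto
          show "\<exists>z'. \<forall>o'\<in>F. real (count s n (z + o') \<omega>) \<le> (real (count s' t (z' + o') \<omega>) + 1) / a'"
          proof (intro exI[of _ z'] ballI)
            fix b assume b: "b \<in> F"
            have "a * real (w b) \<le> a * max (real (w b)) \<mu>" using a0 by (intro mult_left_mono) auto
            also have "\<dots> \<le> real (sc w b) + 1" unfolding sc_def by linarith
            finally have "real (w b) \<le> (real (sc w b) + 1) / a" using a0 by (simp add: field_simps)
            also have "\<dots> \<le> (real (sc w b) + 1) / a'" using a' by (intro divide_left_mono) auto
            finally show "real (count s n (z + b) \<omega>) \<le> (real (count s' t (z' + b) \<omega>) + 1) / a'" using z' b wc by simp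
          qed
        next
          \<comment> \<open>The profile of \<Omega>1 points in one cell and none elsewhere stays
            below the rate threshold by the choice of \<alpha>; its scaled copy is the required
            crowded cell.\<close>
          define w where "w = restrict (\<lambda>b. if b = 0 then \<Omega>1 else 0) F"
          have \<Omega>l: "real \<Omega>1 * ln (real \<Omega>1) + 1 + real \<Omega>1 \<le> 1 / 2 * l" using elim(5) unfolding l_def .
          have \<Omega>ln: "0 \<le> real \<Omega>1 * ln (real \<Omega>1)" using \<Omega>1 by (intro mult_nonneg_nonneg) auto
          have "real \<Omega>1 \<le> cL * l" 
          proof -
            have "1 * l \<le> cL * l" using cL l1 by (intro mult_right_mono) auto
            then show ?thesis using \<Omega>l \<Omega>ln l1 by linarith
          qed
          then have "\<Omega>1 \<le> L" using L by linarith
          then have wP: "w \<in> P" unfolding w_def P_def by (auto simp: PiE_iff)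
          have "R w = rate (real \<Omega>1) \<mu>"
          proof -
            have "R w = (\<Sum>b\<in>F. if b = 0 then rate (real \<Omega>1) \<mu> else 0)"
              unfolding R_def w_def using \<mu>0 by (intro sum.cong) (auto simp: rate_def max_def)
            then show ?thesis using finF F0 by simp
          qed
          also have "\<dots> \<le> (1 + \<eta>) * l"
          proof (cases "real \<Omega>1 \<le> \<mu>")
            case True
            then have "rate (real \<Omega>1) \<mu> = 0" unfolding rate_def using \<mu>0 by (simp add: max_def)
            then show ?thesis using \<eta>0 l1 by simp
          next
            case False
            have "- \<alpha> * l \<le> ln \<mu>"
            proof -
              have "ln (real t powr (-\<alpha>)) \<le> ln \<mu>" using \<mu>(1) \<mu>0 t0 by (subst ln_le_cancel_iff) auto
              then show ?thesis unfolding l_def using t0 by (simp add: ln_powr)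
            qed
            then have "real \<Omega>1 * (- \<alpha> * l) \<le> real \<Omega>1 * ln \<mu>" by (intro mult_left_mono) auto
            moreover have "real \<Omega>1 * \<alpha> * l \<le> 1 / 2 * l"
            proof (rule mult_right_mono)
              have "real \<Omega>1 * \<alpha> \<le> real \<Omega>1 * (1 / (2 * real \<Omega>1))" using \<alpha> by (intro mult_left_mono) auto
              then show "real \<Omega>1 * \<alpha> \<le> 1 / 2" using \<Omega>1 by simp
            qed (use l1 in simp)
            moreover have "rate (real \<Omega>1) \<mu> = real \<Omega>1 * ln (real \<Omega>1) - real \<Omega>1 * ln \<mu> - real \<Omega>1 + \<mu>"
              unfolding rate_def using False \<mu>0 \<Omega>1 by (simp add: max_def ln_div right_diff_distrib)
            ultimately have "rate (real \<Omega>1) \<mu> \<le> l" using \<Omega>l False by (simp add: algebra_simps)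
            also have "\<dots> \<le> (1 + \<eta>) * l" using \<eta>0 l1 by (simp add: distrib_right)
            finally show ?thesis .
          qed
          finally have nR: "\<not> (1 + \<eta>) * l < R w" by simp
          have "good w \<omega>" using G wP by blast
          then obtain z' where z': "\<forall>b\<in>F. count s' t (z' + b) \<omega> = sc w b" using nR unfolding good_def by auto
          have "real \<Omega> + 1 \<le> a * max (real (w 0)) \<mu>"
          proof -
            have "real \<Omega> + 1 \<le> a * real \<Omega>1" using \<Omega>1(1) a0 by (simp add: field_simps)
            also have "\<dots> \<le> a * max (real (w 0)) \<mu>" unfolding w_def using F0 a0 by (intro mult_left_mono) auto
            finally show ?thesis .
          qed
          then have "\<Omega> \<le> sc w 0" unfolding sc_def by linarith
          then show "\<exists>z. \<Omega> \<le> count s' t z \<omega>" using z' F0 by (intro exI[of _ z']) auto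
        qed
      qed
      qed
    qed
  qed (use \<alpha> \<kappa> cs in auto)
qed

text \<open>The tilt is constant on F, equal to the Chernoff optimum ln (k / (v \<mu>)) for a count
  of mean v \<mu> to reach k, where v = card F. The factor exp h in the tilted bound turns \<mu>^k
  into \<mu>^(k - 1), so the bound has the order t \<mu>^(k - 1) of the expected number of
  clusters.\<close>

lemma sparse_counts_bound:
  assumes \<rho>: "1 \<le> \<rho>" and s: "0 < s" and t: "0 < t" and F: "finite F" "F \<noteq> {}" and k: "0 < k"
    and \<mu>: "\<mu> = \<rho> * real t * (\<sigma> * s ^ CARD('d))" "real (card F) * \<mu> \<le> 1"
  shows "except (\<rho> * (exp 1 * real (card F)) ^ k * (real t * \<mu> ^ (k - 1)))
    (\<lambda>\<omega>. \<forall>z. (\<Sum>b\<in>F. count s (nat \<lfloor>\<rho> * real t\<rfloor>) (z + b) \<omega>) < k)"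
proof -
  define v where "v = real (card F)"
  have v1: "1 \<le> v" unfolding v_def using F by (simp add: Suc_leI card_gt_0_iff)
  have t0: "0 < real t" using t by simp
  have \<mu>0: "0 < \<mu>" unfolding \<mu> using \<rho> t0 \<sigma>(1) s by simp
  define n where "n = nat \<lfloor>\<rho> * real t\<rfloor>"
  have n: "real n \<le> \<rho> * real t" unfolding n_def using \<rho> t0 by simp
  have k1: "1 \<le> real k" using k by simp
  have vm: "0 < v * \<mu>" "v * \<mu> \<le> real k" using v1 \<mu>0 \<mu>(2) k1 unfolding v_def by auto
  define h where "h = ln (real k / (v * \<mu>))"
  have h0: "0 \<le> h" unfolding h_def using vm by (intro ln_ge_zero) (simp add: field_simps)
  have eh: "exp h = real k / (v * \<mu>)" unfolding h_def using vm k1 by (intro exp_ln) auto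
  have tb: "except (real n * real (card F) * exp h * exp (real n * (\<sigma> * s ^ CARD('d)) * (\<Sum>b\<in>F. exp h - 1) - h * real k))
     (\<lambda>\<omega>. \<forall>z. (\<exists>b\<in>F. 0 < count s n (z + b) \<omega>) \<longrightarrow> (\<Sum>b\<in>F. h * real (count s n (z + b) \<omega>)) < h * real k)"
    by (rule count_tilted_bound) (use F h0 mass_le s in auto)
  show ?thesis unfolding n_def[symmetric]
  proof (rule except_mono[OF tb])
    have nq: "real n * (\<sigma> * s ^ CARD('d)) \<le> \<mu>" unfolding \<mu> using n \<sigma>(1) s by (intro mult_right_mono) auto
    have "real n * (\<sigma> * s ^ CARD('d)) * (\<Sum>b\<in>F. exp h - 1) \<le> \<mu> * (\<Sum>b\<in>F. exp h - 1)"
      using nq h0 by (intro mult_right_mono sum_nonneg) auto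
    also have "\<dots> = \<mu> * v * exp h - \<mu> * v" unfolding v_def by (simp add: right_diff_distrib)
    also have "\<mu> * v * exp h = real k" unfolding eh using v1 \<mu>0 by (simp add: field_simps)
    also have "real k - \<mu> * v \<le> real k" using vm by (simp add: mult.commute)
    finally have "exp (real n * (\<sigma> * s ^ CARD('d)) * (\<Sum>b\<in>F. exp h - 1) - h * real k) \<le> exp (real k - h * real k)" by simp
    also have "\<dots> = exp 1 ^ k / exp h ^ k" by (simp add: exp_diff exp_of_nat_mult[symmetric] mult.commute)
    finally have ee: "exp (real n * (\<sigma> * s ^ CARD('d)) * (\<Sum>b\<in>F. exp h - 1) - h * real k) \<le> exp 1 ^ k / exp h ^ k" .
    have "real n * real (card F) * exp h * exp (real n * (\<sigma> * s ^ CARD('d)) * (\<Sum>b\<in>F. exp h - 1) - h * real k)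
       \<le> (\<rho> * real t) * v * exp h * (exp 1 ^ k / exp h ^ k)"
      unfolding v_def[symmetric] using n \<rho> v1 by (intro mult_mono[OF _ ee] mult_mono mult_nonneg_nonneg) auto
    also have "exp h ^ k = exp h * exp h ^ (k - 1)" using k by (cases k) auto
    also have "(\<rho> * real t) * v * exp h * (exp 1 ^ k / (exp h * exp h ^ (k - 1))) = \<rho> * real t * v * exp 1 ^ k * (1 / exp h) ^ (k - 1)"
      by (simp add: power_divide)
    also have "\<dots> \<le> \<rho> * real t * v * exp 1 ^ k * (v * \<mu>) ^ (k - 1)"
    proof -
      have "1 / exp h \<le> v * \<mu>" unfolding eh using vm k1 mult_left_mono[OF k1, of "v * \<mu>"] by (simp add: divide_le_eq)
      then show ?thesis using \<rho> v1 by (intro mult_left_mono power_mono) auto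
    qed
    also have "\<dots> = \<rho> * (exp 1 * v) ^ k * (real t * \<mu> ^ (k - 1))"
    proof -
      have "v ^ k = v * v ^ (k - 1)" using k by (cases k) auto
      then show ?thesis by (simp add: power_mult_distrib)
    qed
    finally show "real n * real (card F) * exp h * exp (real n * (\<sigma> * s ^ CARD('d)) * (\<Sum>b\<in>F. exp h - 1) - h * real k)
       \<le> \<rho> * (exp 1 * real (card F)) ^ k * (real t * \<mu> ^ (k - 1))" unfolding v_def .
  next
    fix \<omega> assume H: "\<forall>z. (\<exists>b\<in>F. 0 < count s n (z + b) \<omega>) \<longrightarrow> (\<Sum>b\<in>F. h * real (count s n (z + b) \<omega>)) < h * real k"
    show "\<forall>z. (\<Sum>b\<in>F. count s n (z + b) \<omega>) < k"
    proof
      fix z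
      show "(\<Sum>b\<in>F. count s n (z + b) \<omega>) < k"
      proof (cases "\<exists>b\<in>F. 0 < count s n (z + b) \<omega>")
        case True
        then have "h * real (\<Sum>b\<in>F. count s n (z + b) \<omega>) < h * real k"
          using H[rule_format, of z] by (simp add: sum_distrib_left)
        then have "real (\<Sum>b\<in>F. count s n (z + b) \<omega>) < real k" using h0 by (simp only: mult_less_cancel_left)
        then show ?thesis by (simp only: of_nat_less_iff)
      next
        case False
        then have "(\<Sum>b\<in>F. count s n (z + b) \<omega>) = 0" by auto
        then show ?thesis using k by simp
      qed
    qed
  qed
qed

text \<open>A k-set within bounded distance has expected number of order t \<mu>^(k-1). Since \<mu> is a
  negative power of t, at the smallest k for which this is a negative power of t there are already
  many cliques of size k - 2.\<close>
lemma sparse_regime: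
  assumes \<rho>: "1 \<le> \<rho>" and \<tau>: "0 < \<tau>" "\<tau> \<le> 1" and \<alpha>: "0 < \<alpha>" and F: "finite F" "F \<noteq> {}"
  obtains \<kappa> s0 where "0 < \<kappa>" "0 < s0"
    "eventually (\<lambda>t. \<forall>s. 0 < s \<longrightarrow> s < s0 \<longrightarrow> \<rho> * real t * (\<sigma> * s ^ CARD('d)) \<le> real t powr (-\<alpha>) \<longrightarrow>
      (\<exists>j\<ge>1. except (real t powr (-\<kappa>)) (\<lambda>\<omega>. (\<forall>z. (\<Sum>b\<in>F. count s (nat \<lfloor>\<rho> * real t\<rfloor>) (z + b) \<omega>) \<le> j + 1) \<and>
         (j = 1 \<or> (\<exists>z. j \<le> count (\<tau> * s) t z \<omega>))))) sequentially"
proof -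
  define a where "a = \<tau> ^ CARD('d) / \<rho>"
  have a0: "0 < a" "a \<le> 1"
  proof -
    show "0 < a" unfolding a_def using \<tau> \<rho> by simp
    have "\<tau> ^ CARD('d) \<le> 1" using \<tau> by (intro power_le_one) auto
    then show "a \<le> 1" unfolding a_def using \<rho> by (simp add: divide_le_eq)
  qed
  \<comment> \<open>So large that t \<mu>^(km - 1) is a negative power of t for every \<mu> \<le>
    t^(-\<alpha>). The least k below is thus bounded independently of t and s, and so are all
    constants depending on it.\<close>
  define km where "km = nat \<lceil>(1 + \<alpha>) / \<alpha>\<rceil> + 3"
  have km: "1 + \<alpha> \<le> \<alpha> * (real km - 1)" "3 \<le> km"
  proof -
    have "(1 + \<alpha>) / \<alpha> \<le> real km - 1" unfolding km_def by linarith
    then show "1 + \<alpha> \<le> \<alpha> * (real km - 1)" using \<alpha> by (simp add: field_simps)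
    show "3 \<le> km" unfolding km_def by simp
  qed
  obtain c s0 where cs: "0 < c" "0 < s0" "\<And>s. 0 < s \<Longrightarrow> s < s0 \<Longrightarrow> \<exists>Z. dense_boxes (1/2) 1 c s Z"
    using ex_dense_boxes[of "1/2" 1] by auto
  define v where "v = real (card F)"
  have v1: "1 \<le> v" unfolding v_def using F by (simp add: Suc_leI card_gt_0_iff)
  define C1 where "C1 = \<rho> * (exp 1 * v) ^ km"
  define cm where "cm = 1 / 4 * (1 / 2) ^ km * (exp (-1) / fact km) * a ^ km"
  have cm0: "0 < cm" unfolding cm_def using a0 by simp
  define C2 where "C2 = 1 / (c * \<sigma> * cm)"
  have C20: "0 < C2" unfolding C2_def using cs cm0 \<sigma> by simp
  define \<kappa> where "\<kappa> = min (\<alpha> / 4) (1 / 2)"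
  have \<kappa>: "0 < \<kappa>" "\<kappa> \<le> \<alpha> / 4" "\<kappa> \<le> 1 / 2" using \<alpha> by (simp_all add: \<kappa>_def min_def)
  show thesis
  proof (rule that[of \<kappa> s0])
    have ev1: "eventually (\<lambda>t::nat. v * real t powr (-\<alpha>) \<le> 1) sequentially" using \<alpha> by real_asymp
    have ev2: "eventually (\<lambda>t::nat. (C1 + C2) * real t powr (- (\<alpha> / 2)) + 4 * (real km + 1)\<^sup>2 / real t \<le> real t powr (-\<kappa>)) sequentially"
    proof -
      have "eventually (\<lambda>t::nat. 2 * (C1 + C2) * ln (real t) ^ 0 \<le> real t powr (\<alpha> / 4)) sequentially"
        by (rule eventually_polylog_le_powr) (use \<alpha> in simp)
      moreover have "eventually (\<lambda>t::nat. 8 * (real km + 1)\<^sup>2 * ln (real t) ^ 0 \<le> real t powr (1 / 2)) sequentially"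
        by (rule eventually_polylog_le_powr) simp
      moreover have "eventually (\<lambda>t::nat. 1 \<le> t) sequentially" by (rule eventually_ge_at_top)
      ultimately show ?thesis
      proof eventually_elim
        case (elim t)
        have t: "1 \<le> real t" using elim(3) by simp
        have "2 * (C1 + C2) * real t powr (- (\<alpha> / 2)) \<le> real t powr (\<alpha> / 4) * real t powr (- (\<alpha> / 2))"
          using elim(1) by (intro mult_right_mono) auto
        also have "\<dots> = real t powr (- (\<alpha> / 4))" unfolding powr_add[symmetric] by simp
        also have "\<dots> \<le> real t powr (-\<kappa>)" using t \<kappa> by (intro powr_mono) auto
        finally have 1: "2 * (C1 + C2) * real t powr (- (\<alpha> / 2)) \<le> real t powr (-\<kappa>)" .
        have "8 * (real km + 1)\<^sup>2 * real t powr (-1) \<le> real t powr (1 / 2) * real t powr (-1)"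
          using elim(2) by (intro mult_right_mono) auto
        also have "\<dots> = real t powr (- (1 / 2))" unfolding powr_add[symmetric] by simp
        also have "\<dots> \<le> real t powr (-\<kappa>)" using t \<kappa> by (intro powr_mono) auto
        finally have 2: "8 * (real km + 1)\<^sup>2 / real t \<le> real t powr (-\<kappa>)" using t by (simp add: powr_minus_divide)
        show ?case using 1 2 by (simp add: field_simps)
      qed
    qed
    have ev3: "eventually (\<lambda>t::nat. 4 * (real km + 1)\<^sup>2 \<le> real t) sequentially" by real_asymp
    have ev4: "eventually (\<lambda>t::nat. 1 \<le> t) sequentially" by (rule eventually_ge_at_top)
    show "eventually (\<lambda>t. \<forall>s. 0 < s \<longrightarrow> s < s0 \<longrightarrow> \<rho> * real t * (\<sigma> * s ^ CARD('d)) \<le> real t powr (-\<alpha>) \<longrightarrow>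
      (\<exists>j\<ge>1. except (real t powr (-\<kappa>)) (\<lambda>\<omega>. (\<forall>z. (\<Sum>b\<in>F. count s (nat \<lfloor>\<rho> * real t\<rfloor>) (z + b) \<omega>) \<le> j + 1) \<and>
         (j = 1 \<or> (\<exists>z. j \<le> count (\<tau> * s) t z \<omega>))))) sequentially"
      using ev1 ev2 ev3 ev4
    proof eventually_elim
      case (elim t)
      show ?case
      proof (intro allI impI)
      fix s :: real assume s: "0 < s" "s < s0" and sm: "\<rho> * real t * (\<sigma> * s ^ CARD('d)) \<le> real t powr (-\<alpha>)"
      have t: "1 \<le> real t" "0 < real t" using elim(4) by auto
      define \<mu> where "\<mu> = \<rho> * real t * (\<sigma> * s ^ CARD('d))"
      have \<mu>0: "0 < \<mu>" unfolding \<mu>_def using \<rho> t \<sigma>(1) s by simp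
      have \<mu>: "\<mu> \<le> real t powr (-\<alpha>)" using sm unfolding \<mu>_def .
      have v\<mu>: "v * \<mu> \<le> 1"
      proof -
        have "v * \<mu> \<le> v * real t powr (-\<alpha>)" using \<mu> v1 by (intro mult_left_mono) auto
        then show ?thesis using elim(1) by linarith
      qed
      have \<mu>1: "\<mu> \<le> 1"
      proof -
        have "1 * \<mu> \<le> v * \<mu>" using v1 \<mu>0 by (intro mult_right_mono) auto
        then show ?thesis using v\<mu> by linarith
      qed
      \<comment> \<open>The bound 3 \<le> k ensures j = k - 2 \<ge> 1. For k = 3 no clique has to be
        found, as j = 1 is always available.\<close>
      define Q where "Q k \<longleftrightarrow> 3 \<le> k \<and> real t * \<mu> ^ (k - 1) \<le> real t powr (- (\<alpha> / 2))" for k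
      have "Q km"
      proof -
        have "real t * \<mu> ^ (km - 1) \<le> real t powr 1 * (real t powr (-\<alpha>)) ^ (km - 1)"
          using \<mu> \<mu>0 t by (intro mult_mono power_mono) auto
        also have "\<dots> = real t powr (1 - \<alpha> * (real km - 1))"
        proof -
          have "(real t powr (-\<alpha>)) ^ (km - 1) = real t powr (-\<alpha> * real (km - 1))"
            using t by (simp add: powr_realpow[symmetric] powr_powr)
          also have "real (km - 1) = real km - 1" using km by (simp add: of_nat_diff)
          finally have e: "(real t powr (-\<alpha>)) ^ (km - 1) = real t powr (- \<alpha> * (real km - 1))" .
          show ?thesis unfolding e powr_add[symmetric] by simp
        qed
        also have "\<dots> \<le> real t powr (- (\<alpha> / 2))" using t km \<alpha> by (intro powr_mono) auto
        finally show ?thesis unfolding Q_def using km by simp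
      qed
      define k where "k = (LEAST k. Q k)"
      have Qk: "Q k" unfolding k_def using \<open>Q km\<close> by (rule LeastI)
      have kkm: "k \<le> km" unfolding k_def using \<open>Q km\<close> by (rule Least_le)
      have k3: "3 \<le> k" using Qk unfolding Q_def by simp
      have up: "except (C1 * real t powr (- (\<alpha> / 2))) (\<lambda>\<omega>. \<forall>z. (\<Sum>b\<in>F. count s (nat \<lfloor>\<rho> * real t\<rfloor>) (z + b) \<omega>) < k)"
      proof (rule except_mono[OF sparse_counts_bound[OF \<rho> s(1) _ F _ \<mu>_def]])
        show "0 < t" "0 < k" using elim(4) k3 by auto
        show "real (card F) * \<mu> \<le> 1" using v\<mu> unfolding v_def .
        have "\<rho> * (exp 1 * v) ^ k * (real t * \<mu> ^ (k - 1)) \<le> \<rho> * (exp 1 * v) ^ km * real t powr (- (\<alpha> / 2))"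
        proof (intro mult_mono)
          have "1 * 1 \<le> exp 1 * v" using v1 by (intro mult_mono) auto
          then show "(exp 1 * v) ^ k \<le> (exp 1 * v) ^ km" using kkm by (intro power_increasing) auto
          show "real t * \<mu> ^ (k - 1) \<le> real t powr (- (\<alpha> / 2))" using Qk unfolding Q_def by simp
        qed (use \<rho> v1 \<mu>0 in auto)
        then show "\<rho> * (exp 1 * real (card F)) ^ k * (real t * \<mu> ^ (k - 1)) \<le> C1 * real t powr (- (\<alpha> / 2))"
          unfolding C1_def v_def .
      qed simp
      have up': "except (C1 * real t powr (- (\<alpha> / 2))) (\<lambda>\<omega>. \<forall>z. (\<Sum>b\<in>F. count s (nat \<lfloor>\<rho> * real t\<rfloor>) (z + b) \<omega>) \<le> (k - 2) + 1)"
      proof (rule except_mono[OF up order_refl], intro allI)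
        fix \<omega> z assume "\<forall>z. (\<Sum>b\<in>F. count s (nat \<lfloor>\<rho> * real t\<rfloor>) (z + b) \<omega>) < k"
        then have "(\<Sum>b\<in>F. count s (nat \<lfloor>\<rho> * real t\<rfloor>) (z + b) \<omega>) < k" by blast
        then show "(\<Sum>b\<in>F. count s (nat \<lfloor>\<rho> * real t\<rfloor>) (z + b) \<omega>) \<le> (k - 2) + 1" using k3 by linarith
      qed
      have C2p: "0 \<le> C2 * real t powr (- (\<alpha> / 2))" "0 \<le> 4 * (real km + 1)\<^sup>2 / real t" using C20 by auto
      show "\<exists>j\<ge>1. except (real t powr (-\<kappa>)) (\<lambda>\<omega>. (\<forall>z. (\<Sum>b\<in>F. count s (nat \<lfloor>\<rho> * real t\<rfloor>) (z + b) \<omega>) \<le> j + 1) \<and>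
         (j = 1 \<or> (\<exists>z. j \<le> count (\<tau> * s) t z \<omega>)))"
      proof (cases "k = 3")
        case True
        show ?thesis
        proof (intro exI[of _ 1] conjI)
          show "except (real t powr (-\<kappa>)) (\<lambda>\<omega>. (\<forall>z. (\<Sum>b\<in>F. count s (nat \<lfloor>\<rho> * real t\<rfloor>) (z + b) \<omega>) \<le> 1 + 1) \<and>
             (1 = 1 \<or> (\<exists>z. 1 \<le> count (\<tau> * s) t z \<omega>)))"
          proof (rule except_mono[OF up'])
            show "C1 * real t powr (- (\<alpha> / 2)) \<le> real t powr (-\<kappa>)"
              using elim(2) C2p unfolding distrib_right by linarith
          qed (use True in auto)
        qed simp
      next
        case False
        then have k4: "4 \<le> k" using k3 by simp
        define j where "j = k - 2"
        have j2: "2 \<le> j" "j \<le> km" unfolding j_def using k4 kkm by auto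
        have "\<not> Q (k - 1)" unfolding k_def using not_less_Least k4 by (metis Suc_1 diff_less k_def less_le_trans numeral_2_eq_2 pos2 zero_less_one zero_less_numeral)
        then have tk: "real t powr (- (\<alpha> / 2)) < real t * \<mu> ^ j"
          unfolding Q_def j_def using k4 by (auto simp: numeral_2_eq_2)
        \<comment> \<open>Minimality of k gives t \<mu>^j > t^(-\<alpha> / 2) for j = k - 2.
          Dividing by \<mu> \<le> t^(-\<alpha>) makes t \<mu>^(j - 1), the order of the expected
          number of cells with j points, at least t^(\<alpha> / 2). The two steps from k to j are
          the price of this gain.\<close>
        have tj: "real t powr (\<alpha> / 2) \<le> real t * \<mu> ^ (j - 1)"
        proof -
          have "real t powr (\<alpha> / 2) * real t powr (-\<alpha>) = real t powr (- (\<alpha> / 2))" unfolding powr_add[symmetric] by simp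
          also have "\<dots> \<le> real t * \<mu> ^ j" using tk by simp
          also have "\<mu> ^ j = \<mu> ^ (j - 1) * \<mu>" using j2 by (cases j) auto
          also have "real t * (\<mu> ^ (j - 1) * \<mu>) \<le> real t * \<mu> ^ (j - 1) * real t powr (-\<alpha>)"
            using \<mu> \<mu>0 unfolding mult.assoc[symmetric] by (intro mult_left_mono) auto
          finally show ?thesis using t by simp
        qed
        define s' where "s' = \<tau> * s"
        have s': "0 < s'" "s' < s0"
        proof -
          show "0 < s'" unfolding s'_def using \<tau> s by simp
          have "\<tau> * s \<le> 1 * s" using \<tau> s by (intro mult_right_mono) auto
          then show "s' < s0" unfolding s'_def using s by linarith
        qed
        have \<mu>': "a * \<mu> = real t * (\<sigma> * s' ^ CARD('d))"
          unfolding s'_def \<mu>_def a_def using \<rho> by (simp add: power_mult_distrib)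
        have a\<mu>: "0 < a * \<mu>" "a * \<mu> \<le> 1" using a0 \<mu>0 \<mu>1 mult_mono[of a 1 \<mu> 1] by auto
        obtain Z where Z: "dense_boxes (1/2) 1 c s' Z" using cs(3)[OF s'] by blast
        \<comment> \<open>The Poisson weight of j points in one cell, with its constants replaced by
          bounds valid for all j \<le> km.\<close>
        define pr where "pr = 1 / 4 * (1 / 2) ^ km * (exp (-1) / fact km) * (a * \<mu>) ^ j"
        have pr0: "0 < pr" unfolding pr_def using a\<mu> by simp
        have low: "except (a * \<mu> / (c * \<sigma> * real t * pr) + 4 * (real km + 1)\<^sup>2 / real t) (\<lambda>\<omega>. \<exists>z\<in>Z. \<forall>b\<in>{0}. count s' t (z + b) \<omega> = j)"
        proof (rule dense_box_with_counts[OF Z cs(1) s'(1) _ _ _ _ _ _ \<mu>' _ _ _ elim(3) pr0])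
          show "{0} \<subseteq> cube 1" by (simp add: cube_def)
          show "j = (\<Sum>b\<in>{0 :: int^'d}. j)" by simp
          show "0 < t" using elim(4) by simp
          show "real j \<le> real km + 1" using j2 by simp
          show "real (card {0 :: int^'d}) * (a * \<mu>) \<le> real km + 1" using a\<mu> by simp
          have "(1 / 2) ^ km * (exp (-1) / fact km) \<le> (1 / 2 :: real) ^ j * (exp (- (a * \<mu>)) / fact j)"
            using j2 a\<mu> by (intro mult_mono power_decreasing frac_le) (auto simp: fact_mono)
          then have "1 / 4 * ((1 / 2) ^ km * (exp (-1) / fact km)) * (a * \<mu>) ^ j \<le> 1 / 4 * ((1 / 2 :: real) ^ j * (exp (- (a * \<mu>)) / fact j)) * (a * \<mu>) ^ j"
            using a\<mu> by (intro mult_right_mono mult_left_mono) auto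
          then show "pr \<le> 1 / 4 * (1 - 1 / 2) ^ j * (\<Prod>b\<in>{0 :: int^'d}. exp (- (a * \<mu>)) * (a * \<mu>) ^ j / fact j)"
            unfolding pr_def by (simp add: mult_ac)
        qed auto
        have bound: "a * \<mu> / (c * \<sigma> * real t * pr) \<le> C2 * real t powr (- (\<alpha> / 2))"
        proof -
          have "cm * (a * \<mu>) * \<mu> ^ (j - 1) \<le> pr"
          proof -
            have "a ^ km \<le> a ^ (j - 1)" using a0 j2 by (intro power_decreasing) auto
            then have "1 / 4 * (1 / 2) ^ km * (exp (-1) / fact km) * (a ^ km * (a * \<mu>) * \<mu> ^ (j - 1)) \<le>
               1 / 4 * (1 / 2) ^ km * (exp (-1) / fact km) * (a ^ (j - 1) * (a * \<mu>) * \<mu> ^ (j - 1))"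
              using a\<mu> \<mu>0 by (intro mult_left_mono mult_right_mono) auto
            also have "a ^ (j - 1) * (a * \<mu>) * \<mu> ^ (j - 1) = (a * \<mu>) ^ j"
              using j2 by (cases j) (auto simp: power_mult_distrib)
            finally show ?thesis unfolding cm_def pr_def by (simp add: mult.assoc)
          qed
          then have "c * \<sigma> * real t * (cm * (a * \<mu>) * \<mu> ^ (j - 1)) \<le> c * \<sigma> * real t * pr"
            using cs \<sigma>(1) by (intro mult_left_mono) auto
          then have "a * \<mu> / (c * \<sigma> * real t * pr) \<le> a * \<mu> / (c * \<sigma> * real t * (cm * (a * \<mu>) * \<mu> ^ (j - 1)))"
            using cs \<sigma>(1) cm0 a\<mu> \<mu>0 t pr0 by (intro divide_left_mono) auto
          also have "\<dots> = C2 * (1 / (real t * \<mu> ^ (j - 1)))" unfolding C2_def using a\<mu> a0 \<mu>0 by (simp add: field_simps)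
          also have "\<dots> \<le> C2 * (1 / real t powr (\<alpha> / 2))"
            using tj t C20 \<mu>0 by (intro mult_left_mono divide_left_mono) auto
          also have "\<dots> = C2 * real t powr (- (\<alpha> / 2))" by (simp add: powr_minus_divide)
          finally show ?thesis .
        qed
        show ?thesis
        proof (intro exI[of _ j] conjI)
          show "1 \<le> j" using j2 by simp
          show "except (real t powr (-\<kappa>)) (\<lambda>\<omega>. (\<forall>z. (\<Sum>b\<in>F. count s (nat \<lfloor>\<rho> * real t\<rfloor>) (z + b) \<omega>) \<le> j + 1) \<and>
             (j = 1 \<or> (\<exists>z. j \<le> count (\<tau> * s) t z \<omega>)))"
          proof (rule except_mono[OF except_conj[OF up' low]])
            show "C1 * real t powr (- (\<alpha> / 2)) + (a * \<mu> / (c * \<sigma> * real t * pr) + 4 * (real km + 1)\<^sup>2 / real t) \<le> real t powr (-\<kappa>)"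
              using bound elim(2) by (simp add: distrib_right)
            fix \<omega> assume H: "(\<forall>z. (\<Sum>b\<in>F. count s (nat \<lfloor>\<rho> * real t\<rfloor>) (z + b) \<omega>) \<le> (k - 2) + 1) \<and>
              (\<exists>z\<in>Z. \<forall>b\<in>{0}. count s' t (z + b) \<omega> = j)"
            then obtain z where "count s' t z \<omega> = j" by auto
            then have "\<exists>z. j \<le> count (\<tau> * s) t z \<omega>" unfolding s'_def by (intro exI[of _ z]) simp
            then show "(\<forall>z. (\<Sum>b\<in>F. count s (nat \<lfloor>\<rho> * real t\<rfloor>) (z + b) \<omega>) \<le> j + 1) \<and>
              (j = 1 \<or> (\<exists>z. j \<le> count (\<tau> * s) t z \<omega>))" using H unfolding j_def by blast
          qed
        qed
      qed
      qed
    qed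
  qed (use \<kappa> cs in auto)
qed

end

section \<open>From cell counts to colourings\<close>

lemma is_norm_diff_commute:
  assumes "is_norm N"
  shows "N (x - y) = N (y - x)"
proof -
  have "N ((-1) *\<^sub>R (y - x)) = \<bar>-1\<bar> * N (y - x)" using assms unfolding is_norm_def by blast
  then show ?thesis by simp
qed

lemma finite_cell_adj:
  fixes N :: "real^'d \<Rightarrow> real"
  assumes \<beta>: "\<And>x i. \<bar>x $ i\<bar> \<le> \<beta> * N x" and "\<beta> > 0"
  shows "finite {e. cell_adj N \<epsilon> e}"
proof -
  define b where "b = nat \<lceil>\<beta> / \<epsilon> + 1\<rceil>"
  define w where "w = (\<chi> i. int b :: int^'d)"
  have "(\<lambda>e. e + w) ` {e. cell_adj N \<epsilon> e} \<subseteq> cube (2 * b + 1)"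
  proof
    fix y assume "y \<in> (\<lambda>e. e + w) ` {e. cell_adj N \<epsilon> e}"
    then obtain e where e: "y = e + w" "cell_adj N \<epsilon> e" by auto
    have "\<bar>e $ i\<bar> \<le> int b" for i unfolding b_def by (rule cell_adj_bound[OF \<beta> assms(2) e(2)])
    then have "0 \<le> y $ i \<and> y $ i < int (2 * b + 1)" for i
      using abs_le_iff[of "e $ i" "int b"] unfolding e w_def by (simp add: add.commute)
    then show "y \<in> cube (2 * b + 1)" unfolding cube_def by blast
  qed
  then have "finite ((\<lambda>e. e + w) ` {e. cell_adj N \<epsilon> e})" using finite_cube finite_subset by blast
  then show ?thesis by (rule finite_imageD) (auto simp: inj_on_def)
qed

context rgg
begin

abbreviation chi :: "(real^'d \<Rightarrow> real) \<Rightarrow> 'm \<Rightarrow> nat \<Rightarrow> real \<Rightarrow> nat" where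
  "chi N \<omega> n r \<equiv> chromatic_number {1..n} (rgg_adj N (\<lambda>i. X i \<omega>) r)"

abbreviation chi_f :: "(real^'d \<Rightarrow> real) \<Rightarrow> 'm \<Rightarrow> nat \<Rightarrow> real \<Rightarrow> real" where
  "chi_f N \<omega> n r \<equiv> fractional_chromatic_number {1..n} (rgg_adj N (\<lambda>i. X i \<omega>) r)"

text \<open>Points of one fine cell have index difference 0 and are therefore adjacent. This turns
  the crowded cell of \<open>comparable\<close> into a lower bound for every cover, and supplies the
  clique of size j in the sparse regime.\<close>

lemma clique_of_cell:
  assumes N: "is_norm N" and \<beta>: "\<And>x c. (\<And>i. \<bar>x $ i\<bar> \<le> c) \<Longrightarrow> N x \<le> \<beta> * c"
    and \<epsilon>: "0 < \<epsilon>" and s': "0 < s'" "s' * (1 / \<epsilon> + 2 * \<beta>) \<le> r" and tn: "t \<le> n"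
    and T: "fractional_cover {1..n} (rgg_adj N (\<lambda>i. X i \<omega>) r) (\<lambda>_. 1) T"
  shows "real (count s' t z \<omega>) \<le> T"
  unfolding count_def
proof (rule fractional_cover_clique[OF _ _ T])
  show "{i \<in> {1..t}. cell s' (X i \<omega>) = z} \<subseteq> {1..n}" using tn by auto
  fix u v assume uv: "u \<in> {i \<in> {1..t}. cell s' (X i \<omega>) = z}" "v \<in> {i \<in> {1..t}. cell s' (X i \<omega>) = z}" "u \<noteq> v"
  then have "cell_adj N \<epsilon> (cell s' (X u \<omega>) - cell s' (X v \<omega>))" using cell_adj_0[OF N \<epsilon>] by simp
  from close_of_cell_adj[OF N s'(1) _ this] have "N (X u \<omega> - X v \<omega>) \<le> s' * (1 / \<epsilon> + 2 * \<beta>)"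
    using \<beta> by blast
  then show "rgg_adj N (\<lambda>i. X i \<omega>) r u v" unfolding rgg_adj_def using uv s'(2) by auto
qed simp

text \<open>A cover of the graph projects onto the weighted cell graph of any fine box. Enlarged by
  the factor 1 / a', it covers the matching coarse box, and
  \<open>chromatic_number_le_box_cover\<close> rounds the coarse covers to a colouring of the same
  graph.\<close>

lemma comparable_chromatic_bound:
  assumes N: "is_norm N" and \<beta>: "\<beta> > 0" "\<And>x i. \<bar>x $ i\<bar> \<le> \<beta> * N x" "\<And>x c. (\<And>i. \<bar>x $ i\<bar> \<le> c) \<Longrightarrow> N x \<le> \<beta> * c"
    and \<epsilon>: "0 < \<epsilon>" and K: "nat \<lceil>\<beta> / \<epsilon> + 1\<rceil> < K" and a': "0 < a'"
    and s: "0 < s" "0 < s'" "s' = \<tau> * s" "r' \<le> s / \<epsilon>" "s' * (1 / \<epsilon> + 2 * \<beta>) \<le> r'"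
    and n: "t \<le> n" "n \<le> nat \<lfloor>\<rho> * real t\<rfloor>"
    and cmp: "comparable K \<rho> \<tau> a' \<Omega> s t \<omega>"
    and T: "fractional_cover {1..n} (rgg_adj N (\<lambda>i. X i \<omega>) r') (\<lambda>_. 1) T"
  shows "real (chi N \<omega> n r') \<le> real K ^ CARD('d) * ((T + real K ^ CARD('d)) / a' / real (K - nat \<lceil>\<beta> / \<epsilon> + 1\<rceil>) ^ CARD('d) + 2 * 2 ^ (K ^ CARD('d)))"
    and "real \<Omega> \<le> T"
proof -
  let ?E = "rgg_adj N (\<lambda>i. X i \<omega>) r'"
  define b where "b = nat \<lceil>\<beta> / \<epsilon> + 1\<rceil>"
  show "real (chi N \<omega> n r') \<le> real K ^ CARD('d) * ((T + real K ^ CARD('d)) / a' / real (K - nat \<lceil>\<beta> / \<epsilon> + 1\<rceil>) ^ CARD('d) + 2 * 2 ^ (K ^ CARD('d)))"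
    unfolding b_def[symmetric]
  proof (rule chromatic_number_le_box_cover[where c = "\<lambda>i. cell s (X i \<omega>)" and R = "cell_adj N \<epsilon>"])
    show "finite {1..n}" by simp
    show "b < K" unfolding b_def by fact
    show "cell_adj N \<epsilon> (cell s (X u \<omega>) - cell s (X v \<omega>))" if "?E u v" for u v
      using that s(4) unfolding rgg_adj_def by (intro cell_adj_of_close[OF N s(1) \<epsilon>]) auto
    show "\<bar>e $ i\<bar> \<le> int b" if "cell_adj N \<epsilon> e" for e i unfolding b_def by (rule cell_adj_bound[OF \<beta>(2,1) that])
    fix z
    obtain z' where z': "\<forall>p\<in>cube K. real (count s (nat \<lfloor>\<rho> * real t\<rfloor>) (z + p) \<omega>) \<le> (real (count s' t (z' + p) \<omega>) + 1) / a'"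
      using cmp unfolding comparable_def s(3) by blast
    \<comment> \<open>Indices are shifted by z' so that the fine box becomes the standard cube,
      where it is compared cell by cell with the coarse one.\<close>
    have "fractional_cover (cube K) (\<lambda>p q. cell_adj N \<epsilon> (p - q)) (\<lambda>q. card {u\<in>{1..t}. cell s' (X u \<omega>) - z' = q}) T"
    proof (rule fractional_cover_quotient[OF _ _ _ T])
      fix u v assume uv: "u \<noteq> v" "cell s' (X u \<omega>) - z' = cell s' (X v \<omega>) - z' \<or>
          cell_adj N \<epsilon> (cell s' (X u \<omega>) - z' - (cell s' (X v \<omega>) - z'))"
      then have "cell_adj N \<epsilon> (cell s' (X u \<omega>) - cell s' (X v \<omega>))" using cell_adj_0[OF N \<epsilon>] by auto
      from close_of_cell_adj[OF N s(2) _ this] have "N (X u \<omega> - X v \<omega>) \<le> s' * (1 / \<epsilon> + 2 * \<beta>)"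
        using \<beta>(3) by blast
      then show "?E u v" unfolding rgg_adj_def using uv s(5) by auto
    qed (use n finite_cube in auto)
    then have cv: "fractional_cover (cube K) (\<lambda>p q. cell_adj N \<epsilon> (p - q)) (\<lambda>q. real (count s' t (z' + q) \<omega>)) T"
      unfolding count_def by (simp add: diff_eq_eq add.commute)
    have "fractional_cover (cube K) (\<lambda>p q. cell_adj N \<epsilon> (p - q)) (\<lambda>p. card {u \<in> {1..n}. cell s (X u \<omega>) = z + p}) (1 / a' * T + 1 / a' * card (cube K :: (int^'d) set))"
    proof (rule fractional_cover_affine[OF finite_cube cv])
      fix p :: "int^'d" assume p: "p \<in> cube K"
      have "card {u \<in> {1..n}. cell s (X u \<omega>) = z + p} \<le> count s (nat \<lfloor>\<rho> * real t\<rfloor>) (z + p) \<omega>"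
        unfolding count_def using n by (intro card_mono) auto
      then have "real (card {u \<in> {1..n}. cell s (X u \<omega>) = z + p}) \<le> (real (count s' t (z' + p) \<omega>) + 1) / a'"
        using z' p by (meson of_nat_le_iff order_trans)
      then show "real (card {u \<in> {1..n}. cell s (X u \<omega>) = z + p}) \<le> 1 / a' * real (count s' t (z' + p) \<omega>) + 1 / a'"
        by (simp add: add_divide_distrib)
    qed (use a' in auto)
    then show "fractional_cover (cube K) (\<lambda>p q. cell_adj N \<epsilon> (p - q)) (\<lambda>p. card {u \<in> {1..n}. cell s (X u \<omega>) = z + p}) ((T + real K ^ CARD('d)) / a')"
      by (simp add: card_cube add_divide_distrib)
  qed
  obtain z where "\<Omega> \<le> count s' t z \<omega>" using cmp unfolding comparable_def s(3) by blast
  moreover have "real (count s' t z \<omega>) \<le> T"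
    using clique_of_cell[OF N _ \<epsilon> s(2,5) n(1) T] \<beta>(3) by blast
  ultimately show "real \<Omega> \<le> T" by linarith
qed

text \<open>Paths of two edges span N-distance at most 2 r', which is why adjacency of cells is
  taken with \<epsilon> / 2. Hence a ball of radius two has at most j + 1 points. For j = 1 the
  required j \<le> T comes from a single vertex.\<close>

lemma sparse_chromatic_bound:
  assumes N: "is_norm N" and \<epsilon>: "0 < \<epsilon>" and s: "0 < s" "2 * r' \<le> s / (\<epsilon> / 2)"
    and n: "1 \<le> n" "n \<le> nt" and fin: "finite {e. cell_adj N (\<epsilon> / 2) e}"
    and ball: "\<And>z. (\<Sum>b\<in>{e. cell_adj N (\<epsilon> / 2) e}. count s nt (z + b) \<omega>) \<le> j + 1"
    and T: "fractional_cover {1..n} (rgg_adj N (\<lambda>i. X i \<omega>) r') (\<lambda>_. 1) T"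
    and j: "j = 1 \<or> real j \<le> T"
  shows "real (chi N \<omega> n r') \<le> T"
proof (rule chromatic_number_le_cover_of_small_balls[OF _ _ _ _ T])
  let ?E = "rgg_adj N (\<lambda>i. X i \<omega>) r'"
  have tri: "N (x + y) \<le> N x + N y" for x y using N unfolding is_norm_def by blast
  have nonneg: "0 \<le> N x" for x
  proof -
    have "N (x - x) \<le> N x + N (- x)" using tri[of x "-x"] by simp
    moreover have "N (- x) = N x" using is_norm_diff_commute[OF N, of 0 x] by simp
    moreover have "N 0 = 0" using N unfolding is_norm_def by blast
    ultimately show ?thesis by simp
  qed
  show "?E v u" if "?E u v" for u v using that is_norm_diff_commute[OF N] unfolding rgg_adj_def by metis
  show "\<not> ?E u u" for u unfolding rgg_adj_def by simp
  fix u assume u: "u \<in> {1..n}"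
  let ?B = "{v \<in> {1..n}. v = u \<or> ?E u v \<or> (\<exists>w\<in>{1..n}. ?E u w \<and> ?E w v)}"
  let ?F = "{e. cell_adj N (\<epsilon> / 2) e}"
  have "?B \<subseteq> (\<Union>b\<in>?F. {i\<in>{1..nt}. cell s (X i \<omega>) = cell s (X u \<omega>) + b})"
  proof
    fix v assume v: "v \<in> ?B"
    have "N (X v \<omega> - X u \<omega>) \<le> s / (\<epsilon> / 2)"
    proof -
      consider "v = u" | "?E u v" | w where "?E u w" "?E w v" using v by auto
      then show ?thesis
      proof cases
        case 1
        have "N 0 = 0" using N unfolding is_norm_def by blast
        then show ?thesis using 1 s(1) \<epsilon> by simp
      next
        case 2
        then have "N (X v \<omega> - X u \<omega>) \<le> r'" using is_norm_diff_commute[OF N] unfolding rgg_adj_def by metis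
        then show ?thesis using s(2) nonneg[of "X v \<omega> - X u \<omega>"] by linarith
      next
        case 3
        then have "N (X w \<omega> - X u \<omega>) \<le> r'" "N (X v \<omega> - X w \<omega>) \<le> r'"
          using is_norm_diff_commute[OF N] unfolding rgg_adj_def by metis+
        then show ?thesis using s(2) tri[of "X v \<omega> - X w \<omega>" "X w \<omega> - X u \<omega>"] by simp
      qed
    qed
    then have "cell_adj N (\<epsilon> / 2) (cell s (X v \<omega>) - cell s (X u \<omega>))" using \<epsilon> by (intro cell_adj_of_close[OF N s(1)]) auto
    then show "v \<in> (\<Union>b\<in>?F. {i\<in>{1..nt}. cell s (X i \<omega>) = cell s (X u \<omega>) + b})"
      using v n by (intro UN_I[of "cell s (X v \<omega>) - cell s (X u \<omega>)"]) auto
  qed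
  then have "card ?B \<le> card (\<Union>b\<in>?F. {i\<in>{1..nt}. cell s (X i \<omega>) = cell s (X u \<omega>) + b})"
    using fin by (intro card_mono) auto
  also have "\<dots> \<le> (\<Sum>b\<in>?F. card {i\<in>{1..nt}. cell s (X i \<omega>) = cell s (X u \<omega>) + b})" by (rule card_UN_le) fact
  also have "\<dots> \<le> j + 1" using ball[of "cell s (X u \<omega>)"] unfolding count_def .
  finally show "card ?B \<le> j + 1" .
next
  have "real (card {1::nat}) \<le> T" by (rule fractional_cover_clique[OF _ _ T]) (use n in auto)
  then show "real j \<le> T" using j by auto
qed simp

section \<open>Choice of constants, geometric blocks and almost sure convergence\<close>

lemma chi_le_of_covers:
  assumes "0 < \<delta>"
    and "\<And>T. fractional_cover {1..n} (rgg_adj N (\<lambda>i. X i \<omega>) r) (\<lambda>_. 1) T \<Longrightarrow> real (chi N \<omega> n r) \<le> (1 + \<delta>) * T"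
  shows "real (chi N \<omega> n r) \<le> (1 + \<delta>) * chi_f N \<omega> n r"
proof -
  have "real (chi N \<omega> n r) / (1 + \<delta>) \<le> chi_f N \<omega> n r"
    by (rule fractional_chromatic_number_ge) (use assms in \<open>auto simp: divide_le_eq mult.commute\<close>)
  then show ?thesis using assms(1) by (simp add: divide_le_eq mult.commute)
qed

text \<open>The first estimate treats one geometric range of radii and unites the three regimes.
  Since infinitely many such ranges lead down to radius 0, the second one settles all radii up to
  t^(-3) together: there, three points in a cluster of cells are improbable.\<close>

lemma ratio_bound_at_scale:
  assumes N: "is_norm N" and \<delta>: "0 < \<delta>"
  obtains \<rho> \<kappa> r0 where "1 < \<rho>" "0 < \<kappa>" "0 < r0"
    "eventually (\<lambda>t. \<forall>r. 0 < r \<longrightarrow> r < r0 \<longrightarrow> except (real t powr (-\<kappa>)) (\<lambda>\<omega>. \<forall>n r'. t \<le> n \<longrightarrow> real n \<le> \<rho> * real t \<longrightarrow>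
       r \<le> r' \<longrightarrow> r' \<le> \<rho> * r \<longrightarrow> real (chi N \<omega> n r') \<le> (1 + \<delta>) * chi_f N \<omega> n r')) sequentially"
    "eventually (\<lambda>t. except (real t powr (-1)) (\<lambda>\<omega>. \<forall>n r'. t \<le> n \<longrightarrow> real n \<le> \<rho> * real t \<longrightarrow>
       0 < r' \<longrightarrow> r' \<le> real t powr (-3) \<longrightarrow> real (chi N \<omega> n r') \<le> (1 + \<delta>) * chi_f N \<omega> n r')) sequentially"
proof -
  obtain \<beta> where \<beta>: "\<beta> > 0" "\<And>x i. \<bar>x $ i\<bar> \<le> \<beta> * N x" "\<And>x c. (\<And>i. \<bar>x $ i\<bar> \<le> c) \<Longrightarrow> N x \<le> \<beta> * c"
    using is_norm_component_bounds[OF N] by metis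
  define d where "d = CARD('d)"
  \<comment> \<open>The budget \<delta>: the comparison costs 1 / a' = 1 + \<delta> / 4, shrinking
    the boxes raises this to at most 1 + \<delta> / 2, and the additive constant takes the remaining
    \<delta> / 2.\<close>
  define a' where "a' = 1 / (1 + \<delta> / 4)"
  have a': "0 < a'" "a' < 1" unfolding a'_def using \<delta> by auto
  have "((\<lambda>\<epsilon>. (1 / ((1 + \<epsilon>) * (1 + 2 * \<beta> * \<epsilon>))) ^ d / (1 + \<epsilon>)) \<longlongrightarrow> (1 / ((1 + 0) * (1 + 2 * \<beta> * 0))) ^ d / (1 + 0)) (at_right 0)"
    by (intro tendsto_intros) auto
  then have "((\<lambda>\<epsilon>. (1 / ((1 + \<epsilon>) * (1 + 2 * \<beta> * \<epsilon>))) ^ d / (1 + \<epsilon>)) \<longlongrightarrow> 1) (at_right 0)" by simp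
  then have "eventually (\<lambda>\<epsilon>. a' < (1 / ((1 + \<epsilon>) * (1 + 2 * \<beta> * \<epsilon>))) ^ d / (1 + \<epsilon>)) (at_right 0)"
    using a'(2) by (rule order_tendstoD)
  moreover have "eventually (\<lambda>\<epsilon>::real. 0 < \<epsilon>) (at_right 0)" by (rule eventually_at_right_less)
  ultimately have "eventually (\<lambda>\<epsilon>. 0 < \<epsilon> \<and> a' < (1 / ((1 + \<epsilon>) * (1 + 2 * \<beta> * \<epsilon>))) ^ d / (1 + \<epsilon>)) (at_right 0)"
    by eventually_elim simp
  then obtain \<epsilon> where \<epsilon>: "0 < \<epsilon>" "a' < (1 / ((1 + \<epsilon>) * (1 + 2 * \<beta> * \<epsilon>))) ^ d / (1 + \<epsilon>)"
    using eventually_happens'[OF trivial_limit_at_right_real] by blast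
  define \<rho> where "\<rho> = 1 + \<epsilon>"
  \<comment> \<open>With coarse side s = \<epsilon> \<rho> r this makes \<tau> s (1 / \<epsilon> + 2
    \<beta>) equal to r, so points of related fine cells are adjacent at every radius from r on. As
    \<epsilon> tends to 0, so that \<rho> and \<tau> tend to 1, a tends to 1 and exceeds a'.\<close>
  define \<tau> where "\<tau> = 1 / (\<rho> * (1 + 2 * \<beta> * \<epsilon>))"
  define a where "a = \<tau> ^ CARD('d) / \<rho>"
  have \<rho>1: "1 < \<rho>" "1 \<le> \<rho>" unfolding \<rho>_def using \<epsilon> by auto
  have one: "1 < \<rho> * (1 + 2 * \<beta> * \<epsilon>)"
  proof -
    have "1 * 1 < \<rho> * (1 + 2 * \<beta> * \<epsilon>)" using \<rho>1 \<beta>(1) \<epsilon>(1) by (intro mult_strict_mono) auto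
    then show ?thesis by simp
  qed
  have \<tau>: "0 < \<tau>" "\<tau> < 1" "\<tau> \<le> 1" unfolding \<tau>_def using one by auto
  have a'a: "a' < a" unfolding a_def \<tau>_def \<rho>_def using \<epsilon>(2) unfolding d_def .
  have a1: "a < 1"
  proof -
    have "\<tau> ^ CARD('d) \<le> 1" using \<tau> by (intro power_le_one) auto
    then show ?thesis unfolding a_def using \<rho>1 by (simp add: divide_less_eq)
  qed
  define b where "b = nat \<lceil>\<beta> / \<epsilon> + 1\<rceil>"
  have "((\<lambda>K::nat. (real K / (real K - real b)) ^ d) \<longlongrightarrow> 1 ^ d) sequentially"
    by (rule tendsto_power) real_asymp
  moreover have "1 ^ d < (1 + \<delta> / 2) / (1 + \<delta> / 4)" using \<delta> by (simp add: less_divide_eq)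
  ultimately have "eventually (\<lambda>K::nat. (real K / (real K - real b)) ^ d < (1 + \<delta> / 2) / (1 + \<delta> / 4)) sequentially"
    by (rule order_tendstoD)
  moreover have "eventually (\<lambda>K. b < K) sequentially" by (rule eventually_gt_at_top)
  ultimately have "eventually (\<lambda>K. b < K \<and> (real K / (real K - real b)) ^ d < (1 + \<delta> / 2) / (1 + \<delta> / 4)) sequentially"
    by eventually_elim simp
  then obtain K where K: "b < K" "(real K / (real K - real b)) ^ d < (1 + \<delta> / 2) / (1 + \<delta> / 4)"
    using eventually_happens'[OF sequentially_bot] by blast
  have K0: "0 < K" using K by simp
  define A1 where "A1 = (real K / real (K - b)) ^ d / a'"
  have A1: "A1 \<le> 1 + \<delta> / 2"
  proof -
    have "A1 = (1 + \<delta> / 4) * (real K / (real K - real b)) ^ d" unfolding A1_def a'_def using K by (simp add: of_nat_diff)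
    also have "\<dots> \<le> (1 + \<delta> / 4) * ((1 + \<delta> / 2) / (1 + \<delta> / 4))" using K(2) \<delta> by (intro mult_left_mono) auto
    also have "\<dots> = 1 + \<delta> / 2" using \<delta> by simp
    finally show ?thesis .
  qed
  define C1 where "C1 = A1 * real K ^ d + real K ^ d * (2 * 2 ^ (K ^ d))"
  \<comment> \<open>A clique of this size makes the additive constant C1 at most \<delta> / 2 times
    the budget of any cover.\<close>
  define \<Omega> where "\<Omega> = nat \<lceil>2 * C1 / \<delta>\<rceil>"
  have C1\<Omega>: "C1 \<le> \<delta> / 2 * real \<Omega>"
  proof -
    have "2 * C1 / \<delta> \<le> real \<Omega>" unfolding \<Omega>_def by linarith
    then show ?thesis using \<delta> by (simp add: field_simps)
  qed
  have ok_cmp: "real (chi N \<omega> n r') \<le> (1 + \<delta>) * chi_f N \<omega> n r'"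
    if cmp: "comparable K \<rho> \<tau> a' \<Omega> (\<epsilon> * \<rho> * r) t \<omega>" and r: "0 < r" "r \<le> r'" "r' \<le> \<rho> * r" and n: "t \<le> n" "real n \<le> \<rho> * real t"
    for \<omega> n r' r t
  proof (rule chi_le_of_covers[OF \<delta>])
    fix T assume T: "fractional_cover {1..n} (rgg_adj N (\<lambda>i. X i \<omega>) r') (\<lambda>_. 1) T"
    have s': "\<tau> * (\<epsilon> * \<rho> * r) * (1 / \<epsilon> + 2 * \<beta>) = r"
    proof -
      have "1 / \<epsilon> + 2 * \<beta> = (1 + 2 * \<beta> * \<epsilon>) / \<epsilon>" using \<epsilon>(1) by (simp add: add_divide_distrib)
      moreover have "1 + 2 * \<beta> * \<epsilon> \<noteq> 0" using \<epsilon>(1) \<beta>(1) by (simp add: add_pos_pos less_imp_neq[symmetric])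
      ultimately show ?thesis unfolding \<tau>_def using \<epsilon>(1) \<rho>1 by simp
    qed
    have s0: "0 < \<epsilon> * \<rho> * r" "0 < \<tau> * (\<epsilon> * \<rho> * r)" using \<epsilon>(1) \<rho>1 r \<tau> by auto
    have le: "r' \<le> \<epsilon> * \<rho> * r / \<epsilon>" "\<tau> * (\<epsilon> * \<rho> * r) * (1 / \<epsilon> + 2 * \<beta>) \<le> r'"
      unfolding s' using r \<epsilon>(1) by simp_all
    have n': "n \<le> nat \<lfloor>\<rho> * real t\<rfloor>" using n(2) by linarith
    have B: "real (chi N \<omega> n r') \<le> real K ^ CARD('d) * ((T + real K ^ CARD('d)) / a' / real (K - nat \<lceil>\<beta> / \<epsilon> + 1\<rceil>) ^ CARD('d) + 2 * 2 ^ (K ^ CARD('d)))"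
      and \<Omega>T: "real \<Omega> \<le> T"
      using comparable_chromatic_bound[OF N \<beta>(1,2) _ \<epsilon>(1) K(1)[unfolded b_def] a'(1) s0(1,2) refl le n(1) n' cmp T] \<beta>(3) by blast+
    have "real (chi N \<omega> n r') \<le> A1 * T + C1"
      using B unfolding A1_def C1_def b_def[symmetric] d_def[symmetric] by (simp add: power_divide distrib_left add_divide_distrib mult_ac)
    also have "\<dots> \<le> (1 + \<delta> / 2) * T + \<delta> / 2 * T"
    proof -
      have "0 \<le> T" using fractional_cover_nonneg[OF T] .
      then have "A1 * T \<le> (1 + \<delta> / 2) * T" using A1 by (intro mult_right_mono) auto
      moreover have "\<delta> / 2 * real \<Omega> \<le> \<delta> / 2 * T" using \<Omega>T \<delta> by (intro mult_left_mono) auto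
      ultimately show ?thesis using C1\<Omega> by linarith
    qed
    also have "\<dots> = (1 + \<delta>) * T" by (simp add: algebra_simps)
    finally show "real (chi N \<omega> n r') \<le> (1 + \<delta>) * T" .
  qed
  define F where "F = {e. cell_adj N (\<epsilon> / 2) e}"
  have finF: "finite F" unfolding F_def by (rule finite_cell_adj[OF \<beta>(2,1)])
  have F0: "F \<noteq> {}" unfolding F_def using cell_adj_0[OF N, of "\<epsilon> / 2"] \<epsilon>(1) by auto
  have ok_sparse: "real (chi N \<omega> n r') \<le> (1 + \<delta>) * chi_f N \<omega> n r'"
    if ball: "\<And>z. (\<Sum>b\<in>F. count (\<epsilon> * \<rho> * r) (nat \<lfloor>\<rho> * real t\<rfloor>) (z + b) \<omega>) \<le> j + 1"
      and j: "j = 1 \<or> r \<le> r' \<and> (\<exists>z. j \<le> count (\<tau> * (\<epsilon> * \<rho> * r)) t z \<omega>)"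
      and r: "0 < r" "r' \<le> \<rho> * r" and n: "t \<le> n" "real n \<le> \<rho> * real t" and t: "1 \<le> t"
    for \<omega> n r' r t j
  proof (rule chi_le_of_covers[OF \<delta>])
    fix T assume T: "fractional_cover {1..n} (rgg_adj N (\<lambda>i. X i \<omega>) r') (\<lambda>_. 1) T"
    have "real (chi N \<omega> n r') \<le> T"
    proof (rule sparse_chromatic_bound[OF N \<epsilon>(1) _ _ _ _ _ ball[unfolded F_def] T])
      show "0 < \<epsilon> * \<rho> * r" using \<epsilon>(1) \<rho>1 r by simp
      show "2 * r' \<le> \<epsilon> * \<rho> * r / (\<epsilon> / 2)" using r \<epsilon>(1) by simp
      show "1 \<le> n" using n t by simp
      show "n \<le> nat \<lfloor>\<rho> * real t\<rfloor>" using n(2) by linarith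
      show "finite {e. cell_adj N (\<epsilon> / 2) e}" using finF unfolding F_def .
      show "j = 1 \<or> real j \<le> T"
      proof (cases "j = 1")
        case False
        then obtain z where z: "r \<le> r'" "j \<le> count (\<tau> * (\<epsilon> * \<rho> * r)) t z \<omega>" using j by auto
        have s': "\<tau> * (\<epsilon> * \<rho> * r) * (1 / \<epsilon> + 2 * \<beta>) = r"
        proof -
          have "1 / \<epsilon> + 2 * \<beta> = (1 + 2 * \<beta> * \<epsilon>) / \<epsilon>" using \<epsilon>(1) by (simp add: add_divide_distrib)
          moreover have "1 + 2 * \<beta> * \<epsilon> \<noteq> 0" using \<epsilon>(1) \<beta>(1) by (simp add: add_pos_pos less_imp_neq[symmetric])
          ultimately show ?thesis unfolding \<tau>_def using \<epsilon>(1) \<rho>1 by simp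
        qed
        have s0: "0 < \<tau> * (\<epsilon> * \<rho> * r)" "\<tau> * (\<epsilon> * \<rho> * r) * (1 / \<epsilon> + 2 * \<beta>) \<le> r'"
          unfolding s' using \<epsilon>(1) \<rho>1 r \<tau> z by auto
        have "real (count (\<tau> * (\<epsilon> * \<rho> * r)) t z \<omega>) \<le> T"
          using clique_of_cell[OF N _ \<epsilon>(1) s0 n(1) T] \<beta>(3) by blast
        then show ?thesis using z by linarith
      qed simp
    qed
    also have "T \<le> (1 + \<delta>) * T" using fractional_cover_nonneg[OF T] \<delta> by (simp add: distrib_right)
    finally show "real (chi N \<omega> n r') \<le> (1 + \<delta>) * T" .
  qed
  \<comment> \<open>The order matters: the dense regime yields Kc, the logarithmic regime with this
    Kc yields \<alpha>, and the sparse regime starts at t^(-\<alpha>). Together they cover every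
    mean.\<close>
  obtain Kc s1 where dense: "0 < Kc" "0 < s1"
    "eventually (\<lambda>t. \<forall>s. 0 < s \<longrightarrow> s < s1 \<longrightarrow> Kc * ln (real t) \<le> \<rho> * real t * (\<sigma> * s ^ CARD('d)) \<longrightarrow>
      except (real t powr (-1/2)) (comparable K \<rho> \<tau> a' \<Omega> s t)) sequentially"
    using comparable_dense_regime[OF \<rho>1(2) \<tau>(1,3) K0 a_def a'(1) a'a] by blast
  obtain \<alpha> \<kappa>1 s2 where lg: "0 < \<alpha>" "0 < \<kappa>1" "0 < s2"
    "eventually (\<lambda>t. \<forall>s. 0 < s \<longrightarrow> s < s2 \<longrightarrow> real t powr (-\<alpha>) \<le> \<rho> * real t * (\<sigma> * s ^ CARD('d)) \<longrightarrow>
      \<rho> * real t * (\<sigma> * s ^ CARD('d)) \<le> Kc * ln (real t) \<longrightarrow>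
      except (real t powr (-\<kappa>1)) (comparable K \<rho> \<tau> a' \<Omega> s t)) sequentially"
    using comparable_log_regime[OF \<rho>1(2) \<tau>(1,3) K0 a_def a1 a'(1) less_imp_le[OF a'a] dense(1)] by blast
  obtain \<kappa>2 s3 where sp: "0 < \<kappa>2" "0 < s3"
    "eventually (\<lambda>t. \<forall>s. 0 < s \<longrightarrow> s < s3 \<longrightarrow> \<rho> * real t * (\<sigma> * s ^ CARD('d)) \<le> real t powr (-\<alpha>) \<longrightarrow>
      (\<exists>j\<ge>1. except (real t powr (-\<kappa>2)) (\<lambda>\<omega>. (\<forall>z. (\<Sum>b\<in>F. count s (nat \<lfloor>\<rho> * real t\<rfloor>) (z + b) \<omega>) \<le> j + 1) \<and>
         (j = 1 \<or> (\<exists>z. j \<le> count (\<tau> * s) t z \<omega>))))) sequentially"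
    using sparse_regime[OF \<rho>1(2) \<tau>(1,3) lg(1) finF F0] by blast
  define \<kappa> where "\<kappa> = min (1 / 2) (min \<kappa>1 \<kappa>2)"
  have \<kappa>: "0 < \<kappa>" "\<kappa> \<le> 1 / 2" "\<kappa> \<le> \<kappa>1" "\<kappa> \<le> \<kappa>2" using lg sp by (simp_all add: \<kappa>_def min_def)
  define s0 where "s0 = min s1 (min s2 s3)"
  have s0: "0 < s0" "s0 \<le> s1" "s0 \<le> s2" "s0 \<le> s3" using dense lg sp by (simp_all add: s0_def)
  define r0 where "r0 = s0 / (\<epsilon> * \<rho>)"
  show thesis
  proof (rule that[of \<rho> \<kappa> r0])
    show "1 < \<rho>" "0 < \<kappa>" by fact+
    show "0 < r0" unfolding r0_def using s0 \<epsilon>(1) \<rho>1 by simp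
    have ev1: "eventually (\<lambda>t::nat. 1 \<le> t) sequentially" by (rule eventually_ge_at_top)
    show "eventually (\<lambda>t. \<forall>r. 0 < r \<longrightarrow> r < r0 \<longrightarrow> except (real t powr (-\<kappa>)) (\<lambda>\<omega>. \<forall>n r'. t \<le> n \<longrightarrow> real n \<le> \<rho> * real t \<longrightarrow>
       r \<le> r' \<longrightarrow> r' \<le> \<rho> * r \<longrightarrow> real (chi N \<omega> n r') \<le> (1 + \<delta>) * chi_f N \<omega> n r')) sequentially"
      using dense(3) lg(4) sp(3) ev1
    proof eventually_elim
      case (elim t)
      show ?case
      proof (intro allI impI)
        fix r assume r: "0 < r" "r < r0"
        define s where "s = \<epsilon> * \<rho> * r"
        have s: "0 < s" "s < s0" unfolding s_def using r \<epsilon>(1) \<rho>1 by (auto simp: r0_def less_divide_eq mult_ac)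
        have t: "1 \<le> real t" using elim(4) by simp
        define \<mu> where "\<mu> = \<rho> * real t * (\<sigma> * s ^ CARD('d))"
        let ?ok = "\<lambda>\<omega>. \<forall>n r'. t \<le> n \<longrightarrow> real n \<le> \<rho> * real t \<longrightarrow>
           r \<le> r' \<longrightarrow> r' \<le> \<rho> * r \<longrightarrow> real (chi N \<omega> n r') \<le> (1 + \<delta>) * chi_f N \<omega> n r'"
        consider "Kc * ln (real t) \<le> \<mu>" | "real t powr (-\<alpha>) \<le> \<mu>" "\<mu> \<le> Kc * ln (real t)" | "\<mu> \<le> real t powr (-\<alpha>)" by linarith
        then show "except (real t powr (-\<kappa>)) ?ok"
        proof cases
          case 1
          then have "except (real t powr (-1/2)) (comparable K \<rho> \<tau> a' \<Omega> s t)" using elim(1) s s0 unfolding \<mu>_def by auto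
          then show ?thesis
          proof (rule except_mono)
            show "real t powr (-1/2) \<le> real t powr (-\<kappa>)" using t \<kappa> by (intro powr_mono) auto
          qed (use ok_cmp r in \<open>auto simp: s_def\<close>)
        next
          case 2
          then have "except (real t powr (-\<kappa>1)) (comparable K \<rho> \<tau> a' \<Omega> s t)" using elim(2) s s0 unfolding \<mu>_def by auto
          then show ?thesis
          proof (rule except_mono)
            show "real t powr (-\<kappa>1) \<le> real t powr (-\<kappa>)" using t \<kappa> by (intro powr_mono) auto
          qed (use ok_cmp r in \<open>auto simp: s_def\<close>)
        next
          case 3
          then obtain j where j: "except (real t powr (-\<kappa>2)) (\<lambda>\<omega>. (\<forall>z. (\<Sum>b\<in>F. count s (nat \<lfloor>\<rho> * real t\<rfloor>) (z + b) \<omega>) \<le> j + 1) \<and>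
             (j = 1 \<or> (\<exists>z. j \<le> count (\<tau> * s) t z \<omega>)))" using elim(3) s s0 unfolding \<mu>_def by fastforce
          then show ?thesis
          proof (rule except_mono)
            show "real t powr (-\<kappa>2) \<le> real t powr (-\<kappa>)" using t \<kappa> by (intro powr_mono) auto
            fix \<omega> assume H: "(\<forall>z. (\<Sum>b\<in>F. count s (nat \<lfloor>\<rho> * real t\<rfloor>) (z + b) \<omega>) \<le> j + 1) \<and>
             (j = 1 \<or> (\<exists>z. j \<le> count (\<tau> * s) t z \<omega>))"
            show "?ok \<omega>"
            proof (intro allI impI)
              fix n r' assume as: "t \<le> n" "real n \<le> \<rho> * real t" "r \<le> r'" "r' \<le> \<rho> * r"
              have "\<And>z. (\<Sum>b\<in>F. count (\<epsilon> * \<rho> * r) (nat \<lfloor>\<rho> * real t\<rfloor>) (z + b) \<omega>) \<le> j + 1"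
                "j = 1 \<or> r \<le> r' \<and> (\<exists>z. j \<le> count (\<tau> * (\<epsilon> * \<rho> * r)) t z \<omega>)"
                using H as(3) unfolding s_def by blast+
              then show "real (chi N \<omega> n r') \<le> (1 + \<delta>) * chi_f N \<omega> n r'"
                by (rule ok_sparse[OF _ _ r(1) as(4,1,2) elim(4)])
            qed
          qed
        qed
      qed
    qed
    define v where "v = real (card F)"
    define C where "C = \<rho> * \<sigma> * \<epsilon>"
    have ev2: "eventually (\<lambda>t::nat. \<epsilon> * real t powr (-3) \<le> 1) sequentially" by real_asymp
    have ev3: "eventually (\<lambda>t::nat. v * (C * real t powr (-2)) \<le> 1) sequentially" by real_asymp
    define C3 where "C3 = \<rho> * (exp 1 * v) ^ 3 * C\<^sup>2"
    have ev4: "eventually (\<lambda>t::nat. C3 * real t powr (-3) \<le> real t powr (-1)) sequentially"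
      by real_asymp
    show "eventually (\<lambda>t. except (real t powr (-1)) (\<lambda>\<omega>. \<forall>n r'. t \<le> n \<longrightarrow> real n \<le> \<rho> * real t \<longrightarrow>
       0 < r' \<longrightarrow> r' \<le> real t powr (-3) \<longrightarrow> real (chi N \<omega> n r') \<le> (1 + \<delta>) * chi_f N \<omega> n r')) sequentially"
      using ev1 ev2 ev3 ev4
    proof eventually_elim
      case (elim t)
      have t: "1 \<le> real t" using elim(1) by simp
      \<comment> \<open>With j = 1 the argument uses only an upper bound on the radius, so one scale
        with \<rho> r = t^(-3) serves all smaller radii.\<close>
      define r where "r = real t powr (-3) / \<rho>"
      define s where "s = \<epsilon> * \<rho> * r"
      have r: "0 < r" unfolding r_def using t \<rho>1 by simp
      have se: "s = \<epsilon> * real t powr (-3)" unfolding s_def r_def using \<rho>1 by simp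
      have s: "0 < s" unfolding s_def using r \<epsilon>(1) \<rho>1 by simp
      define \<mu> where "\<mu> = \<rho> * real t * (\<sigma> * s ^ CARD('d))"
      have \<mu>0: "0 < \<mu>" unfolding \<mu>_def using \<rho>1 t \<sigma>(1) s by simp
      have \<mu>: "\<mu> \<le> C * real t powr (-2)"
      proof -
        \<comment> \<open>As s \<le> 1, the mean is of order at most t^(-2) in every dimension, and
          the bound for three points in a cluster is of order t * t^(-4).\<close>
        have "s ^ CARD('d) \<le> s ^ 1" using s elim(2) unfolding se by (intro power_decreasing) (auto simp: Suc_leI)
        then have "\<mu> \<le> \<rho> * real t * (\<sigma> * s)" unfolding \<mu>_def using \<rho>1 \<sigma>(1) t by (intro mult_left_mono) auto
        also have "\<dots> = C * (real t powr 1 * real t powr (-3))" unfolding se C_def using t by simp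
        also have "\<dots> = C * real t powr (-2)" unfolding powr_add[symmetric] by simp
        finally show ?thesis .
      qed
      have v0: "0 \<le> v" unfolding v_def by simp
      have "except (\<rho> * (exp 1 * real (card F)) ^ 3 * (real t * \<mu> ^ (3 - 1)))
         (\<lambda>\<omega>. \<forall>z. (\<Sum>b\<in>F. count s (nat \<lfloor>\<rho> * real t\<rfloor>) (z + b) \<omega>) < 3)"
      proof (rule sparse_counts_bound[OF \<rho>1(2) s _ finF F0 _ \<mu>_def])
        have "v * \<mu> \<le> v * (C * real t powr (-2))" using \<mu> v0 by (intro mult_left_mono) auto
        then show "real (card F) * \<mu> \<le> 1" using elim(3) unfolding v_def by linarith
      qed (use elim(1) in auto)
      then show ?case
      proof (rule except_mono)
        have "\<rho> * (exp 1 * v) ^ 3 * (real t * \<mu>\<^sup>2) \<le> \<rho> * (exp 1 * v) ^ 3 * (real t * (C * real t powr (-2))\<^sup>2)"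
          using \<mu> \<mu>0 \<rho>1 v0 t by (intro mult_left_mono power_mono) auto
        also have "\<dots> = C3 * (real t powr 1 * real t powr (-2) * real t powr (-2))"
          unfolding C3_def using t by (simp add: power_mult_distrib power2_eq_square)
        also have "\<dots> = C3 * real t powr (-3)" unfolding powr_add[symmetric] by simp
        finally show "\<rho> * (exp 1 * real (card F)) ^ 3 * (real t * \<mu> ^ (3 - 1)) \<le> real t powr (-1)"
          using elim(4) unfolding v_def by simp
        fix \<omega> assume H: "\<forall>z. (\<Sum>b\<in>F. count s (nat \<lfloor>\<rho> * real t\<rfloor>) (z + b) \<omega>) < 3"
        show "\<forall>n r'. t \<le> n \<longrightarrow> real n \<le> \<rho> * real t \<longrightarrow> 0 < r' \<longrightarrow> r' \<le> real t powr (-3) \<longrightarrow>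
          real (chi N \<omega> n r') \<le> (1 + \<delta>) * chi_f N \<omega> n r'"
        proof (intro allI impI)
          fix n r' assume as: "t \<le> n" "real n \<le> \<rho> * real t" "0 < r'" "r' \<le> real t powr (-3)"
          have r': "r' \<le> \<rho> * r" unfolding r_def using as \<rho>1 by simp
          have "(\<Sum>b\<in>F. count (\<epsilon> * \<rho> * r) (nat \<lfloor>\<rho> * real t\<rfloor>) (z + b) \<omega>) \<le> 1 + 1" for z
            using H[rule_format, of z] unfolding s_def by linarith
          then show "real (chi N \<omega> n r') \<le> (1 + \<delta>) * chi_f N \<omega> n r'"
            by (rule ok_sparse[OF _ disjI1[OF refl] r r' as(1,2) elim(1)])
        qed
      qed
    qed
  qed
qed

text \<open>A union bound over radii in geometric progression. Only about ln t of them lie between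
  t^(-3) and 1, so the sum of their exceptional probabilities stays a negative power of t.\<close>

lemma ratio_bound_block:
  assumes N: "is_norm N" and \<delta>: "0 < \<delta>"
  obtains \<rho> \<kappa> r0 where "1 < \<rho>" "0 < \<kappa>" "0 < r0"
    "eventually (\<lambda>t. except (real t powr (-\<kappa>)) (\<lambda>\<omega>. \<forall>n r. t \<le> n \<longrightarrow> real n \<le> \<rho> * real t \<longrightarrow>
       0 < r \<longrightarrow> r < r0 \<longrightarrow> real (chi N \<omega> n r) \<le> (1 + \<delta>) * chi_f N \<omega> n r)) sequentially"
proof -
  obtain \<rho> \<kappa> r1 where \<rho>: "1 < \<rho>" "0 < \<kappa>" "0 < r1"
    and big: "eventually (\<lambda>t. \<forall>r. 0 < r \<longrightarrow> r < r1 \<longrightarrow> except (real t powr (-\<kappa>)) (\<lambda>\<omega>. \<forall>n r'. t \<le> n \<longrightarrow> real n \<le> \<rho> * real t \<longrightarrow>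
       r \<le> r' \<longrightarrow> r' \<le> \<rho> * r \<longrightarrow> real (chi N \<omega> n r') \<le> (1 + \<delta>) * chi_f N \<omega> n r')) sequentially"
    and small: "eventually (\<lambda>t. except (real t powr (-1)) (\<lambda>\<omega>. \<forall>n r'. t \<le> n \<longrightarrow> real n \<le> \<rho> * real t \<longrightarrow>
       0 < r' \<longrightarrow> r' \<le> real t powr (-3) \<longrightarrow> real (chi N \<omega> n r') \<le> (1 + \<delta>) * chi_f N \<omega> n r')) sequentially"
    using ratio_bound_at_scale[OF N \<delta>] by blast
  define r0 where "r0 = min r1 1"
  define \<kappa>' where "\<kappa>' = min (\<kappa> / 2) (1 / 2)"
  have \<kappa>': "0 < \<kappa>'" "\<kappa>' \<le> \<kappa> / 2" "\<kappa>' \<le> 1 / 2" using \<rho> by (simp_all add: \<kappa>'_def min_def)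
  have ln\<rho>: "0 < ln \<rho>" using \<rho> by simp
  show thesis
  proof (rule that[of \<rho> \<kappa>' r0])
    show "1 < \<rho>" "0 < \<kappa>'" "0 < r0" using \<rho> \<kappa>' by (auto simp: r0_def)
    have ev1: "eventually (\<lambda>t::nat. (2 * (3 / ln \<rho> + 1)) * ln (real t) ^ 1 \<le> real t powr (\<kappa> / 2)) sequentially"
      by (rule eventually_polylog_le_powr) (use \<rho> in simp)
    have ev2: "eventually (\<lambda>t::nat. 2 * real t powr (-1) \<le> real t powr (-1/2)) sequentially" by real_asymp
    have ev3: "eventually (\<lambda>t::nat. 1 \<le> ln (real t)) sequentially" by real_asymp
    have ev4: "eventually (\<lambda>t::nat. 1 \<le> t) sequentially" by (rule eventually_ge_at_top)
    show "eventually (\<lambda>t. except (real t powr (-\<kappa>')) (\<lambda>\<omega>. \<forall>n r. t \<le> n \<longrightarrow> real n \<le> \<rho> * real t \<longrightarrow>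
       0 < r \<longrightarrow> r < r0 \<longrightarrow> real (chi N \<omega> n r) \<le> (1 + \<delta>) * chi_f N \<omega> n r)) sequentially"
      using big small ev1 ev2 ev3 ev4
    proof eventually_elim
      case (elim t)
      have t: "1 \<le> real t" "0 < real t" using elim(6) by auto
      \<comment> \<open>The ranges starting at t^(-3) \<rho>^l with l \<le> L reach from t^(-3) up
        to 1, and r0 \<le> 1.\<close>
      define L where "L = nat \<lfloor>log \<rho> (real t ^ 3)\<rfloor>"
      define rr where "rr l = real t powr (-3) * \<rho> ^ l" for l :: nat
      have rr0: "0 < rr l" for l unfolding rr_def using t \<rho> by simp
      define good where "good l \<omega> \<longleftrightarrow> (rr l < r1 \<longrightarrow> (\<forall>n r'. t \<le> n \<longrightarrow> real n \<le> \<rho> * real t \<longrightarrow>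
         rr l \<le> r' \<longrightarrow> r' \<le> \<rho> * rr l \<longrightarrow> real (chi N \<omega> n r') \<le> (1 + \<delta>) * chi_f N \<omega> n r'))" for l \<omega>
      have each: "except (real t powr (-\<kappa>)) (good l)" for l
      proof (cases "rr l < r1")
        case True
        then show ?thesis using elim(1) rr0[of l] unfolding good_def by simp
      next
        case False
        then show ?thesis unfolding good_def by (intro except_True) auto
      qed
      have "except (\<Sum>l\<in>{0..L}. real t powr (-\<kappa>)) (\<lambda>\<omega>. \<forall>l\<in>{0..L}. good l \<omega>)"
        by (rule except_ball) (use each in auto)
      note conj = except_conj[OF elim(2) this]
      show ?case
      proof (rule except_mono[OF conj])
        have "real (L + 1) \<le> (3 / ln \<rho> + 1) * ln (real t)"
        proof -
          have "0 \<le> log \<rho> (real t ^ 3)" using \<rho> t by simp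
          then have "real L \<le> log \<rho> (real t ^ 3)" unfolding L_def by linarith
          also have "\<dots> = 3 / ln \<rho> * ln (real t)" unfolding log_def using t by (simp add: ln_realpow)
          finally show ?thesis using elim(5) by (simp add: distrib_right)
        qed
        then have "real (L + 1) * real t powr (-\<kappa>) \<le> (3 / ln \<rho> + 1) * ln (real t) * real t powr (-\<kappa>)"
          by (intro mult_right_mono) auto
        also have "\<dots> = (2 * (3 / ln \<rho> + 1) * ln (real t) ^ 1) * real t powr (-\<kappa>) / 2" by simp
        also have "\<dots> \<le> real t powr (\<kappa> / 2) * real t powr (-\<kappa>) / 2"
          using elim(3) by (intro divide_right_mono mult_right_mono) auto
        also have "\<dots> = real t powr (- (\<kappa> / 2)) / 2" unfolding powr_add[symmetric] by simp
        also have "\<dots> \<le> real t powr (-\<kappa>') / 2" using t \<kappa>' by (intro divide_right_mono powr_mono) auto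
        finally have 1: "real (L + 1) * real t powr (-\<kappa>) \<le> real t powr (-\<kappa>') / 2" .
        have "real t powr (-1/2) \<le> real t powr (-\<kappa>')" using t \<kappa>' by (intro powr_mono) auto
        then have 2: "real t powr (-1) \<le> real t powr (-\<kappa>') / 2" using elim(4) by linarith
        have "(\<Sum>l\<in>{0..L}. real t powr (-\<kappa>)) = real (L + 1) * real t powr (-\<kappa>)" by simp
        then show "real t powr (-1) + (\<Sum>l\<in>{0..L}. real t powr (-\<kappa>)) \<le> real t powr (-\<kappa>')" using 1 2 by linarith
      next
        fix \<omega> assume H: "(\<forall>n r'. t \<le> n \<longrightarrow> real n \<le> \<rho> * real t \<longrightarrow> 0 < r' \<longrightarrow> r' \<le> real t powr (-3) \<longrightarrow>
           real (chi N \<omega> n r') \<le> (1 + \<delta>) * chi_f N \<omega> n r') \<and> (\<forall>l\<in>{0..L}. good l \<omega>)"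
        show "\<forall>n r. t \<le> n \<longrightarrow> real n \<le> \<rho> * real t \<longrightarrow> 0 < r \<longrightarrow> r < r0 \<longrightarrow> real (chi N \<omega> n r) \<le> (1 + \<delta>) * chi_f N \<omega> n r"
        proof (intro allI impI)
          fix n r assume as: "t \<le> n" "real n \<le> \<rho> * real t" "0 < r" "r < r0"
          show "real (chi N \<omega> n r) \<le> (1 + \<delta>) * chi_f N \<omega> n r"
          proof (cases "r \<le> real t powr (-3)")
            case True then show ?thesis using H as by blast
          next
            case False
            define x where "x = r * real t ^ 3"
            have t3: "real t powr (-3) = 1 / real t ^ 3" using t by (simp add: powr_minus_divide powr_realpow[of "real t" 3, simplified])
            have x1: "1 < x" using False t unfolding x_def t3 by (simp add: field_simps)
            have xt: "x \<le> real t ^ 3"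
            proof -
              have "r \<le> 1" using as unfolding r0_def by simp
              then have "r * real t ^ 3 \<le> 1 * real t ^ 3" by (intro mult_right_mono) auto
              then show ?thesis unfolding x_def by simp
            qed
            define l where "l = nat \<lfloor>log \<rho> x\<rfloor>"
            have lx: "0 \<le> log \<rho> x" using x1 \<rho> by simp
            have l1: "real l \<le> log \<rho> x" "log \<rho> x < real l + 1" unfolding l_def using lx by linarith+
            have "l \<le> L"
            proof -
              have "log \<rho> x \<le> log \<rho> (real t ^ 3)" using x1 xt \<rho> t by simp
              then show ?thesis unfolding l_def L_def by (intro nat_mono floor_mono)
            qed
            have "\<rho> ^ l \<le> x"
            proof -
              have "\<rho> powr real l \<le> \<rho> powr (log \<rho> x)" using l1 \<rho> by (intro powr_mono) auto
              then show ?thesis using \<rho> x1 by (simp add: powr_realpow)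
            qed
            moreover have "x \<le> \<rho> * \<rho> ^ l"
            proof -
              have "\<rho> powr (log \<rho> x) \<le> \<rho> powr (real l + 1)" using l1 \<rho> by (intro powr_mono) auto
              then show ?thesis using \<rho> x1 by (simp add: powr_realpow powr_add mult.commute)
            qed
            moreover have "r = real t powr (-3) * x" unfolding x_def t3 using t by simp
            ultimately have lr: "rr l \<le> r" "r \<le> \<rho> * rr l"
            proof -
              assume h: "\<rho> ^ l \<le> x" "x \<le> \<rho> * \<rho> ^ l" "r = real t powr (-3) * x"
              show "rr l \<le> r" unfolding rr_def h(3) using h(1) by (intro mult_left_mono) auto
              have "real t powr (-3) * x \<le> real t powr (-3) * (\<rho> * \<rho> ^ l)" using h(2) by (intro mult_left_mono) auto
              then show "r \<le> \<rho> * rr l" unfolding rr_def h(3)[symmetric] by (simp add: mult_ac)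
            qed
            have "good l \<omega>" using H \<open>l \<le> L\<close> by auto
            moreover have "rr l < r1" using lr as unfolding r0_def by simp
            ultimately show ?thesis using as lr unfolding good_def by blast
          qed
        qed
      qed
    qed
  qed
qed

text \<open>Borel-Cantelli along T i, the ceiling of \<rho>^i: the exceptional probabilities are
  dominated by a geometric series, and the blocks from T i to \<rho> T i cover all large n.\<close>

lemma AE_ratio_bound:
  assumes N: "is_norm N" and \<delta>: "0 < \<delta>"
  obtains r0 where "0 < r0" "AE \<omega> in M. eventually (\<lambda>n. \<forall>r. 0 < r \<longrightarrow> r < r0 \<longrightarrow> real (chi N \<omega> n r) \<le> (1 + \<delta>) * chi_f N \<omega> n r) sequentially"
proof -
  obtain \<rho> \<kappa> r0 where \<rho>: "1 < \<rho>" "0 < \<kappa>" "0 < r0"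
    and ev: "eventually (\<lambda>t. except (real t powr (-\<kappa>)) (\<lambda>\<omega>. \<forall>n r. t \<le> n \<longrightarrow> real n \<le> \<rho> * real t \<longrightarrow>
       0 < r \<longrightarrow> r < r0 \<longrightarrow> real (chi N \<omega> n r) \<le> (1 + \<delta>) * chi_f N \<omega> n r)) sequentially"
    using ratio_bound_block[OF N \<delta>] by blast
  define ok where "ok t \<omega> \<longleftrightarrow> (\<forall>n r. t \<le> n \<longrightarrow> real n \<le> \<rho> * real t \<longrightarrow>
       0 < r \<longrightarrow> r < r0 \<longrightarrow> real (chi N \<omega> n r) \<le> (1 + \<delta>) * chi_f N \<omega> n r)" for t \<omega>
  obtain t0 where t0: "\<And>t. t \<ge> t0 \<Longrightarrow> except (real t powr (-\<kappa>)) (ok t)"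
    using ev unfolding ok_def[symmetric] eventually_sequentially by blast
  \<comment> \<open>Borel-Cantelli is applied to exceptional events chosen here, since
    \<open>ok t\<close> need not define an event.\<close>
  have "\<exists>A\<in>events. t \<ge> t0 \<longrightarrow> prob A \<le> real t powr (-\<kappa>) \<and> (\<forall>\<omega>\<in>space M - A. ok t \<omega>)" for t
    using t0[of t] unfolding except_def by (cases "t \<ge> t0") auto
  then obtain A where A: "\<And>t. A t \<in> events" "\<And>t. t \<ge> t0 \<Longrightarrow> prob (A t) \<le> real t powr (-\<kappa>)" "\<And>t \<omega>. t \<ge> t0 \<Longrightarrow> \<omega> \<in> space M - A t \<Longrightarrow> ok t \<omega>"
    by metis
  define T where "T i = nat \<lceil>\<rho> ^ i\<rceil>" for i
  have T: "\<rho> ^ i \<le> real (T i)" for i unfolding T_def by linarith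
  have Tlim: "eventually (\<lambda>i. t0 \<le> T i) sequentially"
  proof -
    have "filterlim (\<lambda>i. \<rho> ^ i) at_top sequentially" using \<rho>(1) by real_asymp
    then have "eventually (\<lambda>i. real t0 \<le> \<rho> ^ i) sequentially" by (auto simp: filterlim_at_top)
    then show ?thesis
    proof eventually_elim
      case (elim i) then show ?case using T[of i] by linarith
    qed
  qed
  have "summable (\<lambda>i. prob (A (T i)))"
  proof (rule summable_comparison_test_ev)
    show "summable (\<lambda>i. (\<rho> powr (-\<kappa>)) ^ i)"
    proof (rule summable_geometric)
      have "\<rho> powr (-\<kappa>) < \<rho> powr 0" using \<rho> by (intro powr_less_mono) auto
      then show "norm (\<rho> powr (-\<kappa>)) < 1" using \<rho> by simp
    qed
    show "eventually (\<lambda>i. norm (prob (A (T i))) \<le> (\<rho> powr (-\<kappa>)) ^ i) sequentially"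
      using Tlim
    proof eventually_elim
      case (elim i)
      have p: "0 < \<rho> ^ i" using \<rho> by simp
      have "prob (A (T i)) \<le> real (T i) powr (-\<kappa>)" using A(2)[OF elim] .
      also have "\<dots> \<le> (\<rho> ^ i) powr (-\<kappa>)" using T[of i] p \<rho> by (intro powr_mono2') auto
      also have "\<dots> = (\<rho> powr (-\<kappa>)) ^ i" using \<rho> by (simp add: powr_realpow[symmetric] powr_powr mult.commute)
      finally show ?case by simp
    qed
  qed
  then have "AE \<omega> in M. eventually (\<lambda>i. \<omega> \<in> space M - A (T i)) sequentially"
    using A(1) by (intro borel_cantelli_AE1) (auto simp: less_top[symmetric])
  then have "AE \<omega> in M. eventually (\<lambda>n. \<forall>r. 0 < r \<longrightarrow> r < r0 \<longrightarrow> real (chi N \<omega> n r) \<le> (1 + \<delta>) * chi_f N \<omega> n r) sequentially"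
  proof (rule AE_mp, intro AE_I2 impI)
    fix \<omega> assume "eventually (\<lambda>i. \<omega> \<in> space M - A (T i)) sequentially"
    then have "eventually (\<lambda>i. ok (T i) \<omega>) sequentially"
      using Tlim by eventually_elim (use A(3) in auto)
    then obtain i0 where i0: "\<And>i. i \<ge> i0 \<Longrightarrow> ok (T i) \<omega>" unfolding eventually_sequentially by blast
    have "eventually (\<lambda>n::nat. \<rho> ^ i0 \<le> real n) sequentially"
      using filterlim_real_sequentially by (auto simp: filterlim_at_top)
    moreover have "eventually (\<lambda>n::nat. 1 \<le> n) sequentially" by (rule eventually_ge_at_top)
    ultimately show "eventually (\<lambda>n. \<forall>r. 0 < r \<longrightarrow> r < r0 \<longrightarrow> real (chi N \<omega> n r) \<le> (1 + \<delta>) * chi_f N \<omega> n r) sequentially"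
    proof eventually_elim
      case (elim n)
      have n1: "1 \<le> real n" using elim(2) by simp
      define i where "i = nat \<lfloor>log \<rho> (real n)\<rfloor>"
      have lx: "0 \<le> log \<rho> (real n)" using n1 \<rho> by simp
      have l1: "real i \<le> log \<rho> (real n)" "log \<rho> (real n) < real i + 1" unfolding i_def using lx by linarith+
      have up: "\<rho> ^ i \<le> real n"
      proof -
        have "\<rho> powr real i \<le> \<rho> powr (log \<rho> (real n))" using l1 \<rho> by (intro powr_mono) auto
        then show ?thesis using \<rho> n1 by (simp add: powr_realpow)
      qed
      have low: "real n \<le> \<rho> * \<rho> ^ i"
      proof -
        have "\<rho> powr (log \<rho> (real n)) \<le> \<rho> powr (real i + 1)" using l1 \<rho> by (intro powr_mono) auto
        then show ?thesis using \<rho> n1 by (simp add: powr_realpow powr_add mult.commute)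
      qed
      have "i0 \<le> i"
      proof -
        have "log \<rho> (\<rho> ^ i0) \<le> log \<rho> (real n)" using elim(1) \<rho> n1 by (subst log_le_cancel_iff) auto
        then have "real i0 \<le> log \<rho> (real n)" using \<rho> by (simp add: log_nat_power)
        then show ?thesis unfolding i_def by linarith
      qed
      then have "ok (T i) \<omega>" by (rule i0)
      moreover have "T i \<le> n" unfolding T_def using up by (simp add: nat_le_iff ceiling_le_iff)
      moreover have "real n \<le> \<rho> * real (T i)"
      proof -
        have "\<rho> * \<rho> ^ i \<le> \<rho> * real (T i)" using T[of i] \<rho> by (intro mult_left_mono) auto
        then show ?thesis using low by linarith
      qed
      ultimately show ?case unfolding ok_def by blast
    qed
  qed
  then show thesis using that \<rho> by blast
qed

end

theorem theorem1p7:
  fixes M :: "'m measure" and X :: "nat \<Rightarrow> 'm \<Rightarrow> real^'d"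
    and N :: "real^'d \<Rightarrow> real" and f :: "real^'d \<Rightarrow> ennreal" and r :: "nat \<Rightarrow> real"
  assumes "prob_space M"
    and "is_norm N"
    and "prob_space.indep_vars M (\<lambda>_. borel) X {1..}"
    and "\<And>i. i \<ge> 1 \<Longrightarrow> distributed M lborel (X i) f"
    and "\<exists>B::real. \<forall>x. f x \<le> ennreal B"
    and "\<And>n. r n > 0"
    and "r \<longlonglongrightarrow> 0"
  shows "AE \<omega> in M. (\<lambda>n. real (chromatic_number {1..n} (rgg_adj N (\<lambda>i. X i \<omega>) (r n)))
                          / fractional_chromatic_number {1..n} (rgg_adj N (\<lambda>i. X i \<omega>) (r n)))
                   \<longlonglongrightarrow> 1"
proof -
  interpret prob_space M by fact
  have fm[measurable]: "f \<in> borel_measurable lborel"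
    using assms(4)[of 1] by (auto dest: distributed_borel_measurable)
  have X1: "X 1 \<in> borel_measurable M" using assms(3) unfolding indep_vars_def by auto
  have dens: "distr M lborel (X 1) = density lborel f"
    using assms(4)[of 1] by (auto dest: distributed_distr_eq_density)
  obtain B where B: "\<And>x. f x \<le> ennreal B" using assms(5) by blast
  \<comment> \<open>Finite because f is bounded, and positive because otherwise f would vanish
    almost everywhere and could not integrate to 1.\<close>
  define \<sigma> where "\<sigma> = enn2real (esssup lborel f)"
  have es: "esssup lborel f \<le> ennreal B" using B by (intro esssup_I) auto
  then have "esssup lborel f < top" by (rule le_less_trans) simp
  then have es\<sigma>: "esssup lborel f = ennreal \<sigma>" unfolding \<sigma>_def by simp
  have ae: "AE x in lborel. f x \<le> ennreal \<sigma>" using esssup_AE[of f lborel] unfolding es\<sigma> .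
  have \<sigma>0: "0 < \<sigma>"
  proof (rule ccontr)
    assume "\<not> 0 < \<sigma>"
    then have "AE x in lborel. f x = 0" using ae by (simp add: ennreal_neg)
    then have "(\<integral>\<^sup>+x. f x \<partial>lborel) = 0" by (simp add: nn_integral_0_iff_AE)
    moreover have "emeasure (density lborel f) (space lborel) = (\<integral>\<^sup>+x. f x \<partial>lborel)" by (simp add: emeasure_density)
    moreover have "prob_space (density lborel f)" using prob_space_distr[of "X 1" lborel] X1 dens by simp
    then have "emeasure (density lborel f) (space lborel) = 1" using prob_space.emeasure_space_1 by fastforce
    ultimately show False by simp
  qed
  interpret rgg M X f \<sigma>
  proof
    show "indep_vars (\<lambda>_. borel) X {1..}" by fact
    show "distributed M lborel (X i) f" if "1 \<le> i" for i using assms(4) that by blast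
    fix \<sigma>' :: real assume l: "\<sigma>' < \<sigma>"
    show "\<not> (AE x in lborel. f x \<le> ennreal \<sigma>')"
    proof
      assume "AE x in lborel. f x \<le> ennreal \<sigma>'"
      then have "ennreal \<sigma> \<le> ennreal \<sigma>'" unfolding es\<sigma>[symmetric] by (intro esssup_I fm)
      moreover have "ennreal \<sigma>' < ennreal \<sigma>" using l \<sigma>0 by (intro ennreal_lessI) auto
      ultimately show False by simp
    qed
  qed (use \<sigma>0 ae in auto)
  \<comment> \<open>Both the null set and r0 depend on the tolerance, so the tolerances run through
    the countable sequence 1 / (k + 1).\<close>
  have "AE \<omega> in M. \<forall>k::nat. eventually (\<lambda>n. real (chi N \<omega> n (r n)) \<le> (1 + 1 / (real k + 1)) * chi_f N \<omega> n (r n)) sequentially"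
    unfolding AE_all_countable
  proof
    fix k :: nat
    obtain r0 where r0: "0 < r0" "AE \<omega> in M. eventually (\<lambda>n. \<forall>r. 0 < r \<longrightarrow> r < r0 \<longrightarrow> real (chi N \<omega> n r) \<le> (1 + 1 / (real k + 1)) * chi_f N \<omega> n r) sequentially"
      using AE_ratio_bound[OF assms(2), of "1 / (real k + 1)"] by auto
    have small: "eventually (\<lambda>n. r n < r0) sequentially" using assms(7) r0(1) by (rule order_tendstoD)
    show "AE \<omega> in M. eventually (\<lambda>n. real (chi N \<omega> n (r n)) \<le> (1 + 1 / (real k + 1)) * chi_f N \<omega> n (r n)) sequentially"
      using r0(2)
    proof (rule AE_mp, intro AE_I2 impI)
      fix \<omega> assume "eventually (\<lambda>n. \<forall>r. 0 < r \<longrightarrow> r < r0 \<longrightarrow> real (chi N \<omega> n r) \<le> (1 + 1 / (real k + 1)) * chi_f N \<omega> n r) sequentially"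
      then show "eventually (\<lambda>n. real (chi N \<omega> n (r n)) \<le> (1 + 1 / (real k + 1)) * chi_f N \<omega> n (r n)) sequentially"
        using small by eventually_elim (use assms(6) in auto)
    qed
  qed
  then show ?thesis
  proof (rule AE_mp, intro AE_I2 impI)
    fix \<omega> assume H: "\<forall>k::nat. eventually (\<lambda>n. real (chi N \<omega> n (r n)) \<le> (1 + 1 / (real k + 1)) * chi_f N \<omega> n (r n)) sequentially"
    \<comment> \<open>For n \<ge> 1 the quotient has a positive denominator; the value at the empty
      graph does not affect the limit.\<close>
    have pos: "1 \<le> chi_f N \<omega> n (r n)" if n: "1 \<le> n" for n
    proof (rule fractional_chromatic_number_ge)
      fix T assume T: "fractional_cover {1..n} (rgg_adj N (\<lambda>i. X i \<omega>) (r n)) (\<lambda>_. 1) T"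
      have "real (card {1::nat}) \<le> T" by (rule fractional_cover_clique[OF _ _ T]) (use n in auto)
      then show "1 \<le> T" by simp
    qed simp
    show "(\<lambda>n. real (chi N \<omega> n (r n)) / chi_f N \<omega> n (r n)) \<longlonglongrightarrow> 1"
    proof (rule order_tendstoI)
      fix y :: real assume y: "y < 1"
      show "eventually (\<lambda>n. y < real (chi N \<omega> n (r n)) / chi_f N \<omega> n (r n)) sequentially"
        using eventually_ge_at_top[of 1]
      proof eventually_elim
        case (elim n)
        have "1 \<le> real (chi N \<omega> n (r n)) / chi_f N \<omega> n (r n)"
          using pos[OF elim] fractional_chromatic_number_le_chromatic_number[of "{1..n}" "rgg_adj N (\<lambda>i. X i \<omega>) (r n)"]
          by (simp add: le_divide_eq)
        then show ?case using y by linarith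
      qed
    next
      fix y :: real assume y: "1 < y"
      then obtain k :: nat where k: "1 / (real k + 1) < y - 1"
        using reals_Archimedean[of "y - 1"] by (auto simp: inverse_eq_divide add.commute)
      show "eventually (\<lambda>n. real (chi N \<omega> n (r n)) / chi_f N \<omega> n (r n) < y) sequentially"
        using H[rule_format, of k] eventually_ge_at_top[of 1]
      proof eventually_elim
        case (elim n)
        have "real (chi N \<omega> n (r n)) / chi_f N \<omega> n (r n) \<le> 1 + 1 / (real k + 1)"
          using elim(1) pos[OF elim(2)] by (simp add: divide_le_eq)
        then show ?case using k by linarith
      qed
    qed
  qed
qed

end
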